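(* Each of the following seven subsets of $\mathrm{Sym}^+(\mathcal T)$ is a rotationally invariant exact relation (here $J=\begin{pmatrix}1&0\\0&-1\end{pmatrix}$): \[ \mathbb M_8=\{I_2\otimes L+t\mathsf T:\ L\in \mathrm{Sym}^+(\mathbb R^2),\ t\in\mathbb R,\ \det L>t^2\}, \] \[ \mathbb M_{13}=\{\mathfrak L(L,R_\perp):\ L\in\mathrm{Sym}(\mathbb R^2),\ L>\tfrac12 I_2\}, \] \[ \mathbb M_{17}=\{\mathsf L\in\mathrm{Sym}^+(\mathcal T):\ \mathsf L(J\otimes R_\perp)\mathsf L=J\otimes R_\perp\}, \] \[ \mathbb M_{19}=\{\mathfrak L(L,M):\ M^2=-I_2,\ L>0,\ L^{-1}+2MR_\perp<0\}, \] \[ \mathbb M_{20}=\{\mathsf L\in\mathrm{Sym}^+(\mathcal T):\ (\mathsf L-\mathsf T)(J\otimes R_\perp)(\mathsf L-\mathsf T)=0\}=\{\mathfrak L(L,M):\ \det M=1,\ L>0,\ L^{-1}<-2MR_\perp\}, \] \[ \mathbb M_{21}=\{\mathfrak L(L,M):\ L>0,\ L^{-1}<-2MR_\perp\}, \] \[ \mathbb M_{22}=\{\mathsf L\in\mathrm{Sym}^+(\mathcal T):\ \mathsf L(I_2\otimes R_\perp)\mathsf L=I_2\otimes R_\perp\}. \] In the parametrized sets, $L$ ranges over real symmetric $2\times2$ matrices and $M$ over real $2\times 2$ matrices.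
   Context: Let $R_\perp=\begin{pmatrix}0&-1\\1&0\end{pmatrix}$ and let $I_2$ be the $2\times2$ identity. Let $\mathcal T=\mathbb R^2\oplus\mathbb R^2$ with its standard inner product. Operators on $\mathcal T$ are written as $2\times2$ block matrices with real $2\times 2$ blocks, and $A\otimes B$ is the block matrix with blocks $A_{ij}B$. Put $\mathsf T=R_\perp\otimes R_\perp$. $\mathrm{Sym}^+(\mathcal T)$ is the set of symmetric positive definite operators on $\mathcal T$; $\mathrm{Sym}^+(\mathbb R^2)$ is the set of symmetric positive definite real $2\times2$ matrices. For real $2\times2$ matrices $L=L^T$ and $M$, \[ \mathfrak L(L,M)=\begin{pmatrix} L & LM \\ {M^T}L & {M^T}LM \end{pmatrix}+\mathsf T . \] Inequalities between (not necessarily symmetric) real matrices are in the sense of quadratic forms. A composite is a $[0,1]^2$-periodic measurable map $\mathsf L:\mathbb R^2\to\mathrm{Sym}^+(\mathcal T)$ with values in a compact subset of $\mathrm{Sym}^+(\mathcal T)$. Its effective tensor $\mathsf L^*\in\mathrm{Sym}^+(\mathcal T)$ is defined by $\mathsf L^*E_0=\int_{[0,1]^2}\mathsf L(x)E(x)\,dx$ for $E_0\in\mathcal T$, where $E=E_0+(\nabla\varphi_1,\nabla\varphi_2)$ with $\varphi_1,\varphi_2\in H^1_{\rm per}$ is the unique such field for which both $\mathbb R^2$-components of $\mathsf L E$ are divergence-free. An exact relation is a set $\mathbb M\subset\mathrm{Sym}^+(\mathcal T)$ such that $\mathsf L^*\in\mathbb M$ for every composite with $\mathsf L(x)\in\mathbb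 M$ for a.e. $x$. It is rotationally invariant if $(I_2\otimes R)\mathsf L(I_2\otimes R^T)\in\mathbb M$ for all $\mathsf L\in\mathbb M$, $R\in SO(2)$. *)

theory Defs
  imports "HOL-Analysis.Analysis"
begin

type_synonym vec2 = "real ^ 2"
type_synonym mat2 = "real ^ 2 ^ 2"

text \<open>A vector of \<open>\<T>\<close> is indexed by pairs \<open>(\<alpha>, i)\<close>: \<open>\<alpha>\<close> selects the summand, \<open>i\<close> the coordinate inside it.
  The standard inner product of \<open>\<T>\<close> and the operator algebra are then those of the library.\<close>

type_synonym tvec = "real ^ (2 \<times> 2)"
type_synonym tmat = "real ^ (2 \<times> 2) ^ (2 \<times> 2)"

definition tpair :: "vec2 \<Rightarrow> vec2 \<Rightarrow> tvec" where
  "tpair u v = (\<chi> p. if fst p = 1 then u $ snd p else v $ snd p)"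

definition tcomp :: "2 \<Rightarrow> tvec \<Rightarrow> vec2" where
  "tcomp a e = (\<chi> i. e $ (a, i))"

definition block :: "mat2 \<Rightarrow> mat2 \<Rightarrow> mat2 \<Rightarrow> mat2 \<Rightarrow> tmat" where
  "block A B C D = (\<chi> p q.
     (if fst p = 1 then (if fst q = 1 then A else B)
                   else (if fst q = 1 then C else D)) $ snd p $ snd q)"

definition kron :: "mat2 \<Rightarrow> mat2 \<Rightarrow> tmat" (infixr "\<otimes>\<^sub>k" 75) where
  "A \<otimes>\<^sub>k B = block (A $ 1 $ 1 *\<^sub>R B) (A $ 1 $ 2 *\<^sub>R B) (A $ 2 $ 1 *\<^sub>R B) (A $ 2 $ 2 *\<^sub>R B)"

definition Rperp :: mat2 where
  "Rperp = vector [vector [0, -1], vector [1, 0]]"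

definition Jmat :: mat2 where
  "Jmat = vector [vector [1, 0], vector [0, -1]]"

abbreviation I2 :: mat2 where
  "I2 \<equiv> mat 1"

definition TT :: tmat where
  "TT = Rperp \<otimes>\<^sub>k Rperp"

text \<open>Strict inequality in the sense of quadratic forms; symmetry is not required.\<close>

definition qless :: "real ^ 'n ^ 'n \<Rightarrow> real ^ 'n ^ 'n \<Rightarrow> bool" (infix "\<prec>" 50) where
  "A \<prec> B \<longleftrightarrow> (\<forall>x. x \<noteq> 0 \<longrightarrow> x \<bullet> (A *v x) < x \<bullet> (B *v x))"

definition Sym :: "(real ^ 'n ^ 'n) set" where
  "Sym = {A. transpose A = A}"

definition SymPos :: "(real ^ 'n ^ 'n) set" where
  "SymPos = {A \<in> Sym. 0 \<prec> A}"

definition frakL :: "mat2 \<Rightarrow> mat2 \<Rightarrow> tmat" where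
  "frakL L M = block L (L ** M) (transpose M ** L) (transpose M ** L ** M) + TT"

definition periodic :: "(vec2 \<Rightarrow> 'b) \<Rightarrow> bool" where
  "periodic f \<longleftrightarrow> (\<forall>x i. f (x + axis i 1) = f x)"

abbreviation cell :: "vec2 measure" where
  "cell \<equiv> lebesgue_on (cbox 0 1)"

definition partial :: "2 \<Rightarrow> (vec2 \<Rightarrow> real) \<Rightarrow> vec2 \<Rightarrow> real" where
  "partial i f x = frechet_derivative f (at x) (axis i 1)"

definition grad :: "(vec2 \<Rightarrow> real) \<Rightarrow> vec2 \<Rightarrow> vec2" where
  "grad f x = (\<chi> i. partial i f x)"

fun Ck :: "nat \<Rightarrow> (vec2 \<Rightarrow> real) \<Rightarrow> bool" where
  "Ck 0 f \<longleftrightarrow> continuous_on UNIV f"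
| "Ck (Suc k) f \<longleftrightarrow> f differentiable_on UNIV \<and> (\<forall>i. Ck k (partial i f))"

definition smooth_per :: "(vec2 \<Rightarrow> real) \<Rightarrow> bool" where
  "smooth_per f \<longleftrightarrow> periodic f \<and> (\<forall>k. Ck k f)"

definition L2_per :: "(vec2 \<Rightarrow> 'b::euclidean_space) \<Rightarrow> bool" where
  "L2_per f \<longleftrightarrow> f \<in> borel_measurable lebesgue \<and> periodic f \<and> integrable cell (\<lambda>x. (norm (f x))\<^sup>2)"

definition L2_tendsto :: "(nat \<Rightarrow> vec2 \<Rightarrow> 'b::euclidean_space) \<Rightarrow> (vec2 \<Rightarrow> 'b) \<Rightarrow> bool" where
  "L2_tendsto u f \<longleftrightarrow> (\<lambda>n. LINT x|cell. (norm (u n x - f x))\<^sup>2) \<longlonglongrightarrow> 0"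

text \<open>\<open>H\<^sup>1\<^sub>p\<^sub>e\<^sub>r\<close> is the closure of the smooth periodic functions in the \<open>H\<^sup>1\<close> norm of the unit cell;
  \<open>H1_per_grad \<phi> g\<close> says that \<open>\<phi>\<close> lies in it and has (weak) gradient \<open>g\<close>.\<close>

definition H1_per_grad :: "(vec2 \<Rightarrow> real) \<Rightarrow> (vec2 \<Rightarrow> vec2) \<Rightarrow> bool" where
  "H1_per_grad \<phi> g \<longleftrightarrow> L2_per \<phi> \<and> L2_per g \<and>
     (\<exists>u. (\<forall>n. smooth_per (u n)) \<and> L2_tendsto u \<phi> \<and> L2_tendsto (\<lambda>n. grad (u n)) g)"

text \<open>Divergence-free in the sense of distributions on the torus.\<close>

definition div_free :: "(vec2 \<Rightarrow> vec2) \<Rightarrow> bool" where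
  "div_free F \<longleftrightarrow> L2_per F \<and> (\<forall>\<psi>. smooth_per \<psi> \<longrightarrow> (LINT x|cell. F x \<bullet> grad \<psi> x) = 0)"

definition composite :: "(vec2 \<Rightarrow> tmat) \<Rightarrow> bool" where
  "composite L \<longleftrightarrow> L \<in> borel_measurable lebesgue \<and> periodic L \<and>
     (\<exists>K. compact K \<and> K \<subseteq> SymPos \<and> range L \<subseteq> K)"

definition cell_field :: "(vec2 \<Rightarrow> tmat) \<Rightarrow> tvec \<Rightarrow> (vec2 \<Rightarrow> tvec) \<Rightarrow> bool" where
  "cell_field L E0 E \<longleftrightarrow>
     (\<exists>\<phi>1 \<phi>2 g1 g2. H1_per_grad \<phi>1 g1 \<and> H1_per_grad \<phi>2 g2 \<and>
        E = (\<lambda>x. E0 + tpair (g1 x) (g2 x))) \<and>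
     (\<forall>a. div_free (\<lambda>x. tcomp a (L x *v E x)))"

definition effective_tensor :: "(vec2 \<Rightarrow> tmat) \<Rightarrow> tmat" where
  "effective_tensor L =
     (THE Ls. \<forall>E0. \<exists>E. cell_field L E0 E \<and> Ls *v E0 = (LINT x|cell. L x *v E x))"

definition exact_relation :: "tmat set \<Rightarrow> bool" where
  "exact_relation \<M> \<longleftrightarrow> \<M> \<subseteq> SymPos \<and>
     (\<forall>L. composite L \<and> (AE x in lebesgue. L x \<in> \<M>) \<longrightarrow> effective_tensor L \<in> \<M>)"

definition rotationally_invariant :: "tmat set \<Rightarrow> bool" where
  "rotationally_invariant \<M> \<longleftrightarrow>
     (\<forall>L\<in>\<M>. \<forall>R. rotation_matrix R \<longrightarrow> (I2 \<otimes>\<^sub>k R) ** L ** (I2 \<otimes>\<^sub>k transpose R) \<in> \<M>)"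

definition M8 :: "tmat set" where
  "M8 = {I2 \<otimes>\<^sub>k L + t *\<^sub>R TT | L t. L \<in> SymPos \<and> det L > t\<^sup>2}"

definition M13 :: "tmat set" where
  "M13 = {frakL L Rperp | L. L \<in> Sym \<and> (1/2) *\<^sub>R I2 \<prec> L}"

definition M17 :: "tmat set" where
  "M17 = {L \<in> SymPos. L ** (Jmat \<otimes>\<^sub>k Rperp) ** L = Jmat \<otimes>\<^sub>k Rperp}"

definition M19 :: "tmat set" where
  "M19 = {frakL L M | L M. L \<in> Sym \<and> M ** M = - I2 \<and> 0 \<prec> L \<and>
     matrix_inv L + 2 *\<^sub>R (M ** Rperp) \<prec> 0}"

definition M20 :: "tmat set" where
  "M20 = {L \<in> SymPos. (L - TT) ** (Jmat \<otimes>\<^sub>k Rperp) ** (L - TT) = 0}"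

definition M20_param :: "tmat set" where
  "M20_param = {frakL L M | L M. L \<in> Sym \<and> det M = 1 \<and> 0 \<prec> L \<and>
     matrix_inv L \<prec> - (2 *\<^sub>R (M ** Rperp))}"

definition M21 :: "tmat set" where
  "M21 = {frakL L M | L M. L \<in> Sym \<and> 0 \<prec> L \<and> matrix_inv L \<prec> - (2 *\<^sub>R (M ** Rperp))}"

definition M22 :: "tmat set" where
  "M22 = {L \<in> SymPos. L ** (I2 \<otimes>\<^sub>k Rperp) ** L = I2 \<otimes>\<^sub>k Rperp}"

end

theory Submission
  imports Defs
begin

text \<open>In the plane, the quarter turn \<open>R\<^sub>\<perp>\<close> maps gradients to divergence-free fields and, by the
  Helmholtz decomposition, mean-zero divergence-free fields to gradients. If \<open>E\<close> solves the cell problem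
  of \<open>L\<close>, then \<open>T E\<close> is divergence-free, hence so are \<open>J = L E\<close> and \<open>(L - T) E\<close>. A relation such as
  \<open>L Q L = Q\<close> or \<open>(L - T) Q (L - T) = 0\<close> with \<open>Q = A \<otimes> R\<^sub>\<perp>\<close> therefore makes \<open>Q J\<close>, respectively
  \<open>Q (L - T) E\<close>, a new cell solution whose mean and mean flux are known, and the relation passes to the
  effective tensor; \<open>M\<^sub>8\<close> is the commutant of \<open>R\<^sub>\<perp> \<otimes> I\<close>. The remaining sets consist of the
  positive \<open>L\<close> for which \<open>L - T\<close> has a two-dimensional kernel, a graph \<open>{(- M v, v)}\<close>, with a
  restriction on \<open>M\<close> or none. For \<open>M\<^sub>1\<^sub>3\<close> the kernel is constant. For \<open>M\<^sub>2\<^sub>1\<close> one prescribes the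
  mean of \<open>E\<close> so that the first component of \<open>(L - T) E\<close> has mean zero; its quarter turn is then a
  gradient, and pairing it with the second component gives an integrand of one sign with integral
  zero, so that \<open>(L - T) E = 0\<close>.\<close>

section \<open>Square integrable functions\<close>

text \<open>Gradients are defined by smooth approximation and divergence-free fields by smooth test
  functions, so the analysis rests on three facts about smooth periodic functions: the null
  Lagrangian identity, obtained from finite differences and translation invariance; the Poincare
  inequality, which supplies a potential for a limit of gradients; and completeness of the
  trigonometric system, which rules out a nonzero mean-zero field that is both divergence-free and
  curl-free. One variational projection serves twice: with weight \<open>L\<close> it solves the
  cell problem, with the identity as weight it yields the Helmholtz decomposition. Each set is
  rewritten as \<open>{L \<in> SymPos. Q L}\<close>. The effective tensor is always positive, so
  only \<open>Q\<close> has to be inherited. The inequalities in the parametrized sets are what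
  positivity becomes after completing a square. For \<open>M19\<close>, the equation
  \<open>M ** M = - I2\<close> splits into determinant one and trace zero, each of them a null
  relation with its own \<open>A\<close>. For \<open>M21\<close> the kernel may vary with
  \<open>x\<close> and no fixed \<open>A\<close> is at hand; there positivity of \<open>L\<close>
  itself supplies the sign of the integrand.\<close>

definition sq_int :: "'a measure \<Rightarrow> ('a \<Rightarrow> 'b::euclidean_space) \<Rightarrow> bool" where
  "sq_int M f \<longleftrightarrow> f \<in> borel_measurable M \<and> integrable M (\<lambda>x. (norm (f x))\<^sup>2)"

lemma sq_int_measurable: "sq_int M f \<Longrightarrow> f \<in> borel_measurable M"
  and sq_int_integrable: "sq_int M f \<Longrightarrow> integrable M (\<lambda>x. (norm (f x))\<^sup>2)"
  by (auto simp: sq_int_def)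

lemma norm_add_sq_le: "(norm (a + b :: 'b::real_inner))\<^sup>2 \<le> 2 * (norm a)\<^sup>2 + 2 * (norm b)\<^sup>2"
proof -
  have "0 \<le> (norm (a - b))\<^sup>2" by simp
  then show ?thesis by (simp add: power2_norm_eq_inner inner_simps inner_commute)
qed

lemma sq_int_bound:
  assumes "sq_int M f" "g \<in> borel_measurable M" "AE x in M. norm (g x) \<le> C * norm (f x)"
  shows "sq_int M g"
  unfolding sq_int_def
proof
  note [measurable] = assms(2)
  show "integrable M (\<lambda>x. (norm (g x))\<^sup>2)"
  proof (rule Bochner_Integration.integrable_bound)
    show "integrable M (\<lambda>x. C\<^sup>2 * (norm (f x))\<^sup>2)" using assms(1) by (simp add: sq_int_def)
    have "AE x in M. (norm (g x))\<^sup>2 \<le> (C * norm (f x))\<^sup>2"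
      using assms(3) by eventually_elim (simp add: power_mono)
    then show "AE x in M. norm ((norm (g x))\<^sup>2) \<le> norm (C\<^sup>2 * (norm (f x))\<^sup>2)"
      by (simp add: power_mult_distrib)
  qed measurable
qed fact

lemma sq_int_add:
  assumes "sq_int M f" "sq_int M g"
  shows "sq_int M (\<lambda>x. f x + g x)"
  unfolding sq_int_def
proof
  note [measurable] = assms[THEN sq_int_measurable]
  show "(\<lambda>x. f x + g x) \<in> borel_measurable M" by measurable
  show "integrable M (\<lambda>x. (norm (f x + g x))\<^sup>2)"
  proof (rule Bochner_Integration.integrable_bound)
    show "integrable M (\<lambda>x. 2 * (norm (f x))\<^sup>2 + 2 * (norm (g x))\<^sup>2)"
      using assms by (simp add: sq_int_def)
    show "AE x in M. norm ((norm (f x + g x))\<^sup>2) \<le> norm (2 * (norm (f x))\<^sup>2 + 2 * (norm (g x))\<^sup>2)"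
      by (intro AE_I2) (use norm_add_sq_le in auto)
  qed measurable
qed

lemma sq_int_scaleR: "sq_int M f \<Longrightarrow> sq_int M (\<lambda>x. c *\<^sub>R f x)"
  by (rule sq_int_bound[where C="\<bar>c\<bar>" and f=f]) (auto simp: sq_int_def)

lemma sq_int_diff: "sq_int M f \<Longrightarrow> sq_int M g \<Longrightarrow> sq_int M (\<lambda>x. f x - g x)"
  using sq_int_add[of M f "\<lambda>x. (-1) *\<^sub>R g x"] sq_int_scaleR[of M g "-1"] by simp

lemma (in finite_measure) sq_int_const: "sq_int M (\<lambda>x. c)"
  by (simp add: sq_int_def)

lemma abs_inner_le_sq: "\<bar>a \<bullet> b\<bar> \<le> (norm a)\<^sup>2 + (norm (b::'b::real_inner))\<^sup>2"
proof -
  have "\<bar>a \<bullet> b\<bar> \<le> norm a * norm b" by (rule Cauchy_Schwarz_ineq2)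
  also have "\<dots> \<le> (norm a)\<^sup>2 + (norm b)\<^sup>2"
    using sum_squares_bound[of "norm a" "norm b"] mult_nonneg_nonneg[OF norm_ge_zero[of a] norm_ge_zero[of b]]
    by linarith
  finally show ?thesis .
qed

lemma sq_int_inner:
  assumes "sq_int M f" "sq_int M g"
  shows "integrable M (\<lambda>x. f x \<bullet> g x)"
proof (rule Bochner_Integration.integrable_bound)
  note [measurable] = assms[THEN sq_int_measurable]
  show "integrable M (\<lambda>x. (norm (f x))\<^sup>2 + (norm (g x))\<^sup>2)"
    using assms by (simp add: sq_int_def)
  show "AE x in M. norm (f x \<bullet> g x) \<le> norm ((norm (f x))\<^sup>2 + (norm (g x))\<^sup>2)"
    by (intro AE_I2) (use abs_inner_le_sq in auto)
qed (use assms in \<open>auto simp: sq_int_def\<close>)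

lemma (in finite_measure) sq_int_imp_integrable:
  assumes "sq_int M f" shows "integrable M f"
proof (rule Bochner_Integration.integrable_bound)
  show "integrable M (\<lambda>x. 1 + (norm (f x))\<^sup>2)"
    using assms by (simp add: sq_int_def)
  show "AE x in M. norm (f x) \<le> norm (1 + (norm (f x))\<^sup>2)"
  proof (intro AE_I2)
    fix x
    have "0 \<le> (norm (f x) - 1)\<^sup>2" by simp
    then have "2 * norm (f x) \<le> 1 + (norm (f x))\<^sup>2" by (simp add: power2_diff)
    then show "norm (f x) \<le> norm (1 + (norm (f x))\<^sup>2)"
      using norm_ge_zero[of "f x"] unfolding real_norm_def by linarith
  qed
qed (use assms in \<open>auto simp: sq_int_def\<close>)

text \<open>The quadratic in \<open>t\<close> is evaluated at its minimum. The case
  \<open>c = 0\<close> has to be covered: in the Euler--Lagrange estimate \<open>c\<close> is the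
  energy of an arbitrary test field, possibly zero.\<close>

lemma discriminant_ineq:
  fixes a b c :: real
  assumes "\<And>t. 0 \<le> a + 2 * t * b + t\<^sup>2 * c" "0 \<le> c" "0 \<le> a"
  shows "b\<^sup>2 \<le> a * c"
proof (cases "c = 0")
  case True
  have "b = 0"
  proof (rule ccontr)
    assume "b \<noteq> 0"
    \<comment> \<open>At this \<open>t\<close> the affine function \<open>a + 2 * t * b\<close>
      equals -1.\<close>
    with assms(1)[of "- (a + 1) / (2 * b)"] True show False by (simp add: field_simps)
  qed
  then show ?thesis using True by simp
next
  case False
  then have "c > 0" using assms by simp
  have "0 \<le> a + 2 * (-b/c) * b + (-b/c)\<^sup>2 * c" by (rule assms)
  also have "\<dots> = a - b\<^sup>2 / c" using \<open>c > 0\<close> by (simp add: field_simps power2_eq_square)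
  finally show ?thesis using \<open>c > 0\<close> by (simp add: field_simps)
qed

lemma sq_int_cauchy_schwarz:
  assumes f: "sq_int M f" and g: "sq_int M g"
  shows "(LINT x|M. f x \<bullet> g x)\<^sup>2 \<le> (LINT x|M. (norm (f x))\<^sup>2) * (LINT x|M. (norm (g x))\<^sup>2)"
proof (rule discriminant_ineq)
  fix t :: real
  have "0 \<le> (LINT x|M. (norm (f x + t *\<^sub>R g x))\<^sup>2)" by simp
  also have "\<dots> = (LINT x|M. (norm (f x))\<^sup>2 + (2 * t * (f x \<bullet> g x) + t\<^sup>2 * (norm (g x))\<^sup>2))"
    by (intro Bochner_Integration.integral_cong refl)
      (simp add: power2_norm_eq_inner inner_add_left inner_add_right inner_commute[of "g _" "f _"] power2_eq_square[of t] distrib_left)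
  also have "\<dots> = (LINT x|M. (norm (f x))\<^sup>2) + 2 * t * (LINT x|M. f x \<bullet> g x) + t\<^sup>2 * (LINT x|M. (norm (g x))\<^sup>2)"
    using sq_int_inner[OF f g] f g by (simp add: sq_int_def)
  finally show "0 \<le> \<dots>" .
qed auto

text \<open>The error is the pairing of \<open>u n - f\<close> with \<open>g\<close>, which
  Cauchy--Schwarz controls.\<close>

lemma sq_int_inner_tendsto:
  assumes u: "\<And>n. sq_int M (u n)" and f: "sq_int M f" and g: "sq_int M g"
    and lim: "(\<lambda>n. LINT x|M. (norm (u n x - f x))\<^sup>2) \<longlonglongrightarrow> 0"
  shows "(\<lambda>n. LINT x|M. u n x \<bullet> g x) \<longlonglongrightarrow> (LINT x|M. f x \<bullet> g x)"
proof -
  let ?d = "\<lambda>n. LINT x|M. (u n x - f x) \<bullet> g x"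
  let ?a = "\<lambda>n. LINT x|M. (norm (u n x - f x))\<^sup>2"
  let ?c = "LINT x|M. (norm (g x))\<^sup>2"
  have "(\<lambda>n. sqrt (?a n * ?c)) \<longlonglongrightarrow> sqrt (0 * ?c)"
    by (intro tendsto_intros lim)
  moreover have "norm (?d n) \<le> sqrt (?a n * ?c)" for n
    using real_sqrt_le_mono[OF sq_int_cauchy_schwarz[OF sq_int_diff[OF u f] g, of n]] by simp
  ultimately have "?d \<longlonglongrightarrow> 0"
    by (intro Lim_null_comparison[of ?d]) (auto intro: always_eventually)
  moreover have "?d n = (LINT x|M. u n x \<bullet> g x) - (LINT x|M. f x \<bullet> g x)" for n
    using sq_int_inner[OF u g] sq_int_inner[OF f g] by (simp add: inner_diff_left)
  ultimately show ?thesis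
    by (simp add: LIM_zero_iff)
qed

text \<open>Riesz--Fischer.  The limit is the pointwise limit of a subsequence, so that pointwise identities
  satisfied by the whole sequence, such as periodicity, are inherited everywhere.\<close>

lemma sq_int_complete:
  fixes u :: "nat \<Rightarrow> 'a \<Rightarrow> 'b::euclidean_space"
  assumes M: "finite_measure M" and u: "\<And>n. sq_int M (u n)"
    and cauchy: "\<And>e. e > 0 \<Longrightarrow> \<exists>N. \<forall>m\<ge>N. \<forall>n\<ge>N. (LINT x|M. (norm (u m x - u n x))\<^sup>2) < e"
  obtains r where "strict_mono (r::nat\<Rightarrow>nat)" "sq_int M (\<lambda>x. lim (\<lambda>k. u (r k) x))"
    "(\<lambda>n. LINT x|M. (norm (u n x - lim (\<lambda>k. u (r k) x)))\<^sup>2) \<longlonglongrightarrow> 0"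
proof -
  interpret finite_measure M by fact
  note [measurable] = u[THEN sq_int_measurable]
  \<comment> \<open>The rate \<open>(1/4)^k\<close> for the squares gives \<open>(1/2)^k\<close> for
    the mean absolute increments, which is summable.\<close>
  have "\<exists>N. \<forall>m\<ge>N. \<forall>n\<ge>N. (LINT x|M. (norm (u m x - u n x))\<^sup>2) < (1/4)^k" for k::nat
    by (rule cauchy) simp
  then obtain N where N: "\<And>k m n. m \<ge> N k \<Longrightarrow> n \<ge> N k \<Longrightarrow> (LINT x|M. (norm (u m x - u n x))\<^sup>2) < (1/4)^k"
    by metis
  \<comment> \<open>The maximum with \<open>Suc m\<close> makes \<open>r\<close> strictly increasing
    while keeping \<open>r k \<ge> N k\<close>.\<close>
  define r where "r = rec_nat (N 0) (\<lambda>k m. max (Suc m) (N (Suc k)))"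
  have r_Suc: "r (Suc k) = max (Suc (r k)) (N (Suc k))" for k by (simp add: r_def)
  have r_mono: "strict_mono r" by (rule strict_monoI_Suc) (simp add: r_Suc)
  have r_ge: "r k \<ge> N k" for k by (cases k) (auto simp: r_Suc r_def)
  define d where "d k x = u (r (Suc k)) x - u (r k) x" for k x
  have [measurable]: "d k \<in> borel_measurable M" for k unfolding d_def by measurable
  have sd: "sq_int M (d k)" for k unfolding d_def by (intro sq_int_diff u)
  define c where "c = sqrt (measure M (space M))"
  have c0: "0 \<le> c" by (simp add: c_def)
  have dint: "integrable M (\<lambda>x. norm (d k x))" for k
    using sq_int_imp_integrable[OF sd] by (rule integrable_norm)
  have dsmall: "(LINT x|M. norm (d k x)) \<le> c * (1/2)^k" for k
  proof -
    have s1: "sq_int M (\<lambda>x. norm (d k x))" using sd by (auto simp: sq_int_def)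
    have "(LINT x|M. norm (d k x))\<^sup>2 \<le> (LINT x|M. (norm (d k x))\<^sup>2) * c\<^sup>2"
      using sq_int_cauchy_schwarz[OF s1 sq_int_const[of "1::real"]] by (simp add: c_def)
    also have "\<dots> \<le> (1/4)^k * c\<^sup>2"
    proof (intro mult_right_mono)
      have "N k \<le> r (Suc k)" using r_ge[of k] by (simp add: r_Suc)
      then show "(LINT x|M. (norm (d k x))\<^sup>2) \<le> (1/4)^k"
        using N[of k "r (Suc k)" "r k"] r_ge[of k] by (simp add: d_def)
    qed simp
    also have "\<dots> = (c * (1/2)^k)\<^sup>2"
    proof -
      have "((1/2)^k)\<^sup>2 = ((1/4::real))^k" by (simp add: power2_eq_square flip: power_mult_distrib)
      then show ?thesis by (simp add: power_mult_distrib)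
    qed
    finally show ?thesis
      using c0 by (auto elim!: power2_le_imp_le)
  qed
  \<comment> \<open>A finite total increment in mean makes the telescoping series converge
    absolutely almost everywhere.\<close>
  have "(\<integral>\<^sup>+x. (\<Sum>k. ennreal (norm (d k x))) \<partial>M) = (\<Sum>k. \<integral>\<^sup>+x. ennreal (norm (d k x)) \<partial>M)"
    by (intro nn_integral_suminf) measurable
  also have "\<dots> \<le> (\<Sum>k. ennreal (c * (1/2)^k))"
    using dsmall dint by (intro suminf_le) (auto simp: nn_integral_eq_integral intro!: ennreal_leI)
  also have "\<dots> = ennreal (\<Sum>k. c * (1/2)^k)"
    using c0 by (intro suminf_ennreal2) (auto intro!: summable_mult summable_geometric)
  finally have "(\<integral>\<^sup>+x. (\<Sum>k. ennreal (norm (d k x))) \<partial>M) \<noteq> \<infinity>"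
    by (auto simp: top_unique)
  then have ae: "AE x in M. (\<Sum>k. ennreal (norm (d k x))) \<noteq> \<infinity>"
    by (intro nn_integral_PInf_AE) measurable
  define f where "f x = lim (\<lambda>k. u (r k) x)" for x
  have [measurable]: "f \<in> borel_measurable M" unfolding f_def by measurable
  have conv: "AE x in M. (\<lambda>k. u (r k) x) \<longlonglongrightarrow> f x"
    using ae
  proof eventually_elim
    fix x assume "(\<Sum>k. ennreal (norm (d k x))) \<noteq> \<infinity>"
    then have "summable (\<lambda>k. norm (d k x))"
      by (intro summable_suminf_not_top) auto
    then have "summable (\<lambda>k. d k x)" by (rule summable_norm_cancel)
    then have "convergent (\<lambda>n. u (r 0) x + (\<Sum>k<n. d k x))"
      by (intro convergent_add convergent_const) (simp add: summable_iff_convergent)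
    moreover have "u (r 0) x + (\<Sum>k<n. d k x) = u (r n) x" for n
      unfolding d_def by (simp add: sum_lessThan_telescope[of "\<lambda>k. u (r k) x"])
    ultimately have "convergent (\<lambda>k. u (r k) x)" by simp
    then show "(\<lambda>k. u (r k) x) \<longlonglongrightarrow> f x" unfolding f_def by (simp add: convergent_LIMSEQ_iff)
  qed
  \<comment> \<open>Fatou's lemma along the subsequence with \<open>n\<close> fixed: the Cauchy
    bound survives in the limit, so the whole sequence converges, not only the subsequence.\<close>
  have fatou: "integrable M (\<lambda>x. (norm (u n x - f x))\<^sup>2) \<and> (LINT x|M. (norm (u n x - f x))\<^sup>2) \<le> e"
    if e: "0 < e" and n: "\<And>m k. m \<ge> N \<Longrightarrow> k \<ge> N \<Longrightarrow> (LINT x|M. (norm (u m x - u k x))\<^sup>2) < e" "n \<ge> N" for e N n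
  proof -
    have lim: "AE x in M. (\<lambda>k. (norm (u n x - u (r k) x))\<^sup>2) \<longlonglongrightarrow> (norm (u n x - f x))\<^sup>2"
      using conv by eventually_elim (intro tendsto_intros)
    have "(\<integral>\<^sup>+x. ennreal ((norm (u n x - f x))\<^sup>2) \<partial>M)
       = (\<integral>\<^sup>+x. liminf (\<lambda>k. ennreal ((norm (u n x - u (r k) x))\<^sup>2)) \<partial>M)"
    proof (rule nn_integral_cong_AE)
      show "AE x in M. ennreal ((norm (u n x - f x))\<^sup>2) = liminf (\<lambda>k. ennreal ((norm (u n x - u (r k) x))\<^sup>2))"
        using lim by eventually_elim (metis tendsto_ennrealI lim_imp_Liminf sequentially_bot)
    qed
    also have "\<dots> \<le> liminf (\<lambda>k. \<integral>\<^sup>+x. ennreal ((norm (u n x - u (r k) x))\<^sup>2) \<partial>M)"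
      by (intro nn_integral_liminf) measurable
    also have "\<dots> \<le> ennreal e"
    proof -
      have "\<forall>\<^sub>F k in sequentially. (\<integral>\<^sup>+x. ennreal ((norm (u n x - u (r k) x))\<^sup>2) \<partial>M) \<le> ennreal e"
        using eventually_ge_at_top[of N]
      proof eventually_elim
        fix k assume "N \<le> k"
        then have "N \<le> r k" using seq_suble[OF r_mono, of k] by linarith
        then have "(LINT x|M. (norm (u n x - u (r k) x))\<^sup>2) \<le> e" using n by (simp add: less_imp_le)
        moreover have "integrable M (\<lambda>x. (norm (u n x - u (r k) x))\<^sup>2)"
          by (intro sq_int_integrable sq_int_diff u)
        ultimately show "(\<integral>\<^sup>+x. ennreal ((norm (u n x - u (r k) x))\<^sup>2) \<partial>M) \<le> ennreal e"
          by (simp add: nn_integral_eq_integral ennreal_leI)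
      qed
      then show ?thesis by (intro Liminf_le) auto
    qed
    finally have le: "(\<integral>\<^sup>+x. ennreal ((norm (u n x - f x))\<^sup>2) \<partial>M) \<le> ennreal e" .
    then have i: "integrable M (\<lambda>x. (norm (u n x - f x))\<^sup>2)"
      by (intro integrableI_bounded) (auto intro: le_less_trans[OF _ ennreal_less_top])
    with le e show ?thesis by (simp add: nn_integral_eq_integral)
  qed
  have lim: "(\<lambda>n. LINT x|M. (norm (u n x - f x))\<^sup>2) \<longlonglongrightarrow> 0"
  proof (rule LIMSEQ_I)
    fix e :: real assume "e > 0"
    then obtain N where "\<forall>m\<ge>N. \<forall>n\<ge>N. (LINT x|M. (norm (u m x - u n x))\<^sup>2) < e/2"
      using cauchy[of "e/2"] by auto
    then have "(LINT x|M. (norm (u n x - f x))\<^sup>2) \<le> e/2" if "n \<ge> N" for n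
      using fatou[of "e/2" N n] that \<open>e > 0\<close> by auto
    then have "norm ((LINT x|M. (norm (u n x - f x))\<^sup>2) - 0) < e" if "n \<ge> N" for n
      using that \<open>e > 0\<close> by fastforce
    then show "\<exists>no. \<forall>n\<ge>no. norm ((LINT x|M. (norm (u n x - f x))\<^sup>2) - 0) < e"
      by blast
  qed
  have "sq_int M f"
  proof -
    obtain N where "\<forall>m\<ge>N. \<forall>n\<ge>N. (LINT x|M. (norm (u m x - u n x))\<^sup>2) < 1"
      using cauchy[of 1] by auto
    then have "sq_int M (\<lambda>x. u N x - f x)"
      using fatou[of 1 N N] by (auto simp: sq_int_def)
    from sq_int_diff[OF u[of N] this] show ?thesis by simp
  qed
  with r_mono lim show thesis unfolding f_def by (intro that)
qed

section \<open>The unit cell as a probability space, and periodic square integrable fields\<close>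

lemma space_cell [simp]: "space cell = cbox 0 1"
  by (simp add: space_restrict_space)

lemma emeasure_cell [simp]: "emeasure cell (cbox 0 1) = 1"
proof -
  have *: "(0::vec2) \<bullet> b \<le> 1 \<bullet> b \<and> (1::vec2) \<bullet> b = 1" if "b \<in> Basis" for b
    using that by (auto simp: Basis_vec_def inner_axis)
  have "emeasure lborel (cbox (0::vec2) 1) = 1"
    using * by (subst emeasure_lborel_cbox) (auto simp: inner_diff_left)
  then show ?thesis by (simp add: emeasure_restrict_space)
qed

lemma measure_cell [simp]: "measure cell (cbox 0 1) = 1"
  by (simp add: measure_def)

lemma finite_measure_cell: "finite_measure cell"
  by (rule finite_measureI) simp

interpretation cell: finite_measure cell
  by (rule finite_measure_cell)

lemma continuous_borel_cell:
  "continuous_on UNIV f \<Longrightarrow> f \<in> borel_measurable cell"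
  by (intro measurable_restrict_space1 measurable_completion) (simp add: borel_measurable_continuous_onI)

lemma continuous_integrable_cell:
  fixes f :: "vec2 \<Rightarrow> 'b::euclidean_space"
  assumes "continuous_on UNIV f"
  shows "integrable cell f"
proof -
  have "bounded (f ` cbox 0 1)"
    using assms by (intro compact_imp_bounded compact_continuous_image) (auto intro: continuous_on_subset)
  then obtain B where "\<And>x. x \<in> cbox 0 1 \<Longrightarrow> norm (f x) \<le> B"
    by (auto simp: bounded_iff)
  then show ?thesis
    by (intro cell.integrable_const_bound[where B=B] AE_I2 continuous_borel_cell assms) auto
qed

lemma integral_cell_eq:
  fixes f :: "vec2 \<Rightarrow> 'b::euclidean_space"
  assumes "continuous_on UNIV f"
  shows "(LINT x|cell. f x) = integral (cbox 0 1) f"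
  by (rule lebesgue_integral_eq_integral[OF continuous_integrable_cell[OF assms]]) simp

lemma continuous_L2_per:
  assumes "continuous_on UNIV f" "periodic f"
  shows "L2_per f"
  unfolding L2_per_def
  using assms by (auto intro!: measurable_completion borel_measurable_continuous_onI
    continuous_integrable_cell continuous_intros)

lemma L2_per_sq_int: "L2_per f \<Longrightarrow> sq_int cell f"
  by (auto simp: L2_per_def sq_int_def intro: measurable_restrict_space1)

lemma L2_per_const: "L2_per (\<lambda>x. c)"
  by (auto simp: L2_per_def periodic_def)

lemma L2_per_iff: "L2_per f \<longleftrightarrow> f \<in> borel_measurable lebesgue \<and> periodic f \<and> sq_int cell f"
  by (auto simp: L2_per_def sq_int_def intro: measurable_restrict_space1)

lemma L2_per_add: "L2_per f \<Longrightarrow> L2_per g \<Longrightarrow> L2_per (\<lambda>x. f x + g x)"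
  unfolding L2_per_iff by (auto simp: periodic_def sq_int_add)

lemma L2_per_scaleR: "L2_per f \<Longrightarrow> L2_per (\<lambda>x. c *\<^sub>R f x)"
  unfolding L2_per_iff by (auto simp: periodic_def sq_int_scaleR)

lemma L2_per_diff: "L2_per f \<Longrightarrow> L2_per g \<Longrightarrow> L2_per (\<lambda>x. f x - g x)"
  unfolding L2_per_iff by (auto simp: periodic_def sq_int_diff)

lemma L2_per_bounded_linear:
  assumes "bounded_linear T" "L2_per f"
  shows "L2_per (\<lambda>x. T (f x))"
proof -
  obtain K where K: "\<And>x. norm (T x) \<le> norm x * K"
    using bounded_linear.bounded[OF assms(1)] by auto
  have T: "T \<in> borel_measurable borel"
    by (intro borel_measurable_continuous_onI linear_continuous_on assms)
  have m: "(\<lambda>x. T (f x)) \<in> borel_measurable lebesgue"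
    using assms(2) T measurable_compose[of f lebesgue borel T borel] by (auto simp: L2_per_def)
  have "sq_int cell (\<lambda>x. T (f x))"
    by (rule sq_int_bound[OF L2_per_sq_int[OF assms(2)], where C=K])
      (use m K in \<open>auto intro: measurable_restrict_space1 simp: mult.commute\<close>)
  with m assms(2) show ?thesis by (auto simp: L2_per_iff periodic_def)
qed

section \<open>Smooth periodic functions\<close>

lemma partial_add:
  assumes "f differentiable_on UNIV" "g differentiable_on UNIV"
  shows "partial i (\<lambda>x. f x + g x) = (\<lambda>x. partial i f x + partial i g x)"
proof
  fix x
  have "f differentiable (at x)" "g differentiable (at x)"
    using assms by (auto simp: differentiable_on_def)
  then have "frechet_derivative (\<lambda>x. f x + g x) (at x)
     = (\<lambda>h. frechet_derivative f (at x) h + frechet_derivative g (at x) h)"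
    by (intro frechet_derivative_at[symmetric] has_derivative_add) (simp_all add: frechet_derivative_works)
  then show "partial i (\<lambda>x. f x + g x) x = partial i f x + partial i g x"
    by (simp add: partial_def)
qed

lemma partial_cmult:
  assumes "f differentiable_on UNIV"
  shows "partial i (\<lambda>x. c * f x) = (\<lambda>x. c * partial i f x)"
proof
  fix x
  have "f differentiable (at x)"
    using assms by (auto simp: differentiable_on_def)
  then have "frechet_derivative (\<lambda>x. c * f x) (at x) = (\<lambda>h. c * frechet_derivative f (at x) h)"
    by (intro frechet_derivative_at[symmetric] has_derivative_mult_right) (simp_all add: frechet_derivative_works)
  then show "partial i (\<lambda>x. c * f x) x = c * partial i f x"
    by (simp add: partial_def)
qed

lemma partial_const [simp]: "partial i (\<lambda>x. c) = (\<lambda>x. 0)"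
  by (simp add: partial_def fun_eq_iff)

lemma Ck_const: "Ck k (\<lambda>x. c)"
  by (induction k arbitrary: c) auto

lemma Ck_add: "Ck k f \<Longrightarrow> Ck k g \<Longrightarrow> Ck k (\<lambda>x. f x + g x)"
  by (induction k arbitrary: f g) (auto intro: continuous_on_add differentiable_on_add simp: partial_add)

lemma Ck_cmult: "Ck k f \<Longrightarrow> Ck k (\<lambda>x. c * f x)"
  by (induction k arbitrary: f)
    (auto intro: continuous_on_mult differentiable_on_mult differentiable_on_const simp: partial_cmult)

lemma smooth_per_const: "smooth_per (\<lambda>x. c)"
  by (simp add: smooth_per_def periodic_def Ck_const)

lemma smooth_per_add: "smooth_per f \<Longrightarrow> smooth_per g \<Longrightarrow> smooth_per (\<lambda>x. f x + g x)"
  by (auto simp: smooth_per_def periodic_def Ck_add)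

lemma smooth_per_cmult: "smooth_per f \<Longrightarrow> smooth_per (\<lambda>x. c * f x)"
  by (auto simp: smooth_per_def periodic_def Ck_cmult)

lemma smooth_per_differentiable:
  assumes "smooth_per u" shows "u differentiable_on UNIV"
  using assms unfolding smooth_per_def by (metis Ck.simps(2))

lemma smooth_per_continuous:
  assumes "smooth_per u" shows "continuous_on UNIV u"
  using assms unfolding smooth_per_def by (metis Ck.simps(1))

lemma continuous_partial:
  assumes "smooth_per u" shows "continuous_on UNIV (partial i u)"
  using assms unfolding smooth_per_def by (metis Ck.simps)

lemma continuous_grad:
  assumes "smooth_per u" shows "continuous_on UNIV (grad u)"
  unfolding grad_def by (intro continuous_on_vec_lambda continuous_partial assms)

lemma smooth_per_periodic: "smooth_per u \<Longrightarrow> periodic u"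
  by (simp add: smooth_per_def)

lemma has_derivative_grad:
  assumes "smooth_per u"
  shows "(u has_derivative (\<lambda>h. grad u x \<bullet> h)) (at x)"
proof -
  have "u differentiable (at x)"
    using smooth_per_differentiable[OF assms] by (auto simp: differentiable_on_def)
  then have d: "(u has_derivative frechet_derivative u (at x)) (at x)"
    by (simp add: frechet_derivative_works)
  then interpret bounded_linear "frechet_derivative u (at x)"
    by (rule has_derivative_bounded_linear)
  have "frechet_derivative u (at x) h = grad u x \<bullet> h" for h
  proof -
    have "h = h $ 1 *\<^sub>R axis 1 1 + h $ 2 *\<^sub>R axis 2 1"
      by (simp add: vec_eq_iff forall_2 axis_def)
    then have "frechet_derivative u (at x) h = frechet_derivative u (at x) (h $ 1 *\<^sub>R axis 1 1 + h $ 2 *\<^sub>R axis 2 1)"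
      by simp
    also have "\<dots> = grad u x \<bullet> h"
      by (simp add: add scale grad_def partial_def inner_vec_def sum_2 mult.commute)
    finally show ?thesis .
  qed
  then have "frechet_derivative u (at x) = (\<lambda>h. grad u x \<bullet> h)" by (rule ext)
  with d show ?thesis by (simp only:)
qed

lemma grad_add:
  "smooth_per f \<Longrightarrow> smooth_per g \<Longrightarrow> grad (\<lambda>x. f x + g x) x = grad f x + grad g x"
  by (simp add: grad_def partial_add smooth_per_differentiable vec_eq_iff)

lemma grad_cmult:
  "smooth_per f \<Longrightarrow> grad (\<lambda>x. c * f x) x = c *\<^sub>R grad f x"
  by (simp add: grad_def partial_cmult smooth_per_differentiable vec_eq_iff)

lemma grad_const [simp]: "grad (\<lambda>x. c) = (\<lambda>x. 0)"
  by (simp add: grad_def vec_eq_iff fun_eq_iff)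

lemma smooth_per_diff: "smooth_per f \<Longrightarrow> smooth_per g \<Longrightarrow> smooth_per (\<lambda>x. f x - g x)"
  using smooth_per_add[of f "\<lambda>x. (-1) * g x"] smooth_per_cmult[of g "-1"] by simp

lemma grad_diff:
  "smooth_per f \<Longrightarrow> smooth_per g \<Longrightarrow> grad (\<lambda>x. f x - g x) x = grad f x - grad g x"
  using grad_add[of f "\<lambda>x. (-1) * g x"] smooth_per_cmult[of g "-1"] grad_cmult[of g "-1"] by simp

lemma periodic_partial:
  assumes "smooth_per u" shows "periodic (partial i u)"
  unfolding periodic_def
proof (intro allI)
  fix x j
  let ?e = "axis j 1 :: vec2"
  have "u (y + ?e) = u y" for y
    using assms by (simp add: smooth_per_def periodic_def)
  then have eq: "u \<circ> (\<lambda>y. y + ?e) = u" by (simp add: fun_eq_iff)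
  have d: "((\<lambda>y. y + ?e) has_derivative (\<lambda>h. h)) (at x)"
    by (auto intro!: derivative_eq_intros)
  have "(u has_derivative (\<lambda>h. grad u (x + ?e) \<bullet> h)) (at (x + ?e))"
    by (rule has_derivative_grad[OF assms])
  then have "(u \<circ> (\<lambda>y. y + ?e) has_derivative (\<lambda>h. grad u (x + ?e) \<bullet> h) \<circ> (\<lambda>h. h)) (at x)"
    by (intro diff_chain_at d)
  then have "(u has_derivative (\<lambda>h. grad u (x + ?e) \<bullet> h)) (at x)"
    unfolding eq by (simp add: comp_def)
  from has_derivative_unique[OF this has_derivative_grad[OF assms]]
  have "grad u (x + ?e) \<bullet> axis i 1 = grad u x \<bullet> axis i 1" by metis
  then show "partial i u (x + ?e) = partial i u x"
    by (simp add: inner_axis grad_def)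
qed

lemma L2_per_smooth: "smooth_per u \<Longrightarrow> L2_per u"
  by (intro continuous_L2_per smooth_per_continuous smooth_per_periodic)

lemma L2_per_grad: "smooth_per u \<Longrightarrow> L2_per (grad u)"
  using periodic_partial by (intro continuous_L2_per continuous_grad) (auto simp: periodic_def grad_def)

section \<open>Translation invariance and the null Lagrangian\<close>

text \<open>The shifted cell is cut at the face where coordinate \<open>i\<close> equals 1. The part
  beyond that face moves back by one period and fills the slab of width \<open>s\<close> that the
  shift left empty.\<close>

lemma integral_translate_nonneg:
  fixes f :: "vec2 \<Rightarrow> real"
  assumes f: "continuous_on UNIV f" "periodic f" and s: "0 \<le> s" "s \<le> 1"
  shows "(LINT x|cell. f (x + s *\<^sub>R axis i 1)) = (LINT x|cell. f x)"
proof -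
  let ?e = "axis i 1 :: vec2"
  have eB: "?e \<in> Basis" by (auto simp: Basis_vec_def)
  have ie: "x \<bullet> ?e = x $ i" for x by (simp add: inner_axis)
  have int: "f integrable_on cbox a b" for a b
    by (intro integrable_continuous continuous_on_subset[OF f(1)]) auto
  have c': "continuous_on UNIV (\<lambda>x. f (x + s *\<^sub>R ?e))"
    by (intro continuous_on_compose2[OF f(1)] continuous_intros) auto
  have "(LINT x|cell. f (x + s *\<^sub>R ?e)) = integral (cbox 0 1) (\<lambda>x. f (x + s *\<^sub>R ?e))"
    by (rule integral_cell_eq[OF c'])
  also have "\<dots> = integral (cbox (s *\<^sub>R ?e) (1 + s *\<^sub>R ?e)) f"
    using integral_shift_cbox[of "s *\<^sub>R ?e" "s *\<^sub>R ?e" "1 + s *\<^sub>R ?e" f] by simp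
  also have "\<dots> = integral (cbox (s *\<^sub>R ?e) (1 + s *\<^sub>R ?e) \<inter> {x. x \<bullet> ?e \<le> 1}) f
     + integral (cbox (s *\<^sub>R ?e) (1 + s *\<^sub>R ?e) \<inter> {x. x \<bullet> ?e \<ge> 1}) f"
    by (rule integral_split[OF int eB])
  also have "cbox (s *\<^sub>R ?e) (1 + s *\<^sub>R ?e) \<inter> {x. x \<bullet> ?e \<le> 1} = cbox (s *\<^sub>R ?e) 1"
    unfolding ie using s exhaust_2[of i] by (auto simp: mem_box_cart axis_def forall_2)
  also have "cbox (s *\<^sub>R ?e) (1 + s *\<^sub>R ?e) \<inter> {x. x \<bullet> ?e \<ge> 1} = cbox ?e (1 + s *\<^sub>R ?e)"
    unfolding ie using s exhaust_2[of i] by (auto simp: mem_box_cart axis_def forall_2)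
  also have "integral (cbox ?e (1 + s *\<^sub>R ?e)) f = integral (cbox 0 (1 + s *\<^sub>R ?e - ?e)) (\<lambda>x. f (x + ?e))"
    using integral_shift_cbox[of ?e ?e "1 + s *\<^sub>R ?e" f] by simp
  also have "\<dots> = integral (cbox 0 (1 + s *\<^sub>R ?e - ?e)) f"
    using f(2) by (simp add: periodic_def)
  also have "cbox 0 (1 + s *\<^sub>R ?e - ?e) = cbox 0 1 \<inter> {x. x \<bullet> ?e \<le> s}"
    unfolding ie using s exhaust_2[of i] by (auto simp: mem_box_cart axis_def forall_2)
  also have "cbox (s *\<^sub>R ?e) 1 = cbox 0 1 \<inter> {x. x \<bullet> ?e \<ge> s}"
    unfolding ie using s exhaust_2[of i] by (auto simp: mem_box_cart axis_def forall_2)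
  also have "integral (cbox 0 1 \<inter> {x. x \<bullet> ?e \<ge> s}) f + integral (cbox 0 1 \<inter> {x. x \<bullet> ?e \<le> s}) f = integral (cbox 0 1) f"
    using integral_split[OF int eB, of 0 1 s] by simp
  also have "\<dots> = (LINT x|cell. f x)"
    by (rule integral_cell_eq[OF f(1), symmetric])
  finally show ?thesis .
qed

lemma periodic_shift:
  assumes "periodic f" shows "periodic (\<lambda>x. f (x + a))"
  unfolding periodic_def
proof (intro allI)
  fix x i
  have "f (x + axis i 1 + a) = f ((x + a) + axis i 1)" by (simp add: add.assoc add.commute[of a])
  then show "f (x + axis i 1 + a) = f (x + a)" using assms by (simp add: periodic_def)
qed

lemma integral_translate:
  fixes f :: "vec2 \<Rightarrow> real"
  assumes f: "continuous_on UNIV f" "periodic f" and s: "\<bar>s\<bar> \<le> 1"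
  shows "(LINT x|cell. f (x + s *\<^sub>R axis i 1)) = (LINT x|cell. f x)"
proof (cases "0 \<le> s")
  case False
  let ?g = "\<lambda>x. f (x + s *\<^sub>R axis i 1)"
  have g: "continuous_on UNIV ?g"
    by (intro continuous_on_compose2[OF f(1)] continuous_intros) auto
  have p: "periodic ?g"
    by (rule periodic_shift[OF f(2)])
  show ?thesis
    \<comment> \<open>Shifting the translate forward by \<open>- s\<close> restores
      \<open>f\<close>, so a negative shift is the nonnegative case read backwards.\<close>
    using integral_translate_nonneg[OF g p, of "-s" i] s False by simp
next
  case True
  then show ?thesis using integral_translate_nonneg[OF f, of s i] s by simp
qed

lemma difference_quotient_tendsto:
  assumes u: "smooth_per u" and s: "s \<longlonglongrightarrow> 0" "\<And>n. s n \<noteq> 0"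
  shows "(\<lambda>n. (u (x + s n *\<^sub>R axis i 1) - u x) / s n) \<longlonglongrightarrow> partial i u x"
proof -
  have "((\<lambda>t. u (x + t *\<^sub>R axis i 1)) has_derivative (\<lambda>h. grad u (x + 0 *\<^sub>R axis i 1) \<bullet> (h *\<^sub>R axis i 1))) (at 0)"
    by (rule has_derivative_compose[OF _ has_derivative_grad[OF u]]) (auto intro!: derivative_eq_intros)
  then have "((\<lambda>t. u (x + t *\<^sub>R axis i 1)) has_field_derivative partial i u x) (at 0)"
    by (simp add: has_field_derivative_def inner_axis grad_def mult.commute[of _ "partial i u x"])

  then have "((\<lambda>t. (u (x + t *\<^sub>R axis i 1) - u x) / t) \<longlongrightarrow> partial i u x) (at 0)"
    by (simp add: has_field_derivative_iff)
  then show ?thesis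
    by (rule filterlim_compose) (use s in \<open>auto simp: filterlim_at\<close>)
qed

text \<open>A mean value estimate whose purpose is to give a constant dominating function for limits
  of difference quotients.\<close>

lemma difference_quotient_bound:
  assumes u: "smooth_per u"
  obtains B where "\<And>x s. x \<in> cbox 0 1 \<Longrightarrow> \<bar>s\<bar> \<le> 1 \<Longrightarrow> s \<noteq> 0 \<Longrightarrow> \<bar>(u (x + s *\<^sub>R axis i 1) - u x) / s\<bar> \<le> B"
proof -
  \<comment> \<open>The enlarged box contains every axis-parallel segment of length at most 1 that
    starts in the cell.\<close>
  have "bounded (partial i u ` cbox (-1) 2)"
    by (intro compact_imp_bounded compact_continuous_image continuous_on_subset[OF continuous_partial[OF u]]) auto
  then obtain B where B: "\<And>x. x \<in> cbox (-1) 2 \<Longrightarrow> norm (partial i u x) \<le> B"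
    unfolding bounded_iff by blast
  show ?thesis
  proof (rule that)
    fix x :: vec2 and s :: real
    assume x: "x \<in> cbox 0 1" and s: "\<bar>s\<bar> \<le> 1" "s \<noteq> 0"
    have "((\<lambda>t. u (x + t *\<^sub>R axis i 1)) has_derivative (\<lambda>h. grad u (x + t *\<^sub>R axis i 1) \<bullet> (h *\<^sub>R axis i 1))) (at t)" for t
      by (rule has_derivative_compose[OF _ has_derivative_grad[OF u]]) (auto intro!: derivative_eq_intros)
    then have d: "((\<lambda>t. u (x + t *\<^sub>R axis i 1)) has_field_derivative partial i u (x + t *\<^sub>R axis i 1)) (at t)" for t
      by (simp add: has_field_derivative_def inner_axis grad_def mult.commute[of _ "partial i u _"])
    have "norm (u (x + s *\<^sub>R axis i 1) - u (x + 0 *\<^sub>R axis i 1)) \<le> B * norm (s - 0)"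
    proof (rule field_differentiable_bound[of "{-1..1}"])
      show "norm (partial i u (x + t *\<^sub>R axis i 1)) \<le> B" if "t \<in> {-1..1}" for t
        using x that exhaust_2[of i] by (intro B) (auto simp: mem_box_cart axis_def forall_2)
    qed (use d s in \<open>auto intro: has_field_derivative_at_within\<close>)
    then show "\<bar>(u (x + s *\<^sub>R axis i 1) - u x) / s\<bar> \<le> B"
      using s by (simp add: field_simps)
  qed
qed

lemma continuous_shift:
  fixes u :: "vec2 \<Rightarrow> real"
  shows "continuous_on UNIV u \<Longrightarrow> continuous_on UNIV (\<lambda>x. u (x + a))"
  by (rule continuous_on_compose2[where g=u and t=UNIV]) (auto intro!: continuous_intros)

text \<open>Every difference quotient has integral zero by translation invariance, and dominated
  convergence carries this over to the derivative.\<close>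

lemma integral_partial_eq_0:
  assumes u: "smooth_per u"
  shows "(LINT x|cell. partial i u x) = 0"
proof -
  define s where "s n = inverse (real (Suc n))" for n
  have s: "s \<longlonglongrightarrow> 0" "\<And>n. s n \<noteq> 0" "\<And>n. \<bar>s n\<bar> \<le> 1"
    unfolding s_def by (rule LIMSEQ_inverse_real_of_nat) (simp_all add: inverse_le_1_iff)
  obtain B where B: "\<And>x s. x \<in> cbox 0 1 \<Longrightarrow> \<bar>s\<bar> \<le> 1 \<Longrightarrow> s \<noteq> 0 \<Longrightarrow> \<bar>(u (x + s *\<^sub>R axis i 1) - u x) / s\<bar> \<le> B"
    by (rule difference_quotient_bound[OF u]) blast
  note c = smooth_per_continuous[OF u]
  have "(\<lambda>n. LINT x|cell. (u (x + s n *\<^sub>R axis i 1) - u x) / s n) \<longlonglongrightarrow> (LINT x|cell. partial i u x)"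
  proof (rule integral_dominated_convergence[where w="\<lambda>x. B"])
    show "AE x in cell. norm ((u (x + s n *\<^sub>R axis i 1) - u x) / s n) \<le> B" for n
      by (intro AE_I2) (use B s in auto)
    show "(\<lambda>x. (u (x + s n *\<^sub>R axis i 1) - u x) / s n) \<in> borel_measurable cell" for n
      by (rule continuous_borel_cell, intro continuous_intros continuous_shift[OF c] c) (use s in auto)
    show "AE x in cell. (\<lambda>n. (u (x + s n *\<^sub>R axis i 1) - u x) / s n) \<longlonglongrightarrow> partial i u x"
      by (intro AE_I2 difference_quotient_tendsto u s)
    show "partial i u \<in> borel_measurable cell"
      by (intro continuous_borel_cell continuous_partial u)
  qed simp
  moreover have "(LINT x|cell. (u (x + s n *\<^sub>R axis i 1) - u x) / s n) = 0" for n
    using integral_translate[OF c smooth_per_periodic[OF u] s(3)[of n], of i]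
    by (simp add: continuous_integrable_cell continuous_shift c)
  ultimately show ?thesis by (simp only: LIMSEQ_const_iff)
qed

text \<open>Pairing a forward difference of \<open>u\<close> with a backward difference of \<open>v\<close> makes the integral of
  the product symmetric in the two directions, by translation invariance alone.\<close>

lemma integral_partial_commute:
  assumes u: "smooth_per u" and v: "smooth_per v"
  shows "(LINT x|cell. partial i u x * partial j v x) = (LINT x|cell. partial j u x * partial i v x)"
proof -
  define s where "s n = inverse (real (Suc n))" for n
  have s: "s \<longlonglongrightarrow> 0" "\<And>n. s n \<noteq> 0" "\<And>n. \<bar>s n\<bar> \<le> 1"
    unfolding s_def by (rule LIMSEQ_inverse_real_of_nat) (simp_all add: inverse_le_1_iff)
  then have s': "(\<lambda>n. - s n) \<longlonglongrightarrow> 0" "\<And>n. - s n \<noteq> 0" "\<And>n. \<bar>- s n\<bar> \<le> 1"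
    using tendsto_minus[OF s(1)] by simp_all
  note c = smooth_per_continuous[OF u] smooth_per_continuous[OF v]
  note cs = c[THEN continuous_shift]
  note p = smooth_per_periodic[OF u] smooth_per_periodic[OF v]
  \<comment> \<open>With \<open>u\<close> shifted by \<open>s n\<close> and \<open>v\<close> by
    \<open>- s n\<close>, moving the shift off \<open>v\<close> adds the two shifts on
    \<open>u\<close>.\<close>
  let ?F = "\<lambda>i j n x. ((u (x + s n *\<^sub>R axis i 1) - u x) / s n) * ((v (x + (- s n) *\<^sub>R axis j 1) - v x) / (- s n))"
  have lim: "(\<lambda>n. LINT x|cell. ?F i j n x) \<longlonglongrightarrow> (LINT x|cell. partial i u x * partial j v x)" for i j
  proof -
    obtain B where B: "\<And>x s. x \<in> cbox 0 1 \<Longrightarrow> \<bar>s\<bar> \<le> 1 \<Longrightarrow> s \<noteq> 0 \<Longrightarrow> \<bar>(u (x + s *\<^sub>R axis i 1) - u x) / s\<bar> \<le> B"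
      by (rule difference_quotient_bound[OF u]) blast
    obtain B' where B': "\<And>x s. x \<in> cbox 0 1 \<Longrightarrow> \<bar>s\<bar> \<le> 1 \<Longrightarrow> s \<noteq> 0 \<Longrightarrow> \<bar>(v (x + s *\<^sub>R axis j 1) - v x) / s\<bar> \<le> B'"
      by (rule difference_quotient_bound[OF v]) blast
    show ?thesis
    proof (rule integral_dominated_convergence[where w="\<lambda>x. B * B'"])
      show "AE x in cell. norm (?F i j n x) \<le> B * B'" for n
      proof (intro AE_I2)
        fix x assume "x \<in> space cell"
        then have x: "x \<in> cbox 0 1" by simp
        note a = B[OF x s(3)[of n] s(2)] and b = B'[OF x s'(3)[of n] s'(2)]
        show "norm (?F i j n x) \<le> B * B'"
          using mult_mono[OF a b order_trans[OF abs_ge_zero a] abs_ge_zero]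
          by (simp only: real_norm_def abs_mult)
      qed
      show "?F i j n \<in> borel_measurable cell" for n
        by (rule continuous_borel_cell, intro continuous_intros cs c) (use s in auto)
      show "(\<lambda>x. partial i u x * partial j v x) \<in> borel_measurable cell"
        by (intro borel_measurable_times continuous_borel_cell continuous_partial u v)
      show "AE x in cell. (\<lambda>n. ?F i j n x) \<longlonglongrightarrow> partial i u x * partial j v x"
        by (intro AE_I2 tendsto_mult difference_quotient_tendsto u v s s')
    qed simp
  qed
  define C where "C a = (LINT x|cell. u (x + a) * v x)" for a
  have cont: "continuous_on UNIV (\<lambda>x. u (x + a) * v (x + b))" for a b
    by (intro continuous_intros cs)
  have int: "integrable cell (\<lambda>x. u (x + a) * v (x + b))" for a b
    by (intro continuous_integrable_cell cont)
  have sh: "(LINT x|cell. u (x + a) * v (x + (- s n) *\<^sub>R axis j 1)) = C (a + s n *\<^sub>R axis j 1)" for a n j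
  proof -
    have per: "periodic (\<lambda>x. u (x + a) * v (x + (- s n) *\<^sub>R axis j 1))"
      using periodic_shift[OF p(1), of a] periodic_shift[OF p(2), of "(- s n) *\<^sub>R axis j 1"]
      unfolding periodic_def by simp
    show ?thesis
      using integral_translate[OF cont per s(3)[of n], of j] by (simp add: C_def algebra_simps)
  qed
  \<comment> \<open>Only the correlation \<open>C\<close> at zero, at the two single shifts and at
    their sum occurs, and these enter symmetrically in \<open>i\<close> and
    \<open>j\<close>.\<close>
  have eq: "(LINT x|cell. ?F i j n x)
      = (C (s n *\<^sub>R axis i 1) - C (s n *\<^sub>R axis i 1 + s n *\<^sub>R axis j 1) - C 0 + C (s n *\<^sub>R axis j 1)) / (s n)\<^sup>2" for i j n
  proof -
    have "?F i j n x = (u (x + s n *\<^sub>R axis i 1) * v (x + 0) - u (x + s n *\<^sub>R axis i 1) * v (x + (- s n) *\<^sub>R axis j 1)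
       - u (x + 0) * v (x + 0) + u (x + 0) * v (x + (- s n) *\<^sub>R axis j 1)) / (s n)\<^sup>2" for x
      using s(2)[of n] by (simp add: field_simps power2_eq_square)
    then have "(LINT x|cell. ?F i j n x) = ((LINT x|cell. u (x + s n *\<^sub>R axis i 1) * v (x + 0))
       - (LINT x|cell. u (x + s n *\<^sub>R axis i 1) * v (x + (- s n) *\<^sub>R axis j 1))
       - (LINT x|cell. u (x + 0) * v (x + 0)) + (LINT x|cell. u (x + 0) * v (x + (- s n) *\<^sub>R axis j 1))) / (s n)\<^sup>2"
      using int by (simp del: scaleR_minus_left add_0_right)
    then show ?thesis unfolding sh by (simp add: C_def)
  qed
  have "(LINT x|cell. ?F i j n x) = (LINT x|cell. ?F j i n x)" for n
    unfolding eq by (simp add: algebra_simps)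
  then have "(\<lambda>n. LINT x|cell. ?F i j n x) = (\<lambda>n. LINT x|cell. ?F j i n x)"
    by (rule ext)
  then show ?thesis
    using LIMSEQ_unique[OF lim[of i j]] lim[of j i] by (simp only:)
qed

section \<open>The Poincare inequality\<close>

lemma nn_integral_lborel_affine:
  fixes f :: "'a::euclidean_space \<Rightarrow> ennreal"
  assumes [measurable]: "f \<in> borel_measurable borel" and c: "c \<noteq> 0"
  shows "(\<integral>\<^sup>+x. f x \<partial>lborel) = ennreal (\<bar>c\<bar> ^ DIM('a)) * (\<integral>\<^sup>+x. f (t + c *\<^sub>R x) \<partial>lborel)"
  by (subst lborel_affine[OF c, of t])
    (simp add: nn_integral_density nn_integral_distr nn_integral_cmult)

lemma nn_integral_cell:
  assumes "f \<in> borel_measurable borel"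
  shows "(\<integral>\<^sup>+x. f x \<partial>cell) = (\<integral>\<^sup>+x. f x * indicator (cbox 0 1) x \<partial>lborel)"
  by (simp add: nn_integral_restrict_space nn_integral_completion)

text \<open>The fundamental theorem of calculus along the segment, followed by Cauchy--Schwarz
  against the constant 1. Nonnegative integrals are used so that the order of integration can be
  exchanged freely later.\<close>

lemma segment_increment_sq_le:
  assumes u: "smooth_per u"
  shows "ennreal ((u y - u x)\<^sup>2)
    \<le> (\<integral>\<^sup>+t. ennreal ((norm (y - x))\<^sup>2 * (norm (grad u (x + t *\<^sub>R (y - x))))\<^sup>2) * indicator {0..1} t \<partial>lborel)"
proof -
  let ?M = "restrict_space lborel {0..1::real}"
  let ?h = "\<lambda>t. grad u (x + t *\<^sub>R (y - x)) \<bullet> (y - x)"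
  have cont: "continuous_on UNIV ?h"
    by (intro continuous_intros continuous_on_compose2[OF continuous_grad[OF u]]) auto
  have fin: "emeasure ?M (space ?M) = 1"
    by (simp add: emeasure_restrict_space space_restrict_space)
  interpret finite_measure ?M
    by (rule finite_measureI) (use fin in simp)
  have meas: "?h \<in> borel_measurable ?M"
    by (intro measurable_restrict_space1) (simp add: borel_measurable_continuous_onI[OF cont])
  have "bounded (?h ` {0..1})"
    by (intro compact_imp_bounded compact_continuous_image continuous_on_subset[OF cont]) auto
  then obtain B where B: "\<And>t. t \<in> {0..1} \<Longrightarrow> norm (?h t) \<le> B"
    unfolding bounded_iff by blast
  have sq: "sq_int ?M ?h"
    by (rule sq_int_bound[OF sq_int_const[of "1::real"] meas, where C=B])
      (use B in \<open>auto intro!: AE_I2 simp: space_restrict_space\<close>)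
  have d: "((\<lambda>t. u (x + t *\<^sub>R (y - x))) has_real_derivative ?h t) (at t)" for t
  proof -
    have "((\<lambda>t. u (x + t *\<^sub>R (y - x))) has_derivative (\<lambda>h. grad u (x + t *\<^sub>R (y - x)) \<bullet> (h *\<^sub>R (y - x)))) (at t)"
      by (rule has_derivative_compose[OF _ has_derivative_grad[OF u]]) (auto intro!: derivative_eq_intros)
    then show ?thesis
      by (simp add: has_field_derivative_def mult.commute[of _ "?h t"])
  qed
  have ftc: "(LINT t|?M. ?h t) = u y - u x"
  proof -
    have "(LINT t|?M. ?h t) = (LINT t|lborel. ?h t * indicator {0..1} t)"
      by (simp add: integral_restrict_space mult.commute)
    also have "\<dots> = u (x + 1 *\<^sub>R (y - x)) - u (x + 0 *\<^sub>R (y - x))"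
      using cont by (intro integral_FTC_Icc_real d) (auto simp: continuous_on_eq_continuous_at)
    finally show ?thesis by simp
  qed
  have "(LINT t|?M. ?h t)\<^sup>2 \<le> (LINT t|?M. (norm (?h t))\<^sup>2) * (LINT t|?M. (norm (1::real))\<^sup>2)"
    using sq_int_cauchy_schwarz[OF sq sq_int_const[of 1]] by simp
  also have "\<dots> = (LINT t|?M. (norm (?h t))\<^sup>2)"
    using fin by (simp add: measure_def)
  finally have "ennreal ((u y - u x)\<^sup>2) \<le> ennreal (LINT t|?M. (norm (?h t))\<^sup>2)"
    unfolding ftc by (rule ennreal_leI)
  also have "\<dots> = (\<integral>\<^sup>+t. ennreal ((norm (?h t))\<^sup>2) \<partial>?M)"
    by (rule nn_integral_eq_integral[symmetric]) (use sq_int_integrable[OF sq] in auto)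
  also have "\<dots> \<le> (\<integral>\<^sup>+t. ennreal ((norm (y - x))\<^sup>2 * (norm (grad u (x + t *\<^sub>R (y - x))))\<^sup>2) \<partial>?M)"
  proof (intro nn_integral_mono ennreal_leI)
    fix t
    have "(norm (?h t))\<^sup>2 \<le> (norm (grad u (x + t *\<^sub>R (y - x))) * norm (y - x))\<^sup>2"
      by (intro power_mono) (use Cauchy_Schwarz_ineq2 in auto)
    then show "(norm (?h t))\<^sup>2 \<le> (norm (y - x))\<^sup>2 * (norm (grad u (x + t *\<^sub>R (y - x))))\<^sup>2"
      by (simp add: power_mult_distrib mult.commute)
  qed
  finally show ?thesis
    by (simp add: nn_integral_restrict_space)
qed

lemma norm_diff_cell_le:
  assumes "x \<in> cbox 0 1" "y \<in> cbox (0::vec2) 1"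
  shows "(norm (y - x))\<^sup>2 \<le> 2"
proof -
  have "(y $ i - x $ i)\<^sup>2 \<le> 1" for i
    using assms unfolding abs_square_le_1 mem_box_cart
    by (smt (verit) one_index zero_index)
  from this[of 1] this[of 2] show ?thesis
    unfolding power2_norm_eq_inner by (simp add: inner_vec_def sum_2 power2_eq_square)
qed

text \<open>Points of the segment with parameter at least one half are controlled by the change of
  variables in one end point, the remaining ones by that in the other.\<close>

lemma segment_double_integral_le:
  fixes g :: "vec2 \<Rightarrow> ennreal"
  assumes [measurable]: "g \<in> borel_measurable borel" and t: "0 \<le> t" "t \<le> 1"
  shows "(\<integral>\<^sup>+x. (\<integral>\<^sup>+y. g (x + t *\<^sub>R (y - x)) * indicator (cbox 0 1) (x + t *\<^sub>R (y - x))
      * indicator (cbox 0 1) y * indicator (cbox 0 1) x \<partial>lborel) \<partial>lborel)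
     \<le> 4 * (\<integral>\<^sup>+x. g x * indicator (cbox 0 1) x \<partial>lborel)"
proof -
  define f where "f x = g x * indicator (cbox 0 1) x" for x
  have [measurable]: "f \<in> borel_measurable borel" unfolding f_def by measurable
  let ?N = "\<integral>\<^sup>+x. f x \<partial>lborel"
  let ?F = "\<lambda>x y. f (x + t *\<^sub>R (y - x)) * indicator (cbox 0 1) y * indicator (cbox 0 1) x"
  \<comment> \<open>The Jacobian of the substitution in the plane is \<open>c\<^sup>2\<close>, at
    least 1/4; hence the factor 4.\<close>
  have aff: "(\<integral>\<^sup>+x. f (a + c *\<^sub>R x) \<partial>lborel) \<le> 4 * ?N" if c: "1/2 \<le> c" for a c
  proof -
    have "(\<integral>\<^sup>+x. f (a + c *\<^sub>R x) \<partial>lborel) \<le> ennreal (4 * c\<^sup>2) * (\<integral>\<^sup>+x. f (a + c *\<^sub>R x) \<partial>lborel)"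
    proof -
      have "(1/2)\<^sup>2 \<le> c\<^sup>2" using c by (intro power_mono) auto
      then have "ennreal 1 \<le> ennreal (4 * c\<^sup>2)" by (intro ennreal_leI) (simp add: power2_eq_square)
      from mult_right_mono[OF this, of "\<integral>\<^sup>+x. f (a + c *\<^sub>R x) \<partial>lborel"] show ?thesis by simp
    qed
    also have "\<dots> = 4 * (ennreal (c\<^sup>2) * (\<integral>\<^sup>+x. f (a + c *\<^sub>R x) \<partial>lborel))"
      by (simp add: ennreal_mult' mult.assoc)
    also have "ennreal (c\<^sup>2) * (\<integral>\<^sup>+x. f (a + c *\<^sub>R x) \<partial>lborel) = ?N"
      using nn_integral_lborel_affine[of f c a] c by simp
    finally show ?thesis .
  qed
  have vol: "(\<integral>\<^sup>+x. C * indicator (cbox 0 1) (x::vec2) \<partial>lborel) = C" for C :: ennreal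
    by (rule trans[OF nn_integral_cell[symmetric]]) simp_all
  have "(\<integral>\<^sup>+x. (\<integral>\<^sup>+y. ?F x y \<partial>lborel) \<partial>lborel) \<le> 4 * ?N"
  proof (cases "1/2 \<le> t")
    case True
    have "(\<integral>\<^sup>+x. (\<integral>\<^sup>+y. ?F x y \<partial>lborel) \<partial>lborel) \<le> (\<integral>\<^sup>+x. (4 * ?N) * indicator (cbox 0 1) (x::vec2) \<partial>lborel)"
    proof (intro nn_integral_mono)
      fix x :: vec2
      have "(\<integral>\<^sup>+y. ?F x y \<partial>lborel) \<le> (\<integral>\<^sup>+y. f ((1 - t) *\<^sub>R x + t *\<^sub>R y) * indicator (cbox 0 1) x \<partial>lborel)"
        by (intro nn_integral_mono) (auto simp: algebra_simps split: split_indicator)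
      also have "\<dots> = (\<integral>\<^sup>+y. f ((1 - t) *\<^sub>R x + t *\<^sub>R y) \<partial>lborel) * indicator (cbox 0 1) x"
        by (rule nn_integral_multc) measurable
      also have "\<dots> \<le> (4 * ?N) * indicator (cbox 0 1) x"
        by (intro mult_right_mono aff True) simp
      finally show "(\<integral>\<^sup>+y. ?F x y \<partial>lborel) \<le> (4 * ?N) * indicator (cbox 0 1) x" .
    qed
    also have "\<dots> = 4 * ?N" by (rule vol)
    finally show ?thesis .
  next
    case False
    have "(\<integral>\<^sup>+x. (\<integral>\<^sup>+y. ?F x y \<partial>lborel) \<partial>lborel) = (\<integral>\<^sup>+y. (\<integral>\<^sup>+x. ?F x y \<partial>lborel) \<partial>lborel)"
      by (rule lborel_pair.Fubini'[symmetric]) measurable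
    also have "\<dots> \<le> (\<integral>\<^sup>+x. (4 * ?N) * indicator (cbox 0 1) (x::vec2) \<partial>lborel)"
    proof (intro nn_integral_mono)
      fix y :: vec2
      have "(\<integral>\<^sup>+x. ?F x y \<partial>lborel) \<le> (\<integral>\<^sup>+x. f (t *\<^sub>R y + (1 - t) *\<^sub>R x) * indicator (cbox 0 1) y \<partial>lborel)"
        by (intro nn_integral_mono) (auto simp: algebra_simps split: split_indicator)
      also have "\<dots> = (\<integral>\<^sup>+x. f (t *\<^sub>R y + (1 - t) *\<^sub>R x) \<partial>lborel) * indicator (cbox 0 1) y"
        by (rule nn_integral_multc) measurable
      also have "\<dots> \<le> (4 * ?N) * indicator (cbox 0 1) y"
        using False by (intro mult_right_mono aff) auto
      finally show "(\<integral>\<^sup>+x. ?F x y \<partial>lborel) \<le> (4 * ?N) * indicator (cbox 0 1) y" .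
    qed
    also have "\<dots> = 4 * ?N" by (rule vol)
    finally show ?thesis .
  qed
  then show ?thesis by (simp add: f_def)
qed

text \<open>The segment estimate is integrated over both end points with the segment parameter moved
  outermost. The constant 8 is the squared diameter 2 of the cell times the factor 4 from the change
  of variables.\<close>

lemma double_increment_le:
  assumes u: "smooth_per u"
  shows "(\<integral>\<^sup>+x. (\<integral>\<^sup>+y. ennreal ((u y - u x)\<^sup>2) \<partial>cell) \<partial>cell) \<le> 8 * (\<integral>\<^sup>+x. ennreal ((norm (grad u x))\<^sup>2) \<partial>cell)"
proof -
  have [measurable]: "u \<in> borel_measurable borel" "grad u \<in> borel_measurable borel"
    using smooth_per_continuous[OF u] continuous_grad[OF u] by (auto intro: borel_measurable_continuous_onI)
  define g where "g x = ennreal (2 * (norm (grad u x))\<^sup>2)" for x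
  have [measurable]: "g \<in> borel_measurable borel" unfolding g_def by measurable
  let ?I = "indicator (cbox 0 1) :: vec2 \<Rightarrow> ennreal"
  \<comment> \<open>By convexity the segment stays in the cell, so the indicator at its points costs
    nothing; it keeps the substituted variable inside the cell.\<close>
  let ?G = "\<lambda>x y t. g (x + t *\<^sub>R (y - x)) * ?I (x + t *\<^sub>R (y - x)) * ?I y * ?I x"
  have pt: "ennreal ((u y - u x)\<^sup>2) * ?I y * ?I x \<le> (\<integral>\<^sup>+t. ?G x y t * indicator {0..1} t \<partial>lborel)" for x y
  proof (cases "x \<in> cbox 0 1 \<and> y \<in> cbox 0 1")
    case True
    then have xy: "x \<in> cbox 0 1" "y \<in> cbox 0 1" by auto
    have "ennreal ((u y - u x)\<^sup>2) * ?I y * ?I x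
       \<le> (\<integral>\<^sup>+t. ennreal ((norm (y - x))\<^sup>2 * (norm (grad u (x + t *\<^sub>R (y - x))))\<^sup>2) * indicator {0..1} t \<partial>lborel)"
      using segment_increment_sq_le[OF u, of y x] xy by simp
    also have "\<dots> \<le> (\<integral>\<^sup>+t. ?G x y t * indicator {0..1} t \<partial>lborel)"
    proof (intro nn_integral_mono)
      fix t :: real
      show "ennreal ((norm (y - x))\<^sup>2 * (norm (grad u (x + t *\<^sub>R (y - x))))\<^sup>2) * indicator {0..1} t
         \<le> ?G x y t * indicator {0..1} t"
      proof (cases "t \<in> {0..1}")
        case True
        have "x + t *\<^sub>R (y - x) = (1 - t) *\<^sub>R x + t *\<^sub>R y" by (simp add: algebra_simps)
        also have "\<dots> \<in> cbox 0 1"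
          using True xy convex_box(1)[of 0 "1::vec2"] by (intro convexD) auto
        finally show ?thesis
          using True xy norm_diff_cell_le[OF xy] by (auto simp: g_def intro!: ennreal_leI mult_right_mono)
      qed simp
    qed
    finally show ?thesis .
  qed (auto simp: indicator_def)
  have "(\<integral>\<^sup>+x. (\<integral>\<^sup>+y. ennreal ((u y - u x)\<^sup>2) \<partial>cell) \<partial>cell)
      = (\<integral>\<^sup>+x. (\<integral>\<^sup>+y. ennreal ((u y - u x)\<^sup>2) * ?I y * ?I x \<partial>lborel) \<partial>lborel)"
  proof -
    have "(\<integral>\<^sup>+y. ennreal ((u y - u x)\<^sup>2) \<partial>cell) = (\<integral>\<^sup>+y. ennreal ((u y - u x)\<^sup>2) * ?I y \<partial>lborel)" for x
      by (rule nn_integral_cell) measurable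
    then show ?thesis
      by (simp add: nn_integral_cell nn_integral_multc)
  qed
  also have "\<dots> \<le> (\<integral>\<^sup>+x. (\<integral>\<^sup>+y. (\<integral>\<^sup>+t. ?G x y t * indicator {0..1} t \<partial>lborel) \<partial>lborel) \<partial>lborel)"
    by (intro nn_integral_mono pt)
  also have "\<dots> = (\<integral>\<^sup>+x. (\<integral>\<^sup>+t. (\<integral>\<^sup>+y. ?G x y t * indicator {0..1} t \<partial>lborel) \<partial>lborel) \<partial>lborel)"
    by (intro nn_integral_cong lborel_pair.Fubini') measurable
  also have "\<dots> = (\<integral>\<^sup>+t. (\<integral>\<^sup>+x. (\<integral>\<^sup>+y. ?G x y t * indicator {0..1} t \<partial>lborel) \<partial>lborel) \<partial>lborel)"
    by (rule lborel_pair.Fubini') measurable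
  also have "\<dots> = (\<integral>\<^sup>+t. (\<integral>\<^sup>+x. (\<integral>\<^sup>+y. ?G x y t \<partial>lborel) \<partial>lborel) * indicator {0..1} t \<partial>lborel)"
    by (simp add: nn_integral_multc)
  also have "\<dots> \<le> (\<integral>\<^sup>+t. (4 * (\<integral>\<^sup>+x. g x * ?I x \<partial>lborel)) * indicator {0..1::real} t \<partial>lborel)"
    by (intro nn_integral_mono) (auto split: split_indicator intro!: segment_double_integral_le)
  also have "\<dots> = 4 * (\<integral>\<^sup>+x. g x * ?I x \<partial>lborel)"
    by (simp add: nn_integral_cmult_indicator)
  also have "(\<integral>\<^sup>+x. g x * ?I x \<partial>lborel) = (\<integral>\<^sup>+x. 2 * ennreal ((norm (grad u x))\<^sup>2) \<partial>cell)"
    by (subst nn_integral_cell) (auto simp: g_def ennreal_mult')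
  also have "\<dots> = 2 * (\<integral>\<^sup>+x. ennreal ((norm (grad u x))\<^sup>2) \<partial>cell)"
    by (rule nn_integral_cmult) (intro measurable_compose[OF continuous_borel_cell[OF continuous_grad[OF u]]], measurable)
  finally show ?thesis by (simp add: mult.assoc[symmetric])
qed

text \<open>For mean zero, the double integral of \<open>(u y - u x)\<^sup>2\<close> is twice the
  integral of \<open>u\<^sup>2\<close>; this halves the constant 8.\<close>

lemma poincare:
  assumes u: "smooth_per u" and mean: "(LINT x|cell. u x) = 0"
  shows "(LINT x|cell. (u x)\<^sup>2) \<le> 4 * (LINT x|cell. (norm (grad u x))\<^sup>2)"
proof -
  note c = smooth_per_continuous[OF u]
  have i: "integrable cell u" "integrable cell (\<lambda>x. (u x)\<^sup>2)" "integrable cell (\<lambda>x. (norm (grad u x))\<^sup>2)"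
    by (intro continuous_integrable_cell continuous_intros c continuous_grad u)+
  have iy: "integrable cell (\<lambda>y. (u y - u x)\<^sup>2)" for x
    by (intro continuous_integrable_cell continuous_intros c)
  let ?m = "LINT x|cell. (u x)\<^sup>2"
  have inner: "(LINT y|cell. (u y - u x)\<^sup>2) = ?m + (u x)\<^sup>2" for x
  proof -
    have "(LINT y|cell. (u y - u x)\<^sup>2) = (LINT y|cell. (u y)\<^sup>2 - 2 * u x * u y + (u x)\<^sup>2)"
      by (simp add: power2_diff algebra_simps)
    also have "\<dots> = ?m + (u x)\<^sup>2"
      using i mean by simp
    finally show ?thesis .
  qed
  have "(\<integral>\<^sup>+x. (\<integral>\<^sup>+y. ennreal ((u y - u x)\<^sup>2) \<partial>cell) \<partial>cell) = (\<integral>\<^sup>+x. ennreal (?m + (u x)\<^sup>2) \<partial>cell)"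
    using iy by (simp add: nn_integral_eq_integral inner)
  also have "\<dots> = ennreal (LINT x|cell. ?m + (u x)\<^sup>2)"
    using i by (intro nn_integral_eq_integral) auto
  also have "(LINT x|cell. ?m + (u x)\<^sup>2) = 2 * ?m"
    using i by simp
  finally have "ennreal (2 * ?m) \<le> 8 * (\<integral>\<^sup>+x. ennreal ((norm (grad u x))\<^sup>2) \<partial>cell)"
    using double_increment_le[OF u] by simp
  also have "\<dots> = ennreal (8 * (LINT x|cell. (norm (grad u x))\<^sup>2))"
    using i by (simp add: nn_integral_eq_integral ennreal_mult')
  finally show ?thesis by simp
qed

section \<open>Gradient fields\<close>

definition grad_field :: "(vec2 \<Rightarrow> vec2) \<Rightarrow> bool" where
  "grad_field g \<longleftrightarrow> (\<exists>\<phi>. H1_per_grad \<phi> g)"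

lemma L2_tendsto_add:
  assumes "\<And>n. sq_int cell (u n)" "\<And>n. sq_int cell (v n)" "sq_int cell f" "sq_int cell g"
    and lim: "L2_tendsto u f" "L2_tendsto v g"
  shows "L2_tendsto (\<lambda>n x. u n x + v n x) (\<lambda>x. f x + g x)"
  unfolding L2_tendsto_def
proof (rule tendsto_sandwich[OF _ _ tendsto_const])
  let ?a = "\<lambda>n. LINT x|cell. (norm (u n x - f x))\<^sup>2" and ?b = "\<lambda>n. LINT x|cell. (norm (v n x - g x))\<^sup>2"
  have "(\<lambda>n. 2 * ?a n + 2 * ?b n) \<longlonglongrightarrow> 2 * 0 + 2 * 0"
    using lim unfolding L2_tendsto_def by (intro tendsto_intros)
  then show "(\<lambda>n. 2 * ?a n + 2 * ?b n) \<longlonglongrightarrow> 0" by simp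
  have "(LINT x|cell. (norm (u n x + v n x - (f x + g x)))\<^sup>2) \<le> 2 * ?a n + 2 * ?b n" for n
  proof -
    have i: "integrable cell (\<lambda>x. (norm (u n x - f x))\<^sup>2)" "integrable cell (\<lambda>x. (norm (v n x - g x))\<^sup>2)"
      "integrable cell (\<lambda>x. (norm (u n x + v n x - (f x + g x)))\<^sup>2)"
      by (intro sq_int_integrable sq_int_diff sq_int_add assms)+
    have "(LINT x|cell. (norm (u n x + v n x - (f x + g x)))\<^sup>2)
       \<le> (LINT x|cell. 2 * (norm (u n x - f x))\<^sup>2 + 2 * (norm (v n x - g x))\<^sup>2)"
      using i norm_add_sq_le[of "u n _ - f _" "v n _ - g _"]
      by (intro integral_mono) (auto simp: algebra_simps)
    then show ?thesis using i by simp
  qed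
  then show "\<forall>\<^sub>F n in sequentially. (LINT x|cell. (norm (u n x + v n x - (f x + g x)))\<^sup>2) \<le> 2 * ?a n + 2 * ?b n"
    by simp
qed simp

lemma L2_tendsto_scaleR:
  assumes "L2_tendsto u f"
  shows "L2_tendsto (\<lambda>n x. c *\<^sub>R u n x) (\<lambda>x. c *\<^sub>R f x)"
proof -
  have "(LINT x|cell. (norm (c *\<^sub>R u n x - c *\<^sub>R f x))\<^sup>2) = c\<^sup>2 * (LINT x|cell. (norm (u n x - f x))\<^sup>2)" for n
    by (simp add: scaleR_diff_right[symmetric] power_mult_distrib)
  then show ?thesis
    using tendsto_mult_right_zero[OF assms[unfolded L2_tendsto_def], of "c\<^sup>2"] by (simp add: L2_tendsto_def)
qed

lemma grad_fieldE:
  assumes "grad_field g"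
  obtains \<phi> u where "L2_per \<phi>" "L2_per g" "\<And>n. smooth_per (u n)" "L2_tendsto u \<phi>" "L2_tendsto (\<lambda>n. grad (u n)) g"
proof -
  from assms obtain \<phi> where "H1_per_grad \<phi> g" unfolding grad_field_def by blast
  then obtain u where *: "L2_per \<phi>" "L2_per g" "\<forall>n. smooth_per (u n)" "L2_tendsto u \<phi>" "L2_tendsto (\<lambda>n. grad (u n)) g"
    unfolding H1_per_grad_def by blast
  from *(3) have "\<And>n. smooth_per (u n)" by blast
  from that[OF *(1,2) this *(4,5)] show thesis .
qed

lemma H1_per_grad_smooth: "smooth_per u \<Longrightarrow> H1_per_grad u (grad u)"
  unfolding H1_per_grad_def
  by (intro conjI exI[of _ "\<lambda>n. u"] allI L2_per_smooth L2_per_grad) (simp_all add: L2_tendsto_def)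

lemma grad_field_smooth: "smooth_per u \<Longrightarrow> grad_field (grad u)"
  unfolding grad_field_def by (rule exI, rule H1_per_grad_smooth)

lemma grad_field_zero: "grad_field (\<lambda>x. 0)"
  using grad_field_smooth[OF smooth_per_const] by simp

lemma grad_field_L2_per: "grad_field g \<Longrightarrow> L2_per g"
  by (rule grad_fieldE)

lemma grad_field_approx:
  assumes "grad_field g"
  obtains u where "\<And>n. smooth_per (u n)" "L2_tendsto (\<lambda>n. grad (u n)) g"
  using assms by (rule grad_fieldE) blast

lemma grad_field_add:
  assumes "grad_field g" "grad_field h" shows "grad_field (\<lambda>x. g x + h x)"
proof -
  obtain \<phi> u where 1: "L2_per \<phi>" "L2_per g" "\<And>n. smooth_per (u n)" "L2_tendsto u \<phi>" "L2_tendsto (\<lambda>n. grad (u n)) g"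
    using assms(1) by (rule grad_fieldE) blast
  obtain \<psi> v where 2: "L2_per \<psi>" "L2_per h" "\<And>n. smooth_per (v n)" "L2_tendsto v \<psi>" "L2_tendsto (\<lambda>n. grad (v n)) h"
    using assms(2) by (rule grad_fieldE) blast
  have "H1_per_grad (\<lambda>x. \<phi> x + \<psi> x) (\<lambda>x. g x + h x)"
    unfolding H1_per_grad_def
  proof (intro conjI exI[of _ "\<lambda>n x. u n x + v n x"] allI L2_per_add smooth_per_add 1 2)
    show "L2_tendsto (\<lambda>n x. u n x + v n x) (\<lambda>x. \<phi> x + \<psi> x)"
      by (intro L2_tendsto_add L2_per_sq_int L2_per_smooth 1 2)
    have "L2_tendsto (\<lambda>n x. grad (u n) x + grad (v n) x) (\<lambda>x. g x + h x)"
      by (intro L2_tendsto_add L2_per_sq_int L2_per_grad 1 2)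
    moreover have "grad (\<lambda>x. u n x + v n x) = (\<lambda>x. grad (u n) x + grad (v n) x)" for n
      using 1 2 by (simp add: fun_eq_iff grad_add)
    ultimately show "L2_tendsto (\<lambda>n. grad (\<lambda>x. u n x + v n x)) (\<lambda>x. g x + h x)" by simp
  qed
  then show ?thesis by (auto simp: grad_field_def)
qed

lemma grad_field_scaleR:
  assumes "grad_field g" shows "grad_field (\<lambda>x. c *\<^sub>R g x)"
proof -
  obtain \<phi> u where 1: "L2_per \<phi>" "L2_per g" "\<And>n. smooth_per (u n)" "L2_tendsto u \<phi>" "L2_tendsto (\<lambda>n. grad (u n)) g"
    using assms(1) by (rule grad_fieldE) blast
  have "H1_per_grad (\<lambda>x. c *\<^sub>R \<phi> x) (\<lambda>x. c *\<^sub>R g x)"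
    unfolding H1_per_grad_def
  proof (intro conjI exI[of _ "\<lambda>n x. c * u n x"] allI L2_per_scaleR smooth_per_cmult 1)
    show "L2_tendsto (\<lambda>n x. c * u n x) (\<lambda>x. c *\<^sub>R \<phi> x)"
      using L2_tendsto_scaleR[OF 1(4), of c] by simp
    have "grad (\<lambda>x. c * u n x) = (\<lambda>x. c *\<^sub>R grad (u n) x)" for n
      using 1 by (simp add: fun_eq_iff grad_cmult)
    then show "L2_tendsto (\<lambda>n. grad (\<lambda>x. c * u n x)) (\<lambda>x. c *\<^sub>R g x)"
      using L2_tendsto_scaleR[OF 1(5), of c] by simp
  qed
  then show ?thesis by (auto simp: grad_field_def)
qed

text \<open>Mean square approximation does not see null sets. Only periodicity and measurability of
  the new representative must be supplied, since \<open>L2_per\<close> demands periodicity at every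
  point.\<close>

lemma grad_field_cong_AE:
  assumes "grad_field g" "L2_per h" "AE x in cell. g x = h x"
  shows "grad_field h"
proof -
  obtain \<phi> u where 1: "L2_per \<phi>" "L2_per g" "\<And>n. smooth_per (u n)" "L2_tendsto u \<phi>" "L2_tendsto (\<lambda>n. grad (u n)) g"
    using assms(1) by (rule grad_fieldE) blast
  have "(LINT x|cell. (norm (grad (u n) x - g x))\<^sup>2) = (LINT x|cell. (norm (grad (u n) x - h x))\<^sup>2)" for n
  proof (rule integral_cong_AE)
    have m: "grad (u n) \<in> borel_measurable cell" "g \<in> borel_measurable cell" "h \<in> borel_measurable cell"
      using L2_per_grad[OF 1(3), THEN L2_per_sq_int] L2_per_sq_int[OF 1(2)] L2_per_sq_int[OF assms(2)]
      by (auto simp: sq_int_def)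
    then show "(\<lambda>x. (norm (grad (u n) x - g x))\<^sup>2) \<in> borel_measurable cell"
      "(\<lambda>x. (norm (grad (u n) x - h x))\<^sup>2) \<in> borel_measurable cell" by auto
    show "AE x in cell. (norm (grad (u n) x - g x))\<^sup>2 = (norm (grad (u n) x - h x))\<^sup>2"
      using assms(3) by eventually_elim simp
  qed
  then have "L2_tendsto (\<lambda>n. grad (u n)) h"
    using 1(5) by (simp add: L2_tendsto_def)
  then have "H1_per_grad \<phi> h"
    unfolding H1_per_grad_def by (intro conjI exI[of _ u] allI 1 assms(2))
  then show ?thesis by (auto simp: grad_field_def)
qed

text \<open>The limit is a pointwise \<open>lim\<close> formed on the whole plane, so it is Lebesgue
  measurable there and exactly periodic, not merely almost everywhere.\<close>

lemma L2_per_lim: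
  fixes u :: "nat \<Rightarrow> vec2 \<Rightarrow> 'b::euclidean_space"
  assumes u: "\<And>n. L2_per (u n)"
    and cauchy: "\<And>e. e > 0 \<Longrightarrow> \<exists>N. \<forall>m\<ge>N. \<forall>n\<ge>N. (LINT x|cell. (norm (u m x - u n x))\<^sup>2) < e"
  obtains f where "L2_per f" "L2_tendsto u f"
proof -
  obtain r where r: "strict_mono (r::nat\<Rightarrow>nat)" "sq_int cell (\<lambda>x. lim (\<lambda>k. u (r k) x))"
    "(\<lambda>n. LINT x|cell. (norm (u n x - lim (\<lambda>k. u (r k) x)))\<^sup>2) \<longlonglongrightarrow> 0"
    using sq_int_complete[OF finite_measure_cell L2_per_sq_int[OF u] cauchy] by blast
  have "L2_per (\<lambda>x. lim (\<lambda>k. u (r k) x))"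
    unfolding L2_per_iff
  proof (intro conjI r)
    show "(\<lambda>x. lim (\<lambda>k. u (r k) x)) \<in> borel_measurable lebesgue"
      using u by (intro borel_measurable_lim_metric) (simp add: L2_per_def)
    show "periodic (\<lambda>x. lim (\<lambda>k. u (r k) x))"
      using u by (simp add: L2_per_def periodic_def)
  qed
  then show thesis
    using r(3) by (intro that) (simp_all add: L2_tendsto_def)
qed

text \<open>Only the gradients are assumed Cauchy. Subtracting the means leaves them unchanged and
  lets the Poincare inequality make the potentials Cauchy as well.\<close>

lemma grad_field_limit:
  assumes u: "\<And>n. smooth_per (u n)"
    and cauchy: "\<And>e. e > 0 \<Longrightarrow> \<exists>N. \<forall>m\<ge>N. \<forall>n\<ge>N. (LINT x|cell. (norm (grad (u m) x - grad (u n) x))\<^sup>2) < e"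
  obtains g where "grad_field g" "L2_tendsto (\<lambda>n. grad (u n)) g"
proof -
  define v where "v n x = u n x - (LINT y|cell. u n y)" for n x
  have v: "smooth_per (v n)" for n
    unfolding v_def by (intro smooth_per_diff u smooth_per_const)
  have gv: "grad (v n) = grad (u n)" for n
    unfolding v_def using grad_diff[OF u smooth_per_const] by (simp add: fun_eq_iff)
  have iu: "integrable cell (u n)" "integrable cell (v n)" for n
    by (intro continuous_integrable_cell smooth_per_continuous u v)+
  have mv: "(LINT x|cell. v n x) = 0" for n
    unfolding v_def using iu by simp
  obtain g where g: "L2_per g" "L2_tendsto (\<lambda>n. grad (u n)) g"
    using L2_per_lim[OF L2_per_grad[OF u] cauchy] by blast
  have "\<exists>N. \<forall>m\<ge>N. \<forall>n\<ge>N. (LINT x|cell. (norm (v m x - v n x))\<^sup>2) < e" if e: "e > 0" for e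
  proof -
    \<comment> \<open>The quarter compensates the Poincare constant 4.\<close>
    obtain N where N: "\<And>m n. m \<ge> N \<Longrightarrow> n \<ge> N \<Longrightarrow> (LINT x|cell. (norm (grad (u m) x - grad (u n) x))\<^sup>2) < e / 4"
    proof -
      have "e / 4 > 0" using e by simp
      from cauchy[OF this] show thesis using that by blast
    qed
    have "(LINT x|cell. (norm (v m x - v n x))\<^sup>2) < e" if "m \<ge> N" "n \<ge> N" for m n
    proof -
      have "(LINT x|cell. (v m x - v n x)\<^sup>2) \<le> 4 * (LINT x|cell. (norm (grad (\<lambda>x. v m x - v n x) x))\<^sup>2)"
        using iu mv by (intro poincare smooth_per_diff v) simp
      then show ?thesis using N[OF that] by (simp add: grad_diff[OF v v] gv)
    qed
    then show ?thesis by blast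
  qed
  then obtain \<phi> where "L2_per \<phi>" "L2_tendsto v \<phi>"
    using L2_per_lim[of v, OF L2_per_smooth[OF v]] by blast
  then have "H1_per_grad \<phi> g"
    unfolding H1_per_grad_def
    by (intro conjI exI[of _ v] allI v g) (simp_all add: gv g)
  then show thesis
    using g by (intro that) (auto simp: grad_field_def)
qed

lemma div_free_L2_per: "div_free F \<Longrightarrow> L2_per F"
  by (simp add: div_free_def)

text \<open>The definition of \<open>div_free\<close> tests against smooth gradients only; density
  extends the orthogonality to all gradient fields.\<close>

lemma grad_div_free_orthogonal:
  assumes g: "grad_field g" and F: "div_free F"
  shows "(LINT x|cell. F x \<bullet> g x) = 0"
proof -
  obtain u where u: "\<And>n. smooth_per (u n)" "L2_tendsto (\<lambda>n. grad (u n)) g"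
    using grad_field_approx[OF g] by blast
  have "(\<lambda>n. LINT x|cell. grad (u n) x \<bullet> F x) \<longlonglongrightarrow> (LINT x|cell. g x \<bullet> F x)"
    using u(2) unfolding L2_tendsto_def
    by (intro sq_int_inner_tendsto L2_per_sq_int L2_per_grad u grad_field_L2_per g div_free_L2_per F)
  moreover have "(LINT x|cell. grad (u n) x \<bullet> F x) = 0" for n
    using F u(1) by (simp add: div_free_def inner_commute[of "grad _ _"])
  ultimately show ?thesis
    by (simp add: LIMSEQ_const_iff inner_commute[of "F _"])
qed

lemma div_free_const: "div_free (\<lambda>x. c)"
  unfolding div_free_def
proof (intro conjI allI impI L2_per_const)
  fix \<psi> assume \<psi>: "smooth_per \<psi>"
  have i: "integrable cell (partial i \<psi>)" for i
    by (intro continuous_integrable_cell continuous_partial \<psi>)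
  have "(LINT x|cell. c \<bullet> grad \<psi> x) = (LINT x|cell. c $ 1 * partial 1 \<psi> x + c $ 2 * partial 2 \<psi> x)"
    by (simp add: inner_vec_def sum_2 grad_def)
  also have "\<dots> = 0" using i by (simp add: integral_partial_eq_0[OF \<psi>])
  finally show "(LINT x|cell. c \<bullet> grad \<psi> x) = 0" .
qed

text \<open>Constants are divergence-free, so the mean is orthogonal to every constant, in
  particular to itself.\<close>

lemma integral_grad_field:
  assumes g: "grad_field g" shows "(LINT x|cell. g x) = 0"
proof -
  have "integrable cell g"
    by (intro cell.sq_int_imp_integrable L2_per_sq_int grad_field_L2_per g)
  then have "(LINT x|cell. g x) \<bullet> c = 0" for c
    using grad_div_free_orthogonal[OF g div_free_const[of c]]
    by (simp add: inner_commute[of c])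
  from this[of "LINT x|cell. g x"] show ?thesis by (simp only: inner_eq_zero_iff)
qed

lemma Rperp_nth [simp]: "(Rperp *v v) $ 1 = - v $ 2" "(Rperp *v v) $ 2 = v $ 1"
  by (simp_all add: Rperp_def matrix_vector_mult_def sum_2)

lemma Rperp_skew: "(Rperp *v a) \<bullet> b = - (a \<bullet> (Rperp *v b))"
  by (simp add: inner_vec_def sum_2)

lemma Rperp_Rperp [simp]: "Rperp *v (Rperp *v v) = - v"
  by (simp add: vec_eq_iff forall_2)

text \<open>For smooth potentials this is the symmetry of \<open>integral_partial_commute\<close>.
  Skewness then moves the quarter turn onto the test gradient, so the general case follows from
  orthogonality of \<open>g\<close> to a field already known to be divergence-free.\<close>

lemma div_free_Rperp_grad:
  assumes g: "grad_field g" shows "div_free (\<lambda>x. Rperp *v g x)"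
  unfolding div_free_def
proof (intro conjI allI impI)
  have R: "bounded_linear ((*v) Rperp)" by simp
  show "L2_per (\<lambda>x. Rperp *v g x)"
    by (rule L2_per_bounded_linear[OF R grad_field_L2_per[OF g]])
  fix \<psi> assume \<psi>: "smooth_per \<psi>"
  have "div_free (\<lambda>x. Rperp *v grad \<psi> x)"
    unfolding div_free_def
  proof (intro conjI allI impI)
    show "L2_per (\<lambda>x. Rperp *v grad \<psi> x)"
      by (rule L2_per_bounded_linear[OF R L2_per_grad[OF \<psi>]])
    fix \<eta> assume \<eta>: "smooth_per \<eta>"
    have i: "integrable cell (\<lambda>x. partial i \<psi> x * partial j \<eta> x)" for i j
      by (intro continuous_integrable_cell continuous_intros continuous_partial \<psi> \<eta>)
    have "(LINT x|cell. (Rperp *v grad \<psi> x) \<bullet> grad \<eta> x)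
        = (LINT x|cell. partial 1 \<psi> x * partial 2 \<eta> x - partial 2 \<psi> x * partial 1 \<eta> x)"
      by (simp add: inner_vec_def sum_2 grad_def)
    also have "\<dots> = 0"
      using i integral_partial_commute[OF \<psi> \<eta>, of 1 2] by simp
    finally show "(LINT x|cell. (Rperp *v grad \<psi> x) \<bullet> grad \<eta> x) = 0" .
  qed
  from grad_div_free_orthogonal[OF g this]
  show "(LINT x|cell. (Rperp *v g x) \<bullet> grad \<psi> x) = 0"
    unfolding Rperp_skew[of "g _"] by (simp add: inner_commute)
qed

lemma div_free_add:
  assumes F: "div_free F" and G: "div_free G" shows "div_free (\<lambda>x. F x + G x)"
  unfolding div_free_def
proof (intro conjI allI impI L2_per_add div_free_L2_per F G)
  fix \<psi> assume \<psi>: "smooth_per \<psi>"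
  have "integrable cell (\<lambda>x. F x \<bullet> grad \<psi> x)" "integrable cell (\<lambda>x. G x \<bullet> grad \<psi> x)"
    by (intro sq_int_inner L2_per_sq_int div_free_L2_per F G L2_per_grad \<psi>)+
  then show "(LINT x|cell. (F x + G x) \<bullet> grad \<psi> x) = 0"
    using F G \<psi> by (simp add: inner_add_left div_free_def)
qed

lemma div_free_scaleR:
  "div_free F \<Longrightarrow> div_free (\<lambda>x. c *\<^sub>R F x)"
  by (auto simp: div_free_def intro: L2_per_scaleR)

lemma div_free_cong_AE:
  assumes F: "div_free F" and G: "L2_per G" and eq: "AE x in cell. F x = G x"
  shows "div_free G"
  unfolding div_free_def
proof (intro conjI allI impI G)
  fix \<psi> assume \<psi>: "smooth_per \<psi>"
  have "(LINT x|cell. F x \<bullet> grad \<psi> x) = (LINT x|cell. G x \<bullet> grad \<psi> x)"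
  proof (rule integral_cong_AE)
    show "(\<lambda>x. F x \<bullet> grad \<psi> x) \<in> borel_measurable cell" "(\<lambda>x. G x \<bullet> grad \<psi> x) \<in> borel_measurable cell"
      by (intro borel_measurable_integrable sq_int_inner L2_per_sq_int div_free_L2_per F G L2_per_grad \<psi>)+
    show "AE x in cell. F x \<bullet> grad \<psi> x = G x \<bullet> grad \<psi> x"
      using eq by eventually_elim simp
  qed
  then show "(LINT x|cell. G x \<bullet> grad \<psi> x) = 0"
    using F \<psi> by (simp add: div_free_def)
qed

section \<open>The weighted projection onto gradient fields\<close>

lemma tcomp_nth [simp]: "tcomp a e $ i = e $ (a, i)"
  by (simp add: tcomp_def)

lemma bounded_linear_tcomp: "bounded_linear (tcomp a)"
  by (rule linear_conv_bounded_linear[THEN iffD1])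
    (auto intro!: linearI simp: vec_eq_iff)

lemma tcomp_simps [simp]:
  "tcomp a (x + y) = tcomp a x + tcomp a y" "tcomp a (x - y) = tcomp a x - tcomp a y"
  "tcomp a (c *\<^sub>R x) = c *\<^sub>R tcomp a x" "tcomp a 0 = 0" "tcomp a (- x) = - tcomp a x"
  by (simp_all add: vec_eq_iff)

lemma tvec_eq_iff: "e = f \<longleftrightarrow> (\<forall>a. tcomp a e = tcomp a f)"
  by (auto simp: vec_eq_iff)

lemma inner_tvec: "e \<bullet> f = (\<Sum>a\<in>UNIV. tcomp a e \<bullet> tcomp a f)"
  by (simp add: inner_vec_def sum.cartesian_product UNIV_Times_UNIV case_prod_beta)

text \<open>Counterpart of \<open>tpair\<close> for a family indexed by the summand, so that both
  components are handled by one quantifier.\<close>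

definition tjoin :: "(2 \<Rightarrow> vec2) \<Rightarrow> tvec" where
  "tjoin g = (\<chi> p. g (fst p) $ snd p)"

lemma tcomp_tjoin [simp]: "tcomp a (tjoin g) = g a"
  by (simp add: tjoin_def vec_eq_iff)

lemma tpair_eq_tjoin: "tpair u v = tjoin (\<lambda>a. if a = 1 then u else v)"
  by (simp add: tpair_def tjoin_def vec_eq_iff)

lemma tcomp_tpair [simp]: "tcomp 1 (tpair u v) = u" "tcomp 2 (tpair u v) = v"
  by (simp_all add: tpair_eq_tjoin)

lemma tpair_tcomp: "tpair (tcomp 1 e) (tcomp 2 e) = e"
  by (simp add: tvec_eq_iff forall_2)

lemma bounded_linear_tjoin_single: "bounded_linear (\<lambda>v::vec2. tjoin (\<lambda>b. if b = a then v else 0))"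
  by (rule linear_conv_bounded_linear[THEN iffD1])
    (auto intro!: linearI simp: tvec_eq_iff)

lemma L2_per_tvec:
  assumes "\<And>a. L2_per (\<lambda>x. tcomp a (f x))" shows "L2_per f"
proof -
  have "L2_per (\<lambda>x. tjoin (\<lambda>b. if b = 1 then tcomp 1 (f x) else 0) + tjoin (\<lambda>b. if b = 2 then tcomp 2 (f x) else 0))"
    by (intro L2_per_add L2_per_bounded_linear[OF bounded_linear_tjoin_single] assms)
  moreover have "tjoin (\<lambda>b. if b = 1 then tcomp 1 (f x) else 0) + tjoin (\<lambda>b. if b = 2 then tcomp 2 (f x) else 0) = f x" for x
    by (simp add: tvec_eq_iff forall_2)
  ultimately show ?thesis by simp
qed

lemma L2_per_tcomp: "L2_per f \<Longrightarrow> L2_per (\<lambda>x. tcomp a (f x))"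
  by (rule L2_per_bounded_linear[OF bounded_linear_tcomp])

lemma integral_tcomp:
  assumes "L2_per f" shows "tcomp a (LINT x|cell. f x) = (LINT x|cell. tcomp a (f x))"
  using integral_bounded_linear[OF bounded_linear_tcomp cell.sq_int_imp_integrable[OF L2_per_sq_int[OF assms]], of a]
  by simp

lemma continuous_matrix_vector: "continuous_on UNIV (\<lambda>p. (fst p :: real^'n^'m) *v snd p)"
  unfolding matrix_vector_mult_def
  by (intro continuous_on_vec_lambda continuous_intros)

text \<open>Coercivity and boundedness uniform in \<open>x\<close>: extreme values of continuous
  functions on the compact product of \<open>K\<close> with the unit sphere.\<close>

lemma composite_bounds:
  assumes "composite L"
  obtains c C where "0 < c" "0 < C" "\<And>x v. c * (norm v)\<^sup>2 \<le> v \<bullet> (L x *v v)" "\<And>x v. norm (L x *v v) \<le> C * norm v"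
proof -
  obtain K where K: "compact K" "K \<subseteq> SymPos" "range L \<subseteq> K"
    using assms by (auto simp: composite_def)
  let ?S = "K \<times> sphere (0::tvec) 1"
  have S: "compact ?S" by (intro compact_Times K compact_sphere)
  have "(axis (1,1) 1 :: tvec) \<in> sphere 0 1" by (simp add: norm_axis_1)
  then have ne: "?S \<noteq> {}" using K(3) by auto
  have mv: "continuous_on ?S (\<lambda>p. fst p *v snd p)"
    by (rule continuous_on_subset[OF continuous_matrix_vector]) simp
  obtain p where p: "p \<in> ?S" "\<And>q. q \<in> ?S \<Longrightarrow> snd p \<bullet> (fst p *v snd p) \<le> snd q \<bullet> (fst q *v snd q)"
    using continuous_attains_inf[OF S ne, of "\<lambda>p. snd p \<bullet> (fst p *v snd p)"]
      continuous_on_inner[OF continuous_on_snd[OF continuous_on_id] mv] by auto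
  obtain p' where p': "p' \<in> ?S" "\<And>q. q \<in> ?S \<Longrightarrow> norm (fst q *v snd q) \<le> norm (fst p' *v snd p')"
    using continuous_attains_sup[OF S ne continuous_on_norm[OF mv]] by auto
  let ?c = "snd p \<bullet> (fst p *v snd p)" and ?C = "norm (fst p' *v snd p')"
  have c: "0 < ?c"
  proof -
    have "fst p \<in> SymPos" "snd p \<noteq> 0" using p(1) K(2) by (auto simp: mem_Times_iff)
    then show ?thesis by (auto simp: SymPos_def qless_def)
  qed
  have LK: "L x \<in> K" for x using K(3) by auto
  show thesis
  \<comment> \<open>The added 1 makes the upper constant strictly positive.\<close>
  proof (rule that[of ?c "?C + 1"])
    fix x and v :: tvec
    let ?w = "(1 / norm v) *\<^sub>R v"
    have w: "(L x, ?w) \<in> ?S" if "v \<noteq> 0" using LK[of x] that by simp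
    show "?c * (norm v)\<^sup>2 \<le> v \<bullet> (L x *v v)"
    proof (cases "v = 0")
      case False
      from p(2)[OF w[OF this]] have "?c \<le> (v \<bullet> (L x *v v)) / (norm v)\<^sup>2"
        by (simp add: matrix_vector_mult_scaleR power2_eq_square)
      then show ?thesis using False by (simp add: field_simps)
    qed simp
    show "norm (L x *v v) \<le> (?C + 1) * norm v"
    proof (cases "v = 0")
      case False
      from p'(2)[OF w[OF this]] have "norm (L x *v v) / norm v \<le> ?C"
        by (simp add: matrix_vector_mult_scaleR)
      then have "norm (L x *v v) \<le> ?C * norm v" using False by (simp add: field_simps)
      then show ?thesis using norm_ge_zero[of v] unfolding distrib_right by linarith
    qed simp
  qed (use c in \<open>auto intro: add_nonneg_pos\<close>)
qed

lemma composite_SymPos: "composite L \<Longrightarrow> L x \<in> SymPos"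
  unfolding composite_def by blast

lemma Sym_inner_commute:
  fixes A :: "real^'n^'n"
  assumes "A \<in> Sym" shows "(A *v v) \<bullet> w = v \<bullet> (A *v w)"
  using assms dot_lmul_matrix[of v A w] by (simp add: Sym_def transpose_matrix_vector[symmetric])

lemma composite_L2_per:
  assumes L: "composite L" and f: "L2_per f"
  shows "L2_per (\<lambda>x. L x *v f x)"
proof -
  obtain c C where C: "\<And>x v. norm (L x *v v) \<le> C * norm v"
    using composite_bounds[OF L] by metis
  have m: "(\<lambda>x. L x *v f x) \<in> borel_measurable lebesgue"
    using borel_measurable_continuous_Pair[of L lebesgue f "\<lambda>A v. A *v v"] L f continuous_matrix_vector
    by (auto simp: composite_def L2_per_def)
  have "sq_int cell (\<lambda>x. L x *v f x)"
    by (rule sq_int_bound[OF L2_per_sq_int[OF f], where C=C])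
      (use m C in \<open>auto intro: measurable_restrict_space1\<close>)
  with m L f show ?thesis by (auto simp: L2_per_iff composite_def periodic_def)
qed

definition gpair :: "(2 \<Rightarrow> vec2 \<Rightarrow> real) \<Rightarrow> vec2 \<Rightarrow> tvec" where
  "gpair w x = tjoin (\<lambda>a. grad (w a) x)"

lemma gpair_lincomb:
  assumes "\<And>a. smooth_per (w a)" "\<And>a. smooth_per (w' a)"
  shows "gpair (\<lambda>a x. w a x + c * w' a x) x = gpair w x + c *\<^sub>R gpair w' x"
  using assms by (simp add: gpair_def tvec_eq_iff grad_add grad_cmult smooth_per_cmult)

lemma L2_per_gpair: "(\<And>a. smooth_per (w a)) \<Longrightarrow> L2_per (gpair w)"
  by (rule L2_per_tvec) (simp add: gpair_def L2_per_grad)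

lemma L2_tendsto_tvec:
  assumes "\<And>a. L2_tendsto (\<lambda>n x. tcomp a (u n x)) (\<lambda>x. tcomp a (f x))"
    and "\<And>n. L2_per (u n)" "L2_per f"
  shows "L2_tendsto u f"
proof -
  have "(LINT x|cell. (norm (u n x - f x))\<^sup>2)
      = (\<Sum>a\<in>UNIV. LINT x|cell. (norm (tcomp a (u n x) - tcomp a (f x)))\<^sup>2)" for n
  proof -
    have "(norm e)\<^sup>2 = (\<Sum>a\<in>UNIV. (norm (tcomp a e))\<^sup>2)" for e
      by (simp add: power2_norm_eq_inner inner_tvec)
    then have "(LINT x|cell. (norm (u n x - f x))\<^sup>2)
        = (LINT x|cell. (\<Sum>a\<in>UNIV. (norm (tcomp a (u n x) - tcomp a (f x)))\<^sup>2))"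
      by simp
    also have "\<dots> = (\<Sum>a\<in>UNIV. LINT x|cell. (norm (tcomp a (u n x) - tcomp a (f x)))\<^sup>2)"
      by (intro Bochner_Integration.integral_sum sq_int_integrable sq_int_diff L2_per_sq_int L2_per_tcomp assms)
    finally show ?thesis .
  qed
  moreover have "(\<lambda>n. \<Sum>a\<in>UNIV. LINT x|cell. (norm (tcomp a (u n x) - tcomp a (f x)))\<^sup>2) \<longlonglongrightarrow> (\<Sum>a\<in>(UNIV::2 set). 0)"
    by (intro tendsto_sum) (use assms(1) in \<open>auto simp: L2_tendsto_def\<close>)
  ultimately show ?thesis by (simp add: L2_tendsto_def)
qed

text \<open>Minimise the energy of \<open>F + gpair w\<close> over smooth \<open>w\<close>; by the parallelogram identity a
  minimising sequence is Cauchy, and its limit satisfies the Euler--Lagrange equation.\<close>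

lemma weighted_projection:
  assumes L: "composite L" and F: "L2_per F"
  obtains G where "\<And>a. grad_field (\<lambda>x. tcomp a (G x))" "\<And>a. div_free (\<lambda>x. tcomp a (L x *v (F x + G x)))"
proof -
  obtain c C where c: "0 < c" "\<And>x v. c * (norm v)\<^sup>2 \<le> v \<bullet> (L x *v v)"
    using composite_bounds[OF L] by metis
  define W where "W = {w::2 \<Rightarrow> vec2 \<Rightarrow> real. \<forall>a. smooth_per (w a)}"
  define B where "B f g = (LINT x|cell. f x \<bullet> (L x *v g x))" for f g
  have Wlin: "(\<lambda>a x. w a x + t * w' a x) \<in> W" if "w \<in> W" "w' \<in> W" for w w' t
    using that by (auto simp: W_def intro!: smooth_per_add smooth_per_cmult)
  have gW: "L2_per (gpair w)" if "w \<in> W" for w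
    using that by (intro L2_per_gpair) (auto simp: W_def)
  have sq: "sq_int cell f" "sq_int cell (\<lambda>x. L x *v f x)" if "L2_per f" for f
    using that by (auto intro: L2_per_sq_int composite_L2_per[OF L])
  have iB: "integrable cell (\<lambda>x. f x \<bullet> (L x *v g x))" if "L2_per f" "L2_per g" for f g
    by (intro sq_int_inner sq that)
  have B_sym: "B f g = B g f" for f g
  proof -
    have "f x \<bullet> (L x *v g x) = g x \<bullet> (L x *v f x)" for x
      using composite_SymPos[OF L, of x] Sym_inner_commute[of "L x" "f x" "g x"]
      by (simp add: SymPos_def inner_commute)
    then show ?thesis by (simp only: B_def)
  qed
  have B_lin: "B (\<lambda>x. f x + t *\<^sub>R g x) h = B f h + t * B g h" if "L2_per f" "L2_per g" "L2_per h" for f g h t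
    unfolding B_def using iB[OF that(1,3)] iB[OF that(2,3)] by (simp add: inner_add_left)
  have B_quad: "B (\<lambda>x. f x + t *\<^sub>R g x) (\<lambda>x. f x + t *\<^sub>R g x) = B f f + 2 * t * B f g + t\<^sup>2 * B g g"
    if "L2_per f" "L2_per g" for f g t
  proof -
    have fg: "L2_per (\<lambda>x. f x + t *\<^sub>R g x)" by (intro L2_per_add L2_per_scaleR that)
    show ?thesis
      using B_lin[OF that fg, of t] B_lin[OF that that(1), of t] B_lin[OF that that(2), of t]
        B_sym[of f "\<lambda>x. f x + t *\<^sub>R g x"] B_sym[of g "\<lambda>x. f x + t *\<^sub>R g x"] B_sym[of g f]
      by (simp add: algebra_simps power2_eq_square)
  qed
  have B_pos: "c * (LINT x|cell. (norm (f x))\<^sup>2) \<le> B f f" if "L2_per f" for f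
  proof -
    have "c * (LINT x|cell. (norm (f x))\<^sup>2) = (LINT x|cell. c * (norm (f x))\<^sup>2)" by simp
    also have "\<dots> \<le> B f f" unfolding B_def
      using c(2) sq_int_integrable[OF sq(1)[OF that]] iB[OF that that] by (intro integral_mono) auto
    finally show ?thesis .
  qed
  have B_nonneg: "0 \<le> B f f" if "L2_per f" for f
    by (rule order_trans[OF _ B_pos[OF that]]) (use c in simp)
  define Q where "Q w = B (\<lambda>x. F x + gpair w x) (\<lambda>x. F x + gpair w x)" for w
  have FW: "L2_per (\<lambda>x. F x + gpair w x)" if "w \<in> W" for w
    by (intro L2_per_add F gW that)
  have W0: "(\<lambda>a x. 0) \<in> W" by (simp add: W_def smooth_per_const)
  have Q_nonneg: "0 \<le> Q w" if "w \<in> W" for w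
    unfolding Q_def by (intro B_nonneg FW that)
  define d where "d = Inf (Q ` W)"
  have bdd: "bdd_below (Q ` W)" by (rule bdd_belowI2[where m=0]) (rule Q_nonneg)
  have d_le: "d \<le> Q w" if "w \<in> W" for w
    unfolding d_def by (intro cInf_lower bdd imageI that)
  have Q_lin: "Q (\<lambda>a x. w a x + t * v a x)
      = Q w + 2 * t * B (\<lambda>x. F x + gpair w x) (gpair v) + t\<^sup>2 * B (gpair v) (gpair v)"
    if "w \<in> W" "v \<in> W" for w v t
  proof -
    have "F x + gpair (\<lambda>a x. w a x + t * v a x) x = (F x + gpair w x) + t *\<^sub>R gpair v x" for x
      using that by (simp add: gpair_lincomb W_def)
    then show ?thesis
      unfolding Q_def using B_quad[OF FW[OF that(1)] gW[OF that(2)], of t] by (simp only:)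
  qed
  have "\<exists>w\<in>W. Q w < d + 1 / real (Suc n)" for n
  proof -
    have "Inf (Q ` W) < d + 1 / real (Suc n)" by (simp add: d_def)
    with cInf_lessD[of "Q ` W"] W0 show ?thesis by blast
  qed
  then obtain w where w: "\<And>n. w n \<in> W" "\<And>n. Q (w n) < d + 1 / real (Suc n)" by metis
  \<comment> \<open>The energy at \<open>w n\<close> exceeds the infimum by less than
    \<open>1 / real (Suc n)\<close>, so adding this slack makes the quadratic in the step length
    nonnegative; its discriminant bounds the first variation.\<close>
  have EL: "(B (\<lambda>x. F x + gpair (w n) x) (gpair v))\<^sup>2 \<le> 1 / real (Suc n) * B (gpair v) (gpair v)" if v: "v \<in> W" for v n
  proof (rule discriminant_ineq)
    fix t
    have "d \<le> Q (\<lambda>a x. w n a x + t * v a x)" by (intro d_le Wlin w v)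
    then show "0 \<le> 1 / real (Suc n) + 2 * t * B (\<lambda>x. F x + gpair (w n) x) (gpair v) + t\<^sup>2 * B (gpair v) (gpair v)"
      using w(2)[of n] Q_lin[OF w(1) v, of n t] by linarith
  qed (use B_nonneg gW v in auto)
  have cauchy: "c * (LINT x|cell. (norm (gpair (w m) x - gpair (w n) x))\<^sup>2) \<le> 2 / real (Suc m) + 2 / real (Suc n)" for m n
  proof -
    define v where "v = (\<lambda>a x. w m a x + (-1) * w n a x)"
    have v: "v \<in> W" unfolding v_def by (intro Wlin w)
    have gv: "gpair v x = gpair (w m) x - gpair (w n) x" for x
      unfolding v_def using w(1) gpair_lincomb[of "w m" "w n" "-1" x] by (simp add: W_def)
    \<comment> \<open>A full step along \<open>v\<close> leads from \<open>w n\<close> to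
      \<open>w m\<close>, half a step to the midpoint, whose energy is at least \<open>d\<close>.
      Eliminating the linear term leaves twice the sum of the two excesses over
      \<open>d\<close>.\<close>
    have 1: "Q (w m) = Q (w n) + 2 * B (\<lambda>x. F x + gpair (w n) x) (gpair v) + B (gpair v) (gpair v)"
    proof -
      have "w m = (\<lambda>a x. w n a x + 1 * v a x)" by (simp add: v_def)
      then show ?thesis using Q_lin[OF w(1)[of n] v, of 1] by simp
    qed
    have 2: "d \<le> Q (w n) + B (\<lambda>x. F x + gpair (w n) x) (gpair v) + B (gpair v) (gpair v) / 4"
      using d_le[OF Wlin[OF w(1)[of n] v, of "1/2"]] Q_lin[OF w(1)[of n] v, of "1/2"]
      by (simp add: power2_eq_square)
    have "B (gpair v) (gpair v) \<le> 2 / real (Suc m) + 2 / real (Suc n)"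
    proof -
      have "2 / real (Suc k) = 2 * (1 / real (Suc k))" for k by simp
      then show ?thesis using 1 2 w(2)[of m] w(2)[of n] by (simp only:)
    qed
    then show ?thesis using B_pos[OF gW[OF v]] by (simp add: gv)
  qed
  have comp_cauchy: "\<exists>N. \<forall>m\<ge>N. \<forall>n\<ge>N. (LINT x|cell. (norm (grad (w m a) x - grad (w n a) x))\<^sup>2) < e"
    if e: "e > 0" for e a
  proof -
    have "0 < c * e / 4" using c e by simp
    then obtain N where N: "inverse (real (Suc N)) < c * e / 4" using reals_Archimedean by blast
    have "(LINT x|cell. (norm (grad (w m a) x - grad (w n a) x))\<^sup>2) < e" if mn: "m \<ge> N" "n \<ge> N" for m n
    proof -
      have "c * (LINT x|cell. (norm (grad (w m a) x - grad (w n a) x))\<^sup>2)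
          \<le> c * (LINT x|cell. (norm (gpair (w m) x - gpair (w n) x))\<^sup>2)"
      proof (intro mult_left_mono integral_mono sq_int_integrable sq_int_diff L2_per_sq_int gW w)
        show "L2_per (grad (w m a))" "L2_per (grad (w n a))"
          using w(1) by (auto simp: W_def intro: L2_per_grad)
        fix x
        have "(norm (tcomp a e))\<^sup>2 \<le> (norm e)\<^sup>2" for e
          unfolding power2_norm_eq_inner inner_tvec[of e] by (rule member_le_sum) auto
        from this[of "gpair (w m) x - gpair (w n) x"]
        show "(norm (grad (w m a) x - grad (w n a) x))\<^sup>2 \<le> (norm (gpair (w m) x - gpair (w n) x))\<^sup>2"
          by (simp add: gpair_def)
      qed (use c in simp)
      also have "\<dots> \<le> 2 * inverse (real (Suc m)) + 2 * inverse (real (Suc n))"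
        using cauchy[of m n] by (simp add: inverse_eq_divide)
      also have "\<dots> \<le> 2 * inverse (real (Suc N)) + 2 * inverse (real (Suc N))"
        using mn by (intro add_mono mult_left_mono le_imp_inverse_le) auto
      also have "\<dots> < c * e" using N by simp
      finally show ?thesis using c by simp
    qed
    then show ?thesis by blast
  qed
  have sm: "smooth_per (w n a)" for n a using w(1) by (simp add: W_def)
  have "\<exists>g. grad_field g \<and> L2_tendsto (\<lambda>n. grad (w n a)) g" for a
    using grad_field_limit[of "\<lambda>n. w n a", OF sm comp_cauchy] by blast
  then obtain g where g: "\<And>a. grad_field (g a)" "\<And>a. L2_tendsto (\<lambda>n. grad (w n a)) (g a)" by metis
  define G where "G x = tjoin (\<lambda>a. g a x)" for x
  have GL: "L2_per G" by (rule L2_per_tvec) (simp add: G_def grad_field_L2_per g)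
  have lim: "L2_tendsto (\<lambda>n. gpair (w n)) G"
  proof (rule L2_tendsto_tvec)
    show "L2_tendsto (\<lambda>n x. tcomp a (gpair (w n) x)) (\<lambda>x. tcomp a (G x))" for a
      using g(2)[of a] by (simp add: gpair_def G_def)
    show "L2_per (gpair (w n))" for n by (intro gW w)
  qed fact
  have limF: "(\<lambda>n. LINT x|cell. (norm ((F x + gpair (w n) x) - (F x + G x)))\<^sup>2) \<longlonglongrightarrow> 0"
    using lim by (simp add: L2_tendsto_def)
  have orth: "B (\<lambda>x. F x + G x) (gpair v) = 0" if v: "v \<in> W" for v
  proof -
    have 1: "(\<lambda>n. B (\<lambda>x. F x + gpair (w n) x) (gpair v)) \<longlonglongrightarrow> B (\<lambda>x. F x + G x) (gpair v)"
      unfolding B_def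
      by (rule sq_int_inner_tendsto[OF _ _ _ limF]) (intro sq FW w gW v L2_per_add F GL)+
    have "(\<lambda>n. inverse (real (Suc n)) * B (gpair v) (gpair v)) \<longlonglongrightarrow> 0 * B (gpair v) (gpair v)"
      by (intro tendsto_mult LIMSEQ_inverse_real_of_nat tendsto_const)
    then have up: "(\<lambda>n. 1 / real (Suc n) * B (gpair v) (gpair v)) \<longlonglongrightarrow> 0"
      by (simp only: inverse_eq_divide mult_zero_left)
    have "(\<lambda>n. (B (\<lambda>x. F x + gpair (w n) x) (gpair v))\<^sup>2) \<longlonglongrightarrow> 0"
      by (rule tendsto_sandwich[OF _ _ tendsto_const up]) (intro always_eventually allI zero_le_power2 EL v)+
    from LIMSEQ_unique[OF tendsto_power[OF 1, of 2] this]
    have "(B (\<lambda>x. F x + G x) (gpair v))\<^sup>2 = 0" .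
    then show ?thesis by simp
  qed
  have "div_free (\<lambda>x. tcomp a (L x *v (F x + G x)))" for a
    unfolding div_free_def
  proof (intro conjI allI impI L2_per_tcomp composite_L2_per L L2_per_add F GL)
    fix \<psi> assume \<psi>: "smooth_per \<psi>"
    \<comment> \<open>A test pair with \<open>\<psi>\<close> in component \<open>a\<close> only
      isolates one component of the flux.\<close>
    define v where "v b = (if b = a then \<psi> else (\<lambda>x. 0))" for b
    have v: "v \<in> W" using \<psi> by (auto simp: W_def v_def smooth_per_const)
    have "tcomp a (L x *v (F x + G x)) \<bullet> grad \<psi> x = (F x + G x) \<bullet> (L x *v gpair v x)" for x
    proof -
      have eq: "tcomp b (gpair v x) = (if b = a then grad \<psi> x else 0)" for b
        by (simp add: gpair_def v_def)
      have "(L x *v (F x + G x)) \<bullet> gpair v x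
          = (\<Sum>b\<in>UNIV. if b = a then tcomp a (L x *v (F x + G x)) \<bullet> grad \<psi> x else 0)"
        unfolding inner_tvec eq by (intro sum.cong) auto
      also have "\<dots> = tcomp a (L x *v (F x + G x)) \<bullet> grad \<psi> x"
        by simp
      finally have "(L x *v (F x + G x)) \<bullet> gpair v x = tcomp a (L x *v (F x + G x)) \<bullet> grad \<psi> x" .
      then show ?thesis
        using composite_SymPos[OF L, of x] by (simp add: SymPos_def Sym_inner_commute)
    qed
    then show "(LINT x|cell. tcomp a (L x *v (F x + G x)) \<bullet> grad \<psi> x) = 0"
      using orth[OF v] by (simp add: B_def)
  qed
  moreover have "grad_field (\<lambda>x. tcomp a (G x))" for a by (simp add: G_def g)
  ultimately show thesis by (intro that[of G])
qed

section \<open>Completeness of the trigonometric system\<close>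

definition int_vec :: "vec2 \<Rightarrow> bool" where
  "int_vec k \<longleftrightarrow> (\<forall>i. k $ i \<in> \<int>)"

lemma int_vec_closed: "int_vec 0" "int_vec k \<Longrightarrow> int_vec l \<Longrightarrow> int_vec (k + l)" "int_vec k \<Longrightarrow> int_vec l \<Longrightarrow> int_vec (k - l)"
  by (auto simp: int_vec_def)

lemma int_vec_axis: "int_vec (axis i 1)"
  by (auto simp: int_vec_def axis_def)

lemma has_derivative_trig:
  "((\<lambda>x. a * cos (2 * pi * (k \<bullet> x)) + b * sin (2 * pi * (k \<bullet> x))) has_derivative
    (\<lambda>h. (b * cos (2 * pi * (k \<bullet> x)) - a * sin (2 * pi * (k \<bullet> x))) * (2 * pi * (k \<bullet> h)))) (at (x::vec2))"
  by (auto intro!: derivative_eq_intros simp: algebra_simps)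

lemma partial_trig:
  "partial i (\<lambda>x. a * cos (2 * pi * (k \<bullet> x)) + b * sin (2 * pi * (k \<bullet> x)))
   = (\<lambda>x. (2 * pi * k $ i * b) * cos (2 * pi * (k \<bullet> x)) + (- (2 * pi * k $ i * a)) * sin (2 * pi * (k \<bullet> x)))"
  unfolding partial_def frechet_derivative_at[OF has_derivative_trig, symmetric]
  by (simp add: inner_axis fun_eq_iff algebra_simps)

lemma grad_trig:
  "grad (\<lambda>x. a * cos (2 * pi * (k \<bullet> x)) + b * sin (2 * pi * (k \<bullet> x))) x
   = (2 * pi * (b * cos (2 * pi * (k \<bullet> x)) - a * sin (2 * pi * (k \<bullet> x)))) *\<^sub>R k"
  unfolding grad_def partial_trig by (simp add: vec_eq_iff algebra_simps)

text \<open>At a fixed frequency the combinations of cosine and sine are closed under partial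
  derivatives, so the induction must leave the coefficients arbitrary.\<close>

lemma Ck_trig: "Ck n (\<lambda>x. a * cos (2 * pi * (k \<bullet> x)) + b * sin (2 * pi * (k \<bullet> x)))"
proof (induction n arbitrary: a b)
  case 0
  show ?case by (auto intro!: continuous_intros)
next
  case (Suc n)
  have "(\<lambda>x. a * cos (2 * pi * (k \<bullet> x)) + b * sin (2 * pi * (k \<bullet> x))) differentiable_on UNIV"
    unfolding differentiable_on_def using has_derivative_trig differentiableI by blast
  then show ?case using Suc by (simp only: Ck.simps partial_trig) simp
qed

lemma trig_shift:
  assumes "n \<in> \<int>" shows "cos (t + 2 * pi * n) = cos t" "sin (t + 2 * pi * n) = sin t"
proof -
  obtain m where "n = of_int m" using assms by (rule Ints_cases)
  then show "cos (t + 2 * pi * n) = cos t" "sin (t + 2 * pi * n) = sin t"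
    by (simp_all add: cos_add sin_add)
qed

lemma smooth_per_trig:
  assumes "int_vec k"
  shows "smooth_per (\<lambda>x. a * cos (2 * pi * (k \<bullet> x)) + b * sin (2 * pi * (k \<bullet> x)))"
  unfolding smooth_per_def periodic_def
proof (intro conjI allI Ck_trig)
  fix x i
  have *: "2 * pi * (k \<bullet> (x + axis i 1)) = 2 * pi * (k \<bullet> x) + 2 * pi * k $ i"
    by (simp add: inner_axis inner_add_right algebra_simps)
  have "k $ i \<in> \<int>" using assms by (simp add: int_vec_def)
  then show "a * cos (2 * pi * (k \<bullet> (x + axis i 1))) + b * sin (2 * pi * (k \<bullet> (x + axis i 1)))
     = a * cos (2 * pi * (k \<bullet> x)) + b * sin (2 * pi * (k \<bullet> x))"
    unfolding * by (simp add: trig_shift)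
qed

text \<open>Products are not a constructor: they follow from the product-to-sum formulas, and
  orthogonality to all trigonometric polynomials can then be checked on single frequencies and
  linear combinations.\<close>

inductive trigpoly :: "(vec2 \<Rightarrow> real) \<Rightarrow> bool" where
  cos: "int_vec k \<Longrightarrow> trigpoly (\<lambda>x. cos (2 * pi * (k \<bullet> x)))"
| sin: "int_vec k \<Longrightarrow> trigpoly (\<lambda>x. sin (2 * pi * (k \<bullet> x)))"
| add: "trigpoly f \<Longrightarrow> trigpoly g \<Longrightarrow> trigpoly (\<lambda>x. f x + g x)"
| cmult: "trigpoly f \<Longrightarrow> trigpoly (\<lambda>x. c * f x)"

lemma trigpoly_continuous: "trigpoly f \<Longrightarrow> continuous_on UNIV f"
  by (induction rule: trigpoly.induct) (auto intro!: continuous_intros)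

lemma trigpoly_const: "trigpoly (\<lambda>x. c)"
  using trigpoly.cmult[OF trigpoly.cos[OF int_vec_closed(1)], of c] by simp

lemma trigpoly_mult_cos_sin:
  assumes "trigpoly g" "int_vec k"
  shows "trigpoly (\<lambda>x. cos (2 * pi * (k \<bullet> x)) * g x) \<and> trigpoly (\<lambda>x. sin (2 * pi * (k \<bullet> x)) * g x)"
  using assms(1)
proof (induction rule: trigpoly.induct)
  case (cos l)
  have 1: "cos (2 * pi * (k \<bullet> x)) * cos (2 * pi * (l \<bullet> x))
     = (1/2) * cos (2 * pi * ((k - l) \<bullet> x)) + (1/2) * cos (2 * pi * ((k + l) \<bullet> x))" for x
    by (simp add: inner_diff_left inner_add_left right_diff_distrib distrib_left cos_diff cos_add)
  have 2: "sin (2 * pi * (k \<bullet> x)) * cos (2 * pi * (l \<bullet> x))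
     = (1/2) * sin (2 * pi * ((k - l) \<bullet> x)) + (1/2) * sin (2 * pi * ((k + l) \<bullet> x))" for x
    by (simp add: inner_diff_left inner_add_left right_diff_distrib distrib_left sin_diff sin_add)
  show ?case unfolding 1 2
    by (intro conjI trigpoly.intros int_vec_closed cos assms)
next
  case (sin l)
  have 1: "cos (2 * pi * (k \<bullet> x)) * sin (2 * pi * (l \<bullet> x))
     = (1/2) * sin (2 * pi * ((k + l) \<bullet> x)) + (-1/2) * sin (2 * pi * ((k - l) \<bullet> x))" for x
    by (simp add: inner_diff_left inner_add_left right_diff_distrib distrib_left sin_diff sin_add)
  have 2: "sin (2 * pi * (k \<bullet> x)) * sin (2 * pi * (l \<bullet> x))
     = (1/2) * cos (2 * pi * ((k - l) \<bullet> x)) + (-1/2) * cos (2 * pi * ((k + l) \<bullet> x))" for x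
    by (simp add: inner_diff_left inner_add_left right_diff_distrib distrib_left cos_diff cos_add)
  show ?case unfolding 1 2
    by (intro conjI trigpoly.intros int_vec_closed sin assms)
next
  case (add f g)
  then show ?case unfolding distrib_left by (intro conjI trigpoly.add) auto
next
  case (cmult f c)
  then show ?case unfolding mult.left_commute[of _ c] by (intro conjI trigpoly.cmult) auto
qed

lemma trigpoly_mult:
  assumes "trigpoly f" "trigpoly g" shows "trigpoly (\<lambda>x. f x * g x)"
  using assms(1)
proof (induction rule: trigpoly.induct)
  case (add f f')
  show ?case using trigpoly.add[OF add.IH] by (simp only: distrib_right)
next
  case (cmult f c)
  show ?case using trigpoly.cmult[OF cmult.IH, of c] by (simp only: mult.assoc)
qed (use trigpoly_mult_cos_sin[OF assms(2)] in auto)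

text \<open>The flat torus embedded in the product of two complex planes. Real polynomials there
  pull back to trigonometric polynomials, which makes Stone--Weierstrass on the compact image
  applicable.\<close>

definition torus_map :: "vec2 \<Rightarrow> complex \<times> complex" where
  "torus_map x = (cis (2 * pi * x $ 1), cis (2 * pi * x $ 2))"

lemma continuous_torus_map: "continuous_on S torus_map"
  unfolding torus_map_def cis_conv_exp by (intro continuous_intros)

lemma trigpoly_coordinate: "trigpoly (\<lambda>x. cos (2 * pi * x $ i))" "trigpoly (\<lambda>x. sin (2 * pi * x $ i))"
  using trigpoly.cos[OF int_vec_axis[of i]] trigpoly.sin[OF int_vec_axis[of i]] by (simp_all add: inner_axis')

text \<open>A linear functional is a combination of the four real coordinates, and these pull back
  to the cosine and sine of the two basic frequencies.\<close>

lemma trigpoly_torus: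
  assumes "real_polynomial_function g" shows "trigpoly (\<lambda>x. g (torus_map x))"
  using assms
proof (induction rule: real_polynomial_function.induct)
  case (linear f)
  interpret bounded_linear f by fact
  define c where "c = (f (1, 0), f (\<i>, 0), f (0, 1), f (0, \<i>))"
  have eq: "f (z, w) = fst c * Re z + fst (snd c) * Im z + fst (snd (snd c)) * Re w + snd (snd (snd c)) * Im w" for z w
  proof -
    have "(z, w) = Re z *\<^sub>R (1, 0) + Im z *\<^sub>R (\<i>, 0) + Re w *\<^sub>R (0, 1) + Im w *\<^sub>R (0, \<i>)"
      by (simp add: complex_eq_iff)
    then have "f (z, w) = f (Re z *\<^sub>R (1, 0) + Im z *\<^sub>R (\<i>, 0) + Re w *\<^sub>R (0, 1) + Im w *\<^sub>R (0, \<i>))" by simp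
    then show ?thesis by (simp only: add scale c_def mult.commute fst_conv snd_conv real_scaleR_def)
  qed
  show ?case
    unfolding torus_map_def eq cis.simps
    by (intro trigpoly.add trigpoly.cmult trigpoly_coordinate)
qed (auto intro: trigpoly_const trigpoly.add trigpoly_mult)

text \<open>One point has to be interior because opposite faces of the cell have the same
  image.\<close>

lemma torus_map_inj:
  assumes "torus_map x = torus_map y" "x \<in> box 0 1" "y \<in> cbox 0 1"
  shows "x = y"
proof -
  have "x $ i = y $ i" for i
  proof -
    have "cis (2 * pi * x $ i) = cis (2 * pi * y $ i)"
      using assms(1) exhaust_2[of i] by (auto simp: torus_map_def)
    then have "cos (2 * pi * x $ i) = cos (2 * pi * y $ i) \<and> sin (2 * pi * x $ i) = sin (2 * pi * y $ i)"
      by (simp add: complex_eq_iff)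
    then obtain n where "2 * pi * x $ i = 2 * pi * y $ i + 2 * pi * real_of_int n"
      using sin_cos_eq_iff by metis
    then have "2 * pi * x $ i = 2 * pi * (y $ i + real_of_int n)" by (simp add: algebra_simps)
    then have n: "x $ i = y $ i + real_of_int n" by simp
    moreover have "0 < x $ i" "x $ i < 1" "0 \<le> y $ i" "y $ i \<le> 1"
      using assms(2,3) by (auto simp: mem_box_cart)
    ultimately have "-1 < real_of_int n" "real_of_int n < 1" by linarith+
    then have "n = 0" by linarith
    with n show ?thesis by simp
  qed
  then show ?thesis by (simp add: vec_eq_iff)
qed

lemma divide_add_one_le: "0 \<le> t \<Longrightarrow> t / (t + 1) \<le> (1::real)"
  by (simp add: divide_le_eq)

text \<open>Uniform approximation by polynomials on the image of the cell; the error is the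
  tolerance times the integral of \<open>\<bar>f x\<bar>\<close>.\<close>

lemma trig_orthogonal_continuous:
  fixes f :: "vec2 \<Rightarrow> real" and \<phi> :: "complex \<times> complex \<Rightarrow> real"
  assumes f: "sq_int cell f" and orth: "\<And>p. trigpoly p \<Longrightarrow> (LINT x|cell. f x * p x) = 0"
    and \<phi>: "continuous_on UNIV \<phi>"
  shows "(LINT x|cell. f x * \<phi> (torus_map x)) = 0"
proof -
  have sq: "sq_int cell p" if "continuous_on UNIV p" for p :: "vec2 \<Rightarrow> real"
    using that unfolding sq_int_def
    by (intro conjI continuous_borel_cell continuous_integrable_cell continuous_intros)
  have c\<phi>: "continuous_on UNIV (\<lambda>x. \<phi> (torus_map x))"
    by (rule continuous_on_compose2[OF \<phi> continuous_torus_map]) simp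
  have fi: "integrable cell (\<lambda>x. \<bar>f x\<bar>)"
    by (intro integrable_abs cell.sq_int_imp_integrable f)
  let ?N = "LINT x|cell. \<bar>f x\<bar>"
  have "\<bar>LINT x|cell. f x * \<phi> (torus_map x)\<bar> \<le> e" if "e > 0" for e
  proof -
    have N: "0 \<le> ?N" by simp
    \<comment> \<open>Dividing by \<open>?N + 1\<close> instead of \<open>?N\<close> avoids a zero
      denominator.\<close>
    then have "0 < e / (?N + 1)" using that by (intro divide_pos_pos) linarith+
    then obtain g where g: "real_polynomial_function g"
      "\<And>z. z \<in> torus_map ` cbox 0 1 \<Longrightarrow> \<bar>\<phi> z - g z\<bar> < e / (?N + 1)"
      using Stone_Weierstrass_real_polynomial_function[of "torus_map ` cbox 0 1" \<phi> "e / (?N + 1)"]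
        compact_continuous_image[OF continuous_torus_map compact_cbox] continuous_on_subset[OF \<phi>]
      by (metis subset_UNIV)
    note p = trigpoly_torus[OF g(1)]
    note cp = trigpoly_continuous[OF p]
    have i: "integrable cell (\<lambda>x. f x * \<phi> (torus_map x))" "integrable cell (\<lambda>x. f x * g (torus_map x))"
      using sq_int_inner[OF f sq[OF c\<phi>]] sq_int_inner[OF f sq[OF cp]] by simp_all
    have "(LINT x|cell. f x * \<phi> (torus_map x)) = (LINT x|cell. f x * \<phi> (torus_map x) - f x * g (torus_map x))"
      using i orth[OF p] by simp
    also have "\<bar>\<dots>\<bar> \<le> (LINT x|cell. \<bar>f x * \<phi> (torus_map x) - f x * g (torus_map x)\<bar>)"
      by (rule integral_abs_bound)
    also have "\<dots> \<le> (LINT x|cell. (e / (?N + 1)) * \<bar>f x\<bar>)"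
    proof (intro integral_mono integrable_abs Bochner_Integration.integrable_diff integrable_mult_right i)
      fix x assume "x \<in> space cell"
      then have "\<bar>\<phi> (torus_map x) - g (torus_map x)\<bar> \<le> e / (?N + 1)"
        by (intro less_imp_le g(2)) simp
      then have "\<bar>f x\<bar> * \<bar>\<phi> (torus_map x) - g (torus_map x)\<bar> \<le> \<bar>f x\<bar> * (e / (?N + 1))"
        by (rule mult_left_mono) simp
      then show "\<bar>f x * \<phi> (torus_map x) - f x * g (torus_map x)\<bar> \<le> (e / (?N + 1)) * \<bar>f x\<bar>"
        by (simp add: abs_mult[symmetric] right_diff_distrib mult.commute)
    qed (use cell.sq_int_imp_integrable[OF f] in simp)
    also have "\<dots> = e * (?N / (?N + 1))" by simp
    also have "\<dots> \<le> e * 1" using that by (intro mult_left_mono divide_add_one_le N) simp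
    finally show ?thesis by simp
  qed
  from field_le_epsilon[of "\<bar>LINT x|cell. f x * \<phi> (torus_map x)\<bar>" 0] this
  show ?thesis by auto
qed

text \<open>The indicator of \<open>V\<close> is the pointwise limit of truncated multiples of the
  distance to the image of the complement. Since \<open>V\<close> lies in the open cell, none of its
  points is identified with a point outside \<open>V\<close>.\<close>

lemma trig_orthogonal_open:
  fixes f :: "vec2 \<Rightarrow> real"
  assumes f: "sq_int cell f" and orth: "\<And>p. trigpoly p \<Longrightarrow> (LINT x|cell. f x * p x) = 0"
    and V: "open V" "V \<subseteq> box 0 1"
  shows "(LINT x|cell. f x * indicator V x) = 0"
proof -
  define K where "K = torus_map ` (cbox 0 1 - V)"
  have K: "compact K" unfolding K_def
    by (intro compact_continuous_image continuous_torus_map compact_diff compact_cbox V)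
  \<comment> \<open>The corner keeps \<open>K\<close> nonempty; the distance to an empty set would
    be 0 by convention and the cut-off functions would vanish.\<close>
  have "(0::vec2) \<in> cbox 0 1 - V" using V(2) by (auto simp: mem_box_cart)
  then have ne: "K \<noteq> {}" by (auto simp: K_def)
  define \<phi> where "\<phi> n z = min 1 (real n * infdist z K)" for n z
  have c\<phi>: "continuous_on UNIV (\<phi> n)" for n
    unfolding \<phi>_def by (intro continuous_intros)
  have 0: "(LINT x|cell. f x * \<phi> n (torus_map x)) = 0" for n
    by (rule trig_orthogonal_continuous[OF f _ c\<phi>]) (rule orth)
  have [measurable]: "f \<in> borel_measurable cell" by (rule sq_int_measurable[OF f])
  have "(\<lambda>n. LINT x|cell. f x * \<phi> n (torus_map x)) \<longlonglongrightarrow> (LINT x|cell. f x * indicator V x)"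
  proof (rule integral_dominated_convergence[where w="\<lambda>x. \<bar>f x\<bar>"])
    have "(indicator V :: vec2 \<Rightarrow> real) \<in> borel_measurable cell"
      using V by (intro measurable_restrict_space1 measurable_completion borel_measurable_indicator) simp
    then show "(\<lambda>x. f x * indicator V x) \<in> borel_measurable cell" by measurable
    have "(\<lambda>x. \<phi> n (torus_map x)) \<in> borel_measurable cell" for n
      unfolding \<phi>_def by (intro continuous_borel_cell continuous_intros continuous_torus_map)
    then show "(\<lambda>x. f x * \<phi> n (torus_map x)) \<in> borel_measurable cell" for n by measurable
    show "integrable cell (\<lambda>x. \<bar>f x\<bar>)"
      by (intro integrable_abs cell.sq_int_imp_integrable f)
    show "AE x in cell. (\<lambda>n. f x * \<phi> n (torus_map x)) \<longlonglongrightarrow> f x * indicator V x"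
    proof (intro AE_I2 tendsto_mult tendsto_const)
      fix x assume "x \<in> space cell"
      then have x: "x \<in> cbox 0 1" by simp
      show "(\<lambda>n. \<phi> n (torus_map x)) \<longlonglongrightarrow> indicator V x"
      proof (cases "x \<in> V")
        case True
        have "torus_map x \<notin> K"
          using torus_map_inj[of x] True V(2) by (auto simp: K_def)
        then have pos: "infdist (torus_map x) K > 0"
          using K ne compact_imp_closed infdist_pos_not_in_closed by blast
        obtain N where N: "1 / infdist (torus_map x) K < real N" using reals_Archimedean2 by blast
        have "\<phi> n (torus_map x) = indicator V x" if "n \<ge> N" for n
        proof -
          have "1 / infdist (torus_map x) K \<le> real n" using N that by linarith
          then have "1 \<le> real n * infdist (torus_map x) K" using pos by (simp add: field_simps)
          then show ?thesis using True by (simp add: \<phi>_def)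
        qed
        then show ?thesis
          by (intro tendsto_eventually eventually_sequentiallyI)
      next
        case False
        then have "torus_map x \<in> K" using x by (auto simp: K_def)
        then show ?thesis using False by (simp add: \<phi>_def)
      qed
    qed
    show "AE x in cell. norm (f x * \<phi> n (torus_map x)) \<le> \<bar>f x\<bar>" for n
    proof (intro AE_I2)
      fix x
      have "\<bar>\<phi> n (torus_map x)\<bar> \<le> 1"
        using infdist_nonneg[of "torus_map x" K] by (simp add: \<phi>_def abs_le_iff min_def)
      from mult_left_mono[OF this, of "\<bar>f x\<bar>"]
      show "norm (f x * \<phi> n (torus_map x)) \<le> \<bar>f x\<bar>" by (simp add: abs_mult)
    qed
  qed
  then show ?thesis by (simp add: 0 LIMSEQ_const_iff)
qed

text \<open>By outer regularity the set \<open>A\<close> where \<open>f\<close> is positive has an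
  open neighbourhood \<open>V\<close> of little excess. The integral of \<open>f\<close> over
  \<open>V\<close> is zero and the part over \<open>V - A\<close> is small by Cauchy--Schwarz, so
  the integral over \<open>A\<close> vanishes.\<close>

lemma trig_orthogonal_nonpos:
  fixes f :: "vec2 \<Rightarrow> real"
  assumes fm: "f \<in> borel_measurable lebesgue" and f: "sq_int cell f"
    and orth: "\<And>p. trigpoly p \<Longrightarrow> (LINT x|cell. f x * p x) = 0"
  shows "AE x in cell. f x \<le> 0"
proof -
  have [measurable]: "f \<in> borel_measurable cell" by (rule sq_int_measurable[OF f])
  define A where "A = {x. f x > 0} \<inter> box 0 1"
  have "{x \<in> space lebesgue. f x > 0} \<in> sets lebesgue" using fm by measurable
  then have "{x. f x > 0} \<in> sets lebesgue" by simp
  then have A: "A \<in> sets lebesgue" unfolding A_def by (intro sets.Int) auto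
  have ind: "(indicator B :: vec2 \<Rightarrow> real) \<in> borel_measurable cell" if "B \<in> sets lebesgue" for B
    by (intro measurable_restrict_space1 borel_measurable_indicator that)
  have sqi: "sq_int cell (indicator B :: vec2 \<Rightarrow> real)" if "B \<in> sets lebesgue" for B
    by (rule sq_int_bound[OF cell.sq_int_const[of "1::real"] ind[OF that], where C=1])
      (auto simp: indicator_def)
  have int: "integrable cell (\<lambda>x. f x * indicator B x)" if "B \<in> sets lebesgue" for B
    using sq_int_inner[OF f sqi[OF that]] by simp
  let ?I = "LINT x|cell. f x * indicator A x" and ?Q = "LINT x|cell. (norm (f x))\<^sup>2"
  have "?I\<^sup>2 \<le> e" if e: "e > 0" for e
  proof -
    have Q: "0 \<le> ?Q" by simp
    then have "0 < e / (?Q + 1)" using e by (intro divide_pos_pos) linarith+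
    then obtain T where T: "open T" "A \<subseteq> T" "(T - A) \<in> lmeasurable" "emeasure lebesgue (T - A) < ennreal (e / (?Q + 1))"
      using sets_lebesgue_outer_open[OF A] by metis
    define V where "V = T \<inter> box 0 1"
    have V: "open V" "V \<subseteq> box 0 1" "A \<subseteq> V" "V - A \<subseteq> T - A" using T by (auto simp: V_def A_def)
    have VA: "V - A \<in> sets lebesgue" using V(1) A by (auto intro: sets.Diff)
    have m: "(LINT x|cell. (norm (indicator (V - A) x :: real))\<^sup>2) \<le> e / (?Q + 1)"
    proof -
      have "(LINT x|cell. (norm (indicator (V - A) x :: real))\<^sup>2) = (LINT x|cell. indicator (V - A) x)"
        by (intro Bochner_Integration.integral_cong refl) (simp add: indicator_def)
      also have "\<dots> = measure cell (V - A)"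
      proof -
        have "V - A \<subseteq> cbox 0 1" using V(2) box_subset_cbox by blast
        then show ?thesis using VA by (simp add: sets_restrict_space_iff Int_absorb2)
      qed
      also have "\<dots> = measure lebesgue (V - A)"
      proof -
        have "V - A \<subseteq> cbox 0 1" using V(2) box_subset_cbox by blast
        then show ?thesis by (intro measure_restrict_space) auto
      qed
      also have "\<dots> \<le> measure lebesgue (T - A)"
        using V(4) VA T(3) by (intro measure_mono_fmeasurable)
      also have "\<dots> \<le> e / (?Q + 1)"
        using T(4) e Q emeasure_eq_measure2[OF T(3)]
        by (metis ennreal_less_iff less_imp_le measure_nonneg)
      finally show ?thesis .
    qed
    have "0 = (LINT x|cell. f x * indicator V x)"
      using trig_orthogonal_open[OF f orth V(1,2)] by simp
    also have "\<dots> = (LINT x|cell. f x * indicator A x + f x * indicator (V - A) x)"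
      using V(3) by (intro Bochner_Integration.integral_cong refl) (auto simp: indicator_def)
    also have "\<dots> = ?I + (LINT x|cell. f x * indicator (V - A) x)"
      using int[OF A] int[OF VA] by simp
    finally have "?I = - (LINT x|cell. f x * indicator (V - A) x)" by simp
    then have "?I\<^sup>2 = (LINT x|cell. f x \<bullet> indicator (V - A) x)\<^sup>2" by simp
    also have "\<dots> \<le> ?Q * (LINT x|cell. (norm (indicator (V - A) x :: real))\<^sup>2)"
      by (rule sq_int_cauchy_schwarz[OF f sqi[OF VA]])
    also have "\<dots> \<le> ?Q * (e / (?Q + 1))" by (rule mult_left_mono[OF m Q])
    also have "\<dots> = e * (?Q / (?Q + 1))" by simp
    also have "\<dots> \<le> e * 1" using e by (intro mult_left_mono divide_add_one_le Q) simp
    finally show ?thesis by simp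
  qed
  then have "?I\<^sup>2 \<le> 0" using field_le_epsilon[of "?I\<^sup>2" 0] by auto
  then have I: "?I = 0" by simp
  have "AE x in cell. f x * indicator A x = 0"
    using I integral_nonneg_eq_0_iff_AE[OF int[OF A]] by (auto simp: A_def indicator_def)
  \<comment> \<open>Passing to the open cell loses only the boundary, a null set.\<close>
  moreover have "AE x in cell. x \<in> box 0 1"
  proof -
    have "negligible (cbox 0 1 - box 0 1 :: vec2 set)" by (rule negligible_frontier_interval)
    then have "AE x in lebesgue. x \<notin> cbox 0 1 - box (0::vec2) 1"
      by (intro AE_not_in) (simp add: negligible_iff_null_sets)
    then show ?thesis by (simp add: AE_restrict_space_iff)
  qed
  ultimately show ?thesis by eventually_elim (auto simp: A_def indicator_def not_less split: if_splits)
qed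

lemma trig_orthogonal_eq_0:
  fixes f :: "vec2 \<Rightarrow> real"
  assumes f: "L2_per f" and orth: "\<And>p. trigpoly p \<Longrightarrow> (LINT x|cell. f x * p x) = 0"
  shows "AE x in cell. f x = 0"
proof -
  have "AE x in cell. f x \<le> 0"
    using f orth by (intro trig_orthogonal_nonpos L2_per_sq_int) (auto simp: L2_per_def)
  moreover have "AE x in cell. - f x \<le> 0"
  proof (rule trig_orthogonal_nonpos)
    show "sq_int cell (\<lambda>x. - f x)" using sq_int_scaleR[OF L2_per_sq_int[OF f], of "-1"] by simp
    show "(\<lambda>x. - f x) \<in> borel_measurable lebesgue" using f by (simp add: L2_per_def)
  qed (use orth in simp)
  ultimately show ?thesis by eventually_elim simp
qed

section \<open>The Helmholtz decomposition in the plane\<close>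

text \<open>In the plane \<open>k\<close> and its quarter turn are orthogonal and equally long;
  multiplying by the squared norm avoids a division.\<close>

lemma orthogonal_expand: "(norm k)\<^sup>2 *\<^sub>R v = (v \<bullet> k) *\<^sub>R k + (v \<bullet> (Rperp *v k)) *\<^sub>R (Rperp *v k)"
  unfolding power2_norm_eq_inner by (simp add: vec_eq_iff forall_2 inner_vec_def sum_2 algebra_simps)

text \<open>A field orthogonal to all gradients and all rotated gradients has vanishing Fourier
  coefficients: testing with \<open>sin\<close> and \<open>cos\<close> of frequency \<open>k\<close> gives the components along \<open>k\<close> and
  along its rotation.\<close>

lemma integral_cmult_eq_0D: "(LINT x|M. c * f x) = 0 \<Longrightarrow> c \<noteq> 0 \<Longrightarrow> (LINT x|M. f x) = (0::real)"
  by simp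

lemma harmonic_field_eq_0:
  assumes h: "L2_per h" and mean: "(LINT x|cell. h x) = 0"
    and div: "\<And>\<psi>. smooth_per \<psi> \<Longrightarrow> (LINT x|cell. h x \<bullet> grad \<psi> x) = 0"
    and curl: "\<And>\<psi>. smooth_per \<psi> \<Longrightarrow> (LINT x|cell. h x \<bullet> (Rperp *v grad \<psi> x)) = 0"
  shows "AE x in cell. h x = 0"
proof -
  have hi: "integrable cell h" by (intro cell.sq_int_imp_integrable L2_per_sq_int h)
  have bl: "bounded_linear (\<lambda>u. u \<bullet> v)" for v :: vec2 by (rule bounded_linear_inner_left)
  have hv: "L2_per (\<lambda>x. h x \<bullet> v)" for v by (rule L2_per_bounded_linear[OF bl h])
  have sq: "sq_int cell p" if "continuous_on UNIV p" for p :: "vec2 \<Rightarrow> real"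
    using that unfolding sq_int_def
    by (intro conjI continuous_borel_cell continuous_integrable_cell continuous_intros)
  have int: "integrable cell (\<lambda>x. (h x \<bullet> v) * p x)" if "continuous_on UNIV p" for v p
    using sq_int_inner[OF L2_per_sq_int[OF hv] sq[OF that]] by simp
  have key: "(LINT x|cell. (h x \<bullet> v) * (b * cos (2 * pi * (k \<bullet> x)) - a * sin (2 * pi * (k \<bullet> x)))) = 0"
    if k: "int_vec k" "k \<noteq> 0" for k v a b
  proof -
    let ?p = "\<lambda>x. b * cos (2 * pi * (k \<bullet> x)) - a * sin (2 * pi * (k \<bullet> x))"
    let ?\<psi> = "\<lambda>x. a * cos (2 * pi * (k \<bullet> x)) + b * sin (2 * pi * (k \<bullet> x))"
    have p: "continuous_on UNIV ?p" by (intro continuous_intros)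
    have sm: "smooth_per ?\<psi>" by (rule smooth_per_trig[OF k(1)])
    have g: "grad ?\<psi> x = (2 * pi * ?p x) *\<^sub>R k" for x by (rule grad_trig)
    have "(LINT x|cell. 2 * pi * ((h x \<bullet> k) * ?p x)) = 0"
      using div[OF sm] unfolding g by (simp add: ac_simps)
    then have 1: "(LINT x|cell. (h x \<bullet> k) * ?p x) = 0"
      by (rule integral_cmult_eq_0D) simp
    have "h x \<bullet> (Rperp *v grad ?\<psi> x) = 2 * pi * ((h x \<bullet> (Rperp *v k)) * ?p x)" for x
      unfolding g matrix_vector_mult_scaleR inner_scaleR_right by (simp only: mult.assoc mult.commute[of "h x \<bullet> _"])
    with curl[OF sm] have "(LINT x|cell. 2 * pi * ((h x \<bullet> (Rperp *v k)) * ?p x)) = 0"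
      by (simp only:)
    then have 2: "(LINT x|cell. (h x \<bullet> (Rperp *v k)) * ?p x) = 0"
      by (rule integral_cmult_eq_0D) simp
    have "(norm k)\<^sup>2 * ((h x \<bullet> v) * ?p x)
        = (v \<bullet> k) * ((h x \<bullet> k) * ?p x) + (v \<bullet> (Rperp *v k)) * ((h x \<bullet> (Rperp *v k)) * ?p x)" for x
    proof -
      have "(norm k)\<^sup>2 * (h x \<bullet> v) = h x \<bullet> ((norm k)\<^sup>2 *\<^sub>R v)" by simp
      also have "\<dots> = (v \<bullet> k) * (h x \<bullet> k) + (v \<bullet> (Rperp *v k)) * (h x \<bullet> (Rperp *v k))"
        unfolding orthogonal_expand by (simp add: inner_add_right)
      finally show ?thesis by (simp only: mult.assoc[symmetric] distrib_right)
    qed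
    then have "(LINT x|cell. (norm k)\<^sup>2 * ((h x \<bullet> v) * ?p x)) = 0"
      using int[OF p] by (simp only: Bochner_Integration.integral_add integrable_mult_right
          Bochner_Integration.integral_mult_right_zero 1 2 mult_zero_right add_0)
    then show ?thesis by (rule integral_cmult_eq_0D) (use k(2) in simp)
  qed
  have orth: "(LINT x|cell. (h x \<bullet> v) * p x) = 0" if "trigpoly p" for v p
    using that
  proof (induction rule: trigpoly.induct)
    case (cos k)
    have "(LINT x|cell. h x \<bullet> v) = 0"
      using integral_bounded_linear[OF bl hi, of v] mean by simp
    \<comment> \<open>Frequency zero is not reached by gradients and is covered by the mean.\<close>
    then show ?case using key[OF cos, of v 1 0] by (cases "k = 0") auto
  next
    case (sin k)
    then show ?case using key[OF sin, of v 0 "-1"] by (cases "k = 0") auto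
  next
    case (add f g)
    then show ?case
      using int[OF trigpoly_continuous[OF add.hyps(1)], of v] int[OF trigpoly_continuous[OF add.hyps(2)], of v]
      by (simp add: distrib_left)
  next
    case (cmult f c)
    have "(h x \<bullet> v) * (c * f x) = c * ((h x \<bullet> v) * f x)" for x by simp
    then show ?case using cmult.IH by (simp only: Bochner_Integration.integral_mult_right_zero mult_zero_right)
  qed
  have "AE x in cell. h x \<bullet> axis i 1 = 0" for i
    by (rule trig_orthogonal_eq_0[OF hv orth])
  then have "AE x in cell. h x $ i = 0" for i by (simp add: inner_axis)
  then have "AE x in cell. h x $ 1 = 0 \<and> h x $ 2 = 0" by (intro AE_conjI)
  then show ?thesis by eventually_elim (simp add: vec_eq_iff forall_2)
qed

lemma composite_identity: "composite (\<lambda>x. mat 1)"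
  unfolding composite_def periodic_def
proof (intro conjI exI[of _ "{mat 1}"])
  show "{mat 1} \<subseteq> (SymPos :: tmat set)"
    by (auto simp: SymPos_def Sym_def qless_def)
qed auto

text \<open>The turned field \<open>H\<close> is projected onto gradients. The remainder
  \<open>h\<close> is divergence-free by the projection, and orthogonal to turned gradients because
  \<open>F\<close> is orthogonal to gradients; having mean zero, it vanishes, and \<open>H\<close>
  is minus the gradient \<open>g\<close>.\<close>

theorem helmholtz:
  assumes F: "div_free F"
  shows "grad_field (\<lambda>x. Rperp *v (F x - (LINT y|cell. F y)))"
proof -
  let ?m = "LINT y|cell. F y"
  define H where "H x = Rperp *v (F x - ?m)" for x
  have FL: "L2_per (\<lambda>x. F x - ?m)" by (intro L2_per_diff div_free_L2_per F L2_per_const)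
  have R: "bounded_linear ((*v) Rperp)" by simp
  have HL: "L2_per H" unfolding H_def by (rule L2_per_bounded_linear[OF R FL])
  \<comment> \<open>The projection is stated for pairs, so \<open>H\<close> is placed in the first
    slot with zero in the second.\<close>
  let ?E = "\<lambda>x. tjoin (\<lambda>b. if b = 1 then H x else 0)"
  have EL: "L2_per ?E" by (rule L2_per_bounded_linear[OF bounded_linear_tjoin_single HL])
  obtain G where G: "\<And>a. grad_field (\<lambda>x. tcomp a (G x))" "\<And>a. div_free (\<lambda>x. tcomp a (mat 1 *v (?E x + G x)))"
    using weighted_projection[OF composite_identity EL] by blast
  define g where "g x = tcomp 1 (G x)" for x
  have g: "grad_field g" using G(1) by (simp add: g_def[abs_def])
  define h where "h x = H x + g x" for x
  have h: "div_free h" using G(2)[of 1] by (simp add: h_def[abs_def] g_def)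
  have "AE x in cell. h x = 0"
  proof (rule harmonic_field_eq_0)
    show "L2_per h" by (rule div_free_L2_per[OF h])
    have i: "integrable cell F" "integrable cell (\<lambda>x. F x - ?m)" "integrable cell H" "integrable cell g"
      by (intro cell.sq_int_imp_integrable L2_per_sq_int FL HL div_free_L2_per F grad_field_L2_per g)+
    have "(LINT x|cell. H x) = Rperp *v (LINT x|cell. F x - ?m)"
      unfolding H_def by (rule integral_bounded_linear[OF R i(2)])
    also have "\<dots> = 0" using i(1) by simp
    finally show "(LINT x|cell. h x) = 0"
      unfolding h_def using i(3,4) by (simp add: integral_grad_field[OF g])
    fix \<psi> assume \<psi>: "smooth_per \<psi>"
    show "(LINT x|cell. h x \<bullet> grad \<psi> x) = 0" using h \<psi> by (simp add: div_free_def)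
    have dR: "div_free (\<lambda>x. Rperp *v grad \<psi> x)"
      by (rule div_free_Rperp_grad[OF grad_field_smooth[OF \<psi>]])
    have dF: "div_free (\<lambda>x. F x - ?m)"
      using div_free_add[OF F div_free_const[of "- ?m"]] by simp
    have j: "integrable cell (\<lambda>x. (F x - ?m) \<bullet> grad \<psi> x)" "integrable cell (\<lambda>x. g x \<bullet> (Rperp *v grad \<psi> x))"
      by (intro sq_int_inner L2_per_sq_int FL L2_per_grad \<psi> grad_field_L2_per g div_free_L2_per dR)+
    have "h x \<bullet> (Rperp *v grad \<psi> x) = (F x - ?m) \<bullet> grad \<psi> x + g x \<bullet> (Rperp *v grad \<psi> x)" for x
      by (simp add: h_def H_def inner_add_left Rperp_skew)
    then have "(LINT x|cell. h x \<bullet> (Rperp *v grad \<psi> x))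
       = (LINT x|cell. (F x - ?m) \<bullet> grad \<psi> x) + (LINT x|cell. g x \<bullet> (Rperp *v grad \<psi> x))"
      using j by simp
    also have "\<dots> = 0"
      using dF \<psi> grad_div_free_orthogonal[OF g dR] by (simp add: div_free_def inner_commute)
    finally show "(LINT x|cell. h x \<bullet> (Rperp *v grad \<psi> x)) = 0" .
  qed
  then have "AE x in cell. (-1) *\<^sub>R g x = H x"
    by eventually_elim (simp add: h_def add_eq_0_iff2)
  from grad_field_cong_AE[OF grad_field_scaleR[OF g] HL this]
  show ?thesis by (simp add: H_def[abs_def])
qed

section \<open>Potential and solenoidal pairs\<close>

definition pot :: "tvec \<Rightarrow> (vec2 \<Rightarrow> tvec) \<Rightarrow> bool" where
  "pot E0 E \<longleftrightarrow> (\<forall>a. grad_field (\<lambda>x. tcomp a (E x - E0)))"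

definition solenoidal :: "(vec2 \<Rightarrow> tvec) \<Rightarrow> bool" where
  "solenoidal J \<longleftrightarrow> (\<forall>a. div_free (\<lambda>x. tcomp a (J x)))"

lemma cell_field_iff: "cell_field L E0 E \<longleftrightarrow> pot E0 E \<and> solenoidal (\<lambda>x. L x *v E x)"
proof -
  have "(\<exists>\<phi>1 \<phi>2 g1 g2. H1_per_grad \<phi>1 g1 \<and> H1_per_grad \<phi>2 g2 \<and> E = (\<lambda>x. E0 + tpair (g1 x) (g2 x)))
     \<longleftrightarrow> (\<exists>g1 g2. grad_field g1 \<and> grad_field g2 \<and> E = (\<lambda>x. E0 + tpair (g1 x) (g2 x)))"
    unfolding grad_field_def by blast
  also have "\<dots> \<longleftrightarrow> pot E0 E"
  proof
    assume "\<exists>g1 g2. grad_field g1 \<and> grad_field g2 \<and> E = (\<lambda>x. E0 + tpair (g1 x) (g2 x))"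
    then obtain g1 g2 where g: "grad_field g1" "grad_field g2" "E = (\<lambda>x. E0 + tpair (g1 x) (g2 x))" by blast
    have "tcomp 1 (E x - E0) = g1 x" "tcomp 2 (E x - E0) = g2 x" for x
      by (simp_all add: g(3))
    then show "pot E0 E" unfolding pot_def forall_2 using g(1,2) by simp
  next
    assume p: "pot E0 E"
    have "E = (\<lambda>x. E0 + tpair (tcomp 1 (E x - E0)) (tcomp 2 (E x - E0)))"
      unfolding tpair_tcomp by simp
    with p show "\<exists>g1 g2. grad_field g1 \<and> grad_field g2 \<and> E = (\<lambda>x. E0 + tpair (g1 x) (g2 x))"
      unfolding pot_def by blast
  qed
  finally show ?thesis by (simp add: cell_field_def solenoidal_def)
qed

lemma solenoidal_L2_per: "solenoidal J \<Longrightarrow> L2_per J"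
  by (rule L2_per_tvec) (simp add: solenoidal_def div_free_L2_per)

lemma pot_L2_per_diff: "pot E0 E \<Longrightarrow> L2_per (\<lambda>x. E x - E0)"
  by (rule L2_per_tvec) (simp only: pot_def grad_field_L2_per)

lemma pot_L2_per:
  assumes "pot E0 E" shows "L2_per E"
  using L2_per_add[OF pot_L2_per_diff[OF assms] L2_per_const[of E0]] by simp

lemma L2_per_integrable: "L2_per f \<Longrightarrow> integrable cell f"
  by (intro cell.sq_int_imp_integrable L2_per_sq_int)

lemma L2_per_inner: "L2_per f \<Longrightarrow> L2_per g \<Longrightarrow> integrable cell (\<lambda>x. f x \<bullet> g x)"
  by (intro sq_int_inner L2_per_sq_int)

lemma integral_pot:
  assumes "pot E0 E" shows "(LINT x|cell. E x) = E0"
proof -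
  have "tcomp a (LINT x|cell. E x - E0) = 0" for a
    unfolding integral_tcomp[OF pot_L2_per_diff[OF assms]]
    using assms by (intro integral_grad_field) (simp only: pot_def)
  then have "(LINT x|cell. E x - E0) = 0" by (simp add: tvec_eq_iff)
  then show ?thesis
    using L2_per_integrable[OF pot_L2_per[OF assms]] by simp
qed

text \<open>Hill's identity: the mean of the product is the product of the means, since the
  fluctuation of \<open>E\<close> is a gradient.\<close>

lemma pot_solenoidal_orthogonal:
  assumes E: "pot E0 E" and J: "solenoidal J"
  shows "(LINT x|cell. J x \<bullet> E x) = (LINT x|cell. J x) \<bullet> E0"
proof -
  note l = solenoidal_L2_per[OF J] pot_L2_per_diff[OF E]
  have "(LINT x|cell. J x \<bullet> (E x - E0)) = (LINT x|cell. (\<Sum>a\<in>UNIV. tcomp a (J x) \<bullet> tcomp a (E x - E0)))"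
    unfolding inner_tvec ..
  also have "\<dots> = (\<Sum>a\<in>UNIV. LINT x|cell. tcomp a (J x) \<bullet> tcomp a (E x - E0))"
    by (intro Bochner_Integration.integral_sum L2_per_inner L2_per_tcomp l)
  also have "\<dots> = 0"
    using E J unfolding pot_def solenoidal_def by (intro sum.neutral ballI grad_div_free_orthogonal) auto
  finally have "(LINT x|cell. J x \<bullet> (E x - E0)) = 0" .
  moreover have "(LINT x|cell. J x \<bullet> (E x - E0)) = (LINT x|cell. J x \<bullet> E x) - (LINT x|cell. J x \<bullet> E0)"
    unfolding inner_diff_right
    by (intro Bochner_Integration.integral_diff L2_per_inner l pot_L2_per[OF E] L2_per_const)
  moreover have "(LINT x|cell. J x \<bullet> E0) = (LINT x|cell. J x) \<bullet> E0"
    by (rule integral_inner_left) (rule L2_per_integrable[OF l(1)])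
  ultimately show ?thesis by simp
qed

lemma pot_const: "pot E0 (\<lambda>x. E0)"
  by (simp add: pot_def grad_field_zero)

lemma pot_lincomb:
  assumes "pot E0 E" "pot E0' E'"
  shows "pot (E0 + c *\<^sub>R E0') (\<lambda>x. E x + c *\<^sub>R E' x)"
  unfolding pot_def
proof
  fix a
  have "grad_field (\<lambda>x. tcomp a (E x - E0) + c *\<^sub>R tcomp a (E' x - E0'))"
    using assms unfolding pot_def by (intro grad_field_add grad_field_scaleR) auto
  moreover have "tcomp a (E x + c *\<^sub>R E' x - (E0 + c *\<^sub>R E0')) = tcomp a (E x - E0) + c *\<^sub>R tcomp a (E' x - E0')" for x
    by (simp add: algebra_simps)
  ultimately show "grad_field (\<lambda>x. tcomp a (E x + c *\<^sub>R E' x - (E0 + c *\<^sub>R E0')))" by (simp only:)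
qed

lemma solenoidal_lincomb:
  assumes "solenoidal J" "solenoidal J'"
  shows "solenoidal (\<lambda>x. J x + c *\<^sub>R J' x)"
  using assms by (auto simp: solenoidal_def intro!: div_free_add div_free_scaleR)

lemma solenoidal_const: "solenoidal (\<lambda>x. c)"
  by (simp add: solenoidal_def div_free_const)

lemma solenoidal_cong_AE:
  assumes "solenoidal J" "L2_per J'" "AE x in cell. J x = J' x"
  shows "solenoidal J'"
  unfolding solenoidal_def
proof
  fix a
  have "AE x in cell. tcomp a (J x) = tcomp a (J' x)" using assms(3) by eventually_elim simp
  moreover have "div_free (\<lambda>x. tcomp a (J x))" using assms(1) by (simp add: solenoidal_def)
  ultimately show "div_free (\<lambda>x. tcomp a (J' x))"
    by (intro div_free_cong_AE[OF _ L2_per_tcomp[OF assms(2)]])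
qed

section \<open>Kronecker products acting on potential and solenoidal pairs\<close>

lemma sum_pair_2: "(\<Sum>p\<in>(UNIV :: (2 \<times> 2) set). f p) = (\<Sum>a\<in>UNIV. \<Sum>i\<in>UNIV. f (a, i))"
  by (simp add: sum.cartesian_product case_prod_beta)

lemma tcomp_block:
  "tcomp 1 (block A B C D *v e) = A *v tcomp 1 e + B *v tcomp 2 e"
  "tcomp 2 (block A B C D *v e) = C *v tcomp 1 e + D *v tcomp 2 e"
  by (simp_all add: vec_eq_iff block_def matrix_vector_mult_def sum_pair_2 sum_2)

lemma scaleR_matrix_vector: "(c *\<^sub>R (A::real^'n^'m)) *v v = c *\<^sub>R (A *v v)"
  by (simp add: scaleR_matrix_vector_assoc)

lemma tcomp_kron: "tcomp a (A \<otimes>\<^sub>k B *v e) = (\<Sum>b\<in>UNIV. A $ a $ b *\<^sub>R (B *v tcomp b e))"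
  using exhaust_2[of a] by (auto simp: kron_def tcomp_block sum_2 scaleR_matrix_vector)

lemma grad_field_sum:
  "finite S \<Longrightarrow> (\<And>b. b \<in> S \<Longrightarrow> grad_field (f b)) \<Longrightarrow> grad_field (\<lambda>x. \<Sum>b\<in>S. f b x)"
  by (induction S rule: finite_induct) (auto intro: grad_field_zero grad_field_add)

lemma div_free_sum:
  "finite S \<Longrightarrow> (\<And>b. b \<in> S \<Longrightarrow> div_free (f b)) \<Longrightarrow> div_free (\<lambda>x. \<Sum>b\<in>S. f b x)"
  by (induction S rule: finite_induct) (auto intro: div_free_const div_free_add)

lemma solenoidal_kron_Rperp:
  assumes "pot E0 E" shows "solenoidal (\<lambda>x. A \<otimes>\<^sub>k Rperp *v E x)"
  unfolding solenoidal_def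
proof
  fix a
  have "div_free (\<lambda>x. Rperp *v tcomp b (E x - E0) + Rperp *v tcomp b E0)" for b
    using assms by (intro div_free_add div_free_const div_free_Rperp_grad) (simp only: pot_def)
  then have "div_free (\<lambda>x. Rperp *v tcomp b (E x))" for b
    by (simp flip: matrix_vector_right_distrib)
  then show "div_free (\<lambda>x. tcomp a (A \<otimes>\<^sub>k Rperp *v E x))"
    unfolding tcomp_kron by (intro div_free_sum div_free_scaleR) auto
qed

text \<open>\<open>A\<close> only forms constant linear combinations of the components, each of
  which is a turned solenoidal field covered by the Helmholtz theorem.\<close>

lemma pot_kron_Rperp:
  assumes "solenoidal J"
  shows "pot (A \<otimes>\<^sub>k Rperp *v (LINT x|cell. J x)) (\<lambda>x. A \<otimes>\<^sub>k Rperp *v J x)"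
  unfolding pot_def
proof
  fix a
  have "grad_field (\<lambda>x. Rperp *v tcomp b (J x - (LINT x|cell. J x)))" for b
    using helmholtz[of "\<lambda>x. tcomp b (J x)"] assms
    by (simp add: solenoidal_def integral_tcomp[OF solenoidal_L2_per[OF assms]])
  then show "grad_field (\<lambda>x. tcomp a (A \<otimes>\<^sub>k Rperp *v J x - A \<otimes>\<^sub>k Rperp *v (LINT x|cell. J x)))"
    unfolding matrix_vector_mult_diff_distrib[symmetric] tcomp_kron
    by (intro grad_field_sum grad_field_scaleR) auto
qed

lemma pot_kron_id:
  assumes "pot E0 E" shows "pot (A \<otimes>\<^sub>k I2 *v E0) (\<lambda>x. A \<otimes>\<^sub>k I2 *v E x)"
  unfolding pot_def
proof
  fix a
  have "grad_field (\<lambda>x. I2 *v tcomp b (E x - E0))" for b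
    using assms by (simp only: pot_def matrix_vector_mul_lid)
  then show "grad_field (\<lambda>x. tcomp a (A \<otimes>\<^sub>k I2 *v E x - A \<otimes>\<^sub>k I2 *v E0))"
    unfolding matrix_vector_mult_diff_distrib[symmetric] tcomp_kron
    by (intro grad_field_sum grad_field_scaleR) auto
qed

lemma solenoidal_kron_id:
  assumes "solenoidal J" shows "solenoidal (\<lambda>x. A \<otimes>\<^sub>k I2 *v J x)"
  unfolding solenoidal_def tcomp_kron matrix_vector_mul_lid
  using assms by (intro allI div_free_sum div_free_scaleR) (auto simp: solenoidal_def)

section \<open>The effective tensor\<close>

lemma integral_matrix_vector:
  fixes f :: "vec2 \<Rightarrow> tvec"
  assumes "L2_per f" shows "(LINT x|cell. (A::tmat) *v f x) = A *v (LINT x|cell. f x)"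
  by (rule integral_bounded_linear) (auto intro: L2_per_integrable assms)

lemma cell_field_exists:
  assumes L: "composite L" shows "\<exists>E. cell_field L E0 E"
proof -
  obtain G where "\<And>a. grad_field (\<lambda>x. tcomp a (G x))" "\<And>a. div_free (\<lambda>x. tcomp a (L x *v (E0 + G x)))"
    using weighted_projection[OF L L2_per_const[of E0]] by blast
  then have "cell_field L E0 (\<lambda>x. E0 + G x)"
    by (simp add: cell_field_iff pot_def solenoidal_def)
  then show ?thesis by blast
qed

text \<open>By Hill's identity the energy equals the product of the means, which is zero, and
  coercivity concludes.\<close>

lemma solenoidal_pot_AE_0:
  assumes L: "composite L" and "pot 0 E" "solenoidal (\<lambda>x. L x *v E x)"
  shows "AE x in cell. E x = 0"
proof -
  obtain c C where c: "0 < c" "\<And>x v. c * (norm v)\<^sup>2 \<le> v \<bullet> (L x *v v)"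
    using composite_bounds[OF L] by metis
  have E: "L2_per E" by (rule pot_L2_per[OF assms(2)])
  have "(LINT x|cell. (norm (E x))\<^sup>2) \<le> 0"
  proof -
    have "c * (LINT x|cell. (norm (E x))\<^sup>2) = (LINT x|cell. c * (norm (E x))\<^sup>2)" by simp
    also have "\<dots> \<le> (LINT x|cell. E x \<bullet> (L x *v E x))"
      by (intro integral_mono L2_per_inner composite_L2_per L E c integrable_mult_right
          sq_int_integrable L2_per_sq_int)
    also have "\<dots> = 0"
      using pot_solenoidal_orthogonal[OF assms(2,3)] by (simp add: inner_commute)
    finally show ?thesis using c(1) by (simp add: mult_le_0_iff)
  qed
  then have "(LINT x|cell. (norm (E x))\<^sup>2) = 0"
    by (rule antisym) (rule Bochner_Integration.integral_nonneg, simp)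
  then have "AE x in cell. (norm (E x))\<^sup>2 = 0"
    using integral_nonneg_eq_0_iff_AE[OF sq_int_integrable[OF L2_per_sq_int[OF E]]] by simp
  then show ?thesis by eventually_elim simp
qed

lemma cell_field_L2_per:
  assumes "composite L" "cell_field L E0 E" shows "L2_per E" "L2_per (\<lambda>x. L x *v E x)"
  using assms by (auto simp: cell_field_iff intro: pot_L2_per composite_L2_per)

lemma cell_field_lincomb:
  assumes "cell_field L E0 E" "cell_field L E0' E'"
  shows "cell_field L (E0 + c *\<^sub>R E0') (\<lambda>x. E x + c *\<^sub>R E' x)"
  using assms unfolding cell_field_iff
  by (auto intro: pot_lincomb solenoidal_lincomb simp: matrix_vector_right_distrib matrix_vector_mult_scaleR)

lemma cell_field_flux_unique:
  assumes L: "composite L" and E: "cell_field L E0 E" "cell_field L E0 E'"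
  shows "(LINT x|cell. L x *v E x) = (LINT x|cell. L x *v E' x)"
proof -
  have "cell_field L 0 (\<lambda>x. E x + (-1) *\<^sub>R E' x)"
    using cell_field_lincomb[OF E, of "-1"] by simp
  then have "AE x in cell. E x + (-1) *\<^sub>R E' x = 0"
    unfolding cell_field_iff by (intro solenoidal_pot_AE_0[OF L]) auto
  then have "AE x in cell. L x *v E x = L x *v E' x" by eventually_elim simp
  then show ?thesis
    by (intro integral_cong_AE borel_measurable_integrable L2_per_integrable
        cell_field_L2_per(2)[OF L E(1)] cell_field_L2_per(2)[OF L E(2)])
qed

text \<open>The mean flux depends on \<open>E0\<close> alone, so selecting one solution for each
  \<open>E0\<close> gives a linear map. Its matrix is the only candidate for the definite
  description.\<close>

lemma effective_tensor_apply:
  assumes L: "composite L" and E: "cell_field L E0 E"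
  shows "effective_tensor L *v E0 = (LINT x|cell. L x *v E x)"
proof -
  obtain e where e: "\<And>E0. cell_field L E0 (e E0)"
    using cell_field_exists[OF L] by metis
  define f where "f E0 = (LINT x|cell. L x *v e E0 x)" for E0
  have f: "f E0 = (LINT x|cell. L x *v E x)" if "cell_field L E0 E" for E0 E
    unfolding f_def by (rule cell_field_flux_unique[OF L e that])
  have lin: "f (u + c *\<^sub>R v) = f u + c *\<^sub>R f v" for u v c
  proof -
    have "f (u + c *\<^sub>R v) = (LINT x|cell. L x *v e u x + c *\<^sub>R (L x *v e v x))"
      using f[OF cell_field_lincomb[OF e e]] by (simp add: matrix_vector_right_distrib matrix_vector_mult_scaleR)
    also have "\<dots> = f u + c *\<^sub>R f v"
      unfolding f_def using L2_per_integrable[OF cell_field_L2_per(2)[OF L e]] by simp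
    finally show ?thesis .
  qed
  \<comment> \<open>Linearity at \<open>0 + (-1) *\<^sub>R 0\<close> gives
    \<open>f 0 = f 0 - f 0\<close>.\<close>
  have "f 0 = 0" using lin[of 0 "-1" 0] by simp
  then have "linear f"
    using lin[of _ 1] lin[of 0] by (intro linearI) auto
  then have m: "matrix f *v u = f u" for u by (simp add: matrix_works linear_matrix_vector_mul_eq)
  have "effective_tensor L = matrix f"
    unfolding effective_tensor_def
  proof (rule the_equality)
    show "\<forall>E0. \<exists>E. cell_field L E0 E \<and> matrix f *v E0 = (LINT x|cell. L x *v E x)"
    proof
      fix E0
      show "\<exists>E. cell_field L E0 E \<and> matrix f *v E0 = (LINT x|cell. L x *v E x)"
        by (rule exI[of _ "e E0"]) (simp add: e m f_def)
    qed
    fix M assume M: "\<forall>E0. \<exists>E. cell_field L E0 E \<and> M *v E0 = (LINT x|cell. L x *v E x)"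
    have "M *v E0 = matrix f *v E0" for E0
    proof -
      obtain E where E: "cell_field L E0 E" "M *v E0 = (LINT x|cell. L x *v E x)" using M by blast
      show ?thesis unfolding m f[OF E(1)] by (rule E(2))
    qed
    then show "M = matrix f" by (simp add: matrix_eq)
  qed
  then show ?thesis using m f[OF E] by simp
qed

lemma effective_tensor_inner:
  assumes L: "composite L" and E: "cell_field L E0 E" "cell_field L E0' E'"
  shows "(effective_tensor L *v E0) \<bullet> E0' = (LINT x|cell. (L x *v E x) \<bullet> E' x)"
  using pot_solenoidal_orthogonal[of E0' E' "\<lambda>x. L x *v E x"] E
  by (simp add: effective_tensor_apply[OF L E(1)] cell_field_iff)

lemma SymI:
  fixes A :: "real^'n^'n"
  assumes "\<And>v w. (A *v v) \<bullet> w = v \<bullet> (A *v w)" shows "A \<in> Sym"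
proof -
  have "A $ i $ j = A $ j $ i" for i j
    using assms[of "axis j 1" "axis i 1"] by (simp add: inner_axis inner_axis' matrix_vector_mult_basis column_def)
  then show ?thesis by (simp add: Sym_def transpose_def vec_eq_iff)
qed

lemma effective_tensor_SymPos:
  assumes L: "composite L" shows "effective_tensor L \<in> SymPos"
  unfolding SymPos_def qless_def
proof (intro CollectI conjI allI impI SymI)
  fix v w
  obtain E E' where E: "cell_field L v E" "cell_field L w E'"
    using cell_field_exists[OF L] by metis
  have "(L x *v E x) \<bullet> E' x = (L x *v E' x) \<bullet> E x" for x
    using composite_SymPos[OF L, of x] Sym_inner_commute[of "L x"] by (simp add: SymPos_def inner_commute)
  then show "(effective_tensor L *v v) \<bullet> w = v \<bullet> (effective_tensor L *v w)"
    using effective_tensor_inner[OF L E] effective_tensor_inner[OF L E(2,1)] by (simp add: inner_commute)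
next
  fix v :: tvec assume v: "v \<noteq> 0"
  obtain E where E: "cell_field L v E" using cell_field_exists[OF L] by metis
  obtain c C where c: "0 < c" "\<And>x v. c * (norm v)\<^sup>2 \<le> v \<bullet> (L x *v v)"
    using composite_bounds[OF L] by metis
  note l = cell_field_L2_per[OF L E]
  have mean: "(LINT x|cell. E x) = v" using E by (simp add: cell_field_iff integral_pot)
  \<comment> \<open>The square of the mean is at most the mean square, by Cauchy--Schwarz against
    the constant \<open>v\<close>.\<close>
  have "(norm v)\<^sup>2 \<le> (LINT x|cell. (norm (E x))\<^sup>2)"
  proof -
    have "v \<bullet> v = (LINT x|cell. E x \<bullet> v)"
      using integral_inner_left[OF L2_per_integrable[OF l(1)], of v] mean by simp
    then have "(v \<bullet> v)\<^sup>2 \<le> (LINT x|cell. (norm (E x))\<^sup>2) * (LINT x|cell. (norm v)\<^sup>2)"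
      using sq_int_cauchy_schwarz[OF L2_per_sq_int[OF l(1)] cell.sq_int_const[of v]] by simp
    then have "(norm v)\<^sup>2 * (norm v)\<^sup>2 \<le> (LINT x|cell. (norm (E x))\<^sup>2) * (norm v)\<^sup>2"
      by (simp add: power2_norm_eq_inner power2_eq_square[of "v \<bullet> v"])
    then show ?thesis by (rule mult_right_le_imp_le) (use v in simp)
  qed
  then have "0 < c * (LINT x|cell. (norm (E x))\<^sup>2)"
    using c(1) v by (intro mult_pos_pos) (auto intro: less_le_trans[of _ "(norm v)\<^sup>2"])
  also have "\<dots> = (LINT x|cell. c * (norm (E x))\<^sup>2)" by simp
  also have "\<dots> \<le> (LINT x|cell. E x \<bullet> (L x *v E x))"
    by (intro integral_mono L2_per_inner l c integrable_mult_right sq_int_integrable L2_per_sq_int)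
  also have "\<dots> = v \<bullet> (effective_tensor L *v v)"
    using effective_tensor_inner[OF L E E] by (simp add: inner_commute)
  finally show "v \<bullet> (0 *v v) < v \<bullet> (effective_tensor L *v v)" by simp
qed

section \<open>Relations inherited by the effective tensor\<close>

text \<open>The way all relations are transported: exhibit a potential field with prescribed mean
  and a solenoidal field that is its flux. Equality almost everywhere is enough, which is all that a
  relation on \<open>L x\<close> provides.\<close>

lemma effective_tensor_applyI:
  assumes L: "composite L" and E: "pot E0 E" and J: "solenoidal J"
    and eq: "AE x in cell. J x = L x *v E x"
  shows "effective_tensor L *v E0 = (LINT x|cell. J x)"
proof -
  have l: "L2_per (\<lambda>x. L x *v E x)" by (rule composite_L2_per[OF L pot_L2_per[OF E]])
  have "cell_field L E0 E"
    using E solenoidal_cong_AE[OF J l eq] by (simp add: cell_field_iff)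
  then have "effective_tensor L *v E0 = (LINT x|cell. L x *v E x)"
    by (rule effective_tensor_apply[OF L])
  also have "\<dots> = (LINT x|cell. J x)"
    using eq by (intro integral_cong_AE borel_measurable_integrable L2_per_integrable l solenoidal_L2_per[OF J])
      (auto elim: eventually_mono)
  finally show ?thesis .
qed

text \<open>\<open>TT *v E x\<close> is a null Lagrangian flux: it is solenoidal for every potential
  \<open>E\<close> and its mean is \<open>TT *v E0\<close>.\<close>

lemma cell_field_flux:
  assumes L: "composite L" and E: "cell_field L E0 E"
  shows "solenoidal (\<lambda>x. L x *v E x - TT *v E x)"
    and "(LINT x|cell. L x *v E x - TT *v E x) = (effective_tensor L - TT) *v E0"
proof -
  have p: "pot E0 E" and s: "solenoidal (\<lambda>x. L x *v E x)"
    using E by (auto simp: cell_field_iff)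
  have t: "solenoidal (\<lambda>x. TT *v E x)" unfolding TT_def by (rule solenoidal_kron_Rperp[OF p])
  show "solenoidal (\<lambda>x. L x *v E x - TT *v E x)"
    using solenoidal_lincomb[OF s t, of "-1"] by simp
  have "(LINT x|cell. L x *v E x - TT *v E x) = (LINT x|cell. L x *v E x) - (LINT x|cell. TT *v E x)"
    by (intro Bochner_Integration.integral_diff L2_per_integrable solenoidal_L2_per s t)
  then show "(LINT x|cell. L x *v E x - TT *v E x) = (effective_tensor L - TT) *v E0"
    using effective_tensor_apply[OF L E] integral_matrix_vector[OF pot_L2_per[OF p], of TT] integral_pot[OF p]
    by (simp add: matrix_vector_mult_diff_rdistrib)
qed

text \<open>If \<open>J\<close> is the flux of \<open>E\<close>, then \<open>(A \<otimes> R\<^sub>\<perp>) J\<close> is again a potential field, with flux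
  \<open>(A \<otimes> R\<^sub>\<perp>) E\<close>.\<close>

lemma effective_tensor_duality:
  assumes L: "composite L" and rel: "AE x in cell. L x ** (A \<otimes>\<^sub>k Rperp) ** L x = A \<otimes>\<^sub>k Rperp"
  shows "effective_tensor L ** (A \<otimes>\<^sub>k Rperp) ** effective_tensor L = A \<otimes>\<^sub>k Rperp"
proof -
  let ?Q = "A \<otimes>\<^sub>k Rperp" and ?L = "effective_tensor L"
  have "(?L ** ?Q ** ?L) *v E0 = ?Q *v E0" for E0
  proof -
    obtain E where E: "cell_field L E0 E" using cell_field_exists[OF L] by blast
    then have p: "pot E0 E" and s: "solenoidal (\<lambda>x. L x *v E x)" by (auto simp: cell_field_iff)
    have eq: "AE x in cell. ?Q *v E x = L x *v (?Q *v (L x *v E x))"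
      using rel by eventually_elim (simp add: matrix_vector_mul_assoc matrix_mul_assoc)
    have "?L *v (?Q *v (LINT x|cell. L x *v E x)) = (LINT x|cell. ?Q *v E x)"
      by (rule effective_tensor_applyI[OF L pot_kron_Rperp[OF s] solenoidal_kron_Rperp[OF p] eq])
    also have "\<dots> = ?Q *v E0"
      using integral_matrix_vector[OF pot_L2_per[OF p]] integral_pot[OF p] by simp
    finally show ?thesis
      using effective_tensor_apply[OF L E] by (simp add: matrix_vector_mul_assoc[symmetric])
  qed
  then show ?thesis by (simp add: matrix_eq)
qed

text \<open>Here \<open>E' = (A \<otimes> R\<^sub>\<perp>) (L - T) E\<close> is a potential field whose flux is the null Lagrangian
  flux \<open>T E'\<close>.\<close>

lemma effective_tensor_null_duality:
  assumes L: "composite L" and rel: "AE x in cell. (L x - TT) ** (A \<otimes>\<^sub>k Rperp) ** (L x - TT) = 0"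
  shows "(effective_tensor L - TT) ** (A \<otimes>\<^sub>k Rperp) ** (effective_tensor L - TT) = 0"
proof -
  let ?Q = "A \<otimes>\<^sub>k Rperp" and ?L = "effective_tensor L"
  have "((?L - TT) ** ?Q ** (?L - TT)) *v E0 = 0 *v E0" for E0
  proof -
    obtain E where E: "cell_field L E0 E" using cell_field_exists[OF L] by blast
    define J where "J x = L x *v E x - TT *v E x" for x
    have s: "solenoidal J" and m: "(LINT x|cell. J x) = (?L - TT) *v E0"
      unfolding J_def by (rule cell_field_flux[OF L E])+
    have p: "pot (?Q *v ((?L - TT) *v E0)) (\<lambda>x. ?Q *v J x)"
      using pot_kron_Rperp[OF s] by (simp add: m)
    have st: "solenoidal (\<lambda>x. TT *v (?Q *v J x))"
      unfolding TT_def by (rule solenoidal_kron_Rperp[OF p])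
    have eq: "AE x in cell. TT *v (?Q *v J x) = L x *v (?Q *v J x)"
      using rel
    proof eventually_elim
      fix x assume "(L x - TT) ** ?Q ** (L x - TT) = 0"
      then have "((L x - TT) ** ?Q ** (L x - TT)) *v E x = 0" by simp
      then have "(L x - TT) *v (?Q *v J x) = 0"
        unfolding J_def by (simp add: matrix_vector_mul_assoc[symmetric] matrix_vector_mult_diff_rdistrib)
      then show "TT *v (?Q *v J x) = L x *v (?Q *v J x)"
        by (simp add: matrix_vector_mult_diff_rdistrib)
    qed
    have "?L *v (?Q *v ((?L - TT) *v E0)) = (LINT x|cell. TT *v (?Q *v J x))"
      by (rule effective_tensor_applyI[OF L p st eq])
    also have "\<dots> = TT *v (?Q *v ((?L - TT) *v E0))"
      using integral_matrix_vector[OF pot_L2_per[OF p], of TT] integral_pot[OF p] by simp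
    finally have "(?L - TT) *v (?Q *v ((?L - TT) *v E0)) = 0"
      by (simp add: matrix_vector_mult_diff_rdistrib)
    then show ?thesis by (simp add: matrix_vector_mul_assoc matrix_mul_assoc)
  qed
  then show ?thesis unfolding matrix_eq by blast
qed

text \<open>Mixing the two components by constants preserves both gradients and divergence-free
  fields, so a commuting factor maps cell solutions to cell solutions.\<close>

lemma effective_tensor_commute:
  assumes L: "composite L" and rel: "AE x in cell. L x ** (A \<otimes>\<^sub>k I2) = (A \<otimes>\<^sub>k I2) ** L x"
  shows "effective_tensor L ** (A \<otimes>\<^sub>k I2) = (A \<otimes>\<^sub>k I2) ** effective_tensor L"
proof -
  let ?Q = "A \<otimes>\<^sub>k I2" and ?L = "effective_tensor L"
  have "(?L ** ?Q) *v E0 = (?Q ** ?L) *v E0" for E0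
  proof -
    obtain E where E: "cell_field L E0 E" using cell_field_exists[OF L] by blast
    then have p: "pot E0 E" and s: "solenoidal (\<lambda>x. L x *v E x)" by (auto simp: cell_field_iff)
    have eq: "AE x in cell. ?Q *v (L x *v E x) = L x *v (?Q *v E x)"
      using rel by eventually_elim (simp add: matrix_vector_mul_assoc matrix_mul_assoc)
    have "?L *v (?Q *v E0) = (LINT x|cell. ?Q *v (L x *v E x))"
      by (rule effective_tensor_applyI[OF L pot_kron_id[OF p] solenoidal_kron_id[OF s] eq])
    also have "\<dots> = ?Q *v (?L *v E0)"
      using integral_matrix_vector[OF solenoidal_L2_per[OF s], of ?Q] effective_tensor_apply[OF L E] by simp
    finally show ?thesis by (simp add: matrix_vector_mul_assoc matrix_mul_assoc)
  qed
  then show ?thesis unfolding matrix_eq by blast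
qed

text \<open>The constant field \<open>e\<close> solves the cell problem, with the constant flux
  \<open>TT *v e\<close>.\<close>

lemma effective_tensor_kernel:
  assumes L: "composite L" and rel: "AE x in cell. (L x - TT) *v e = 0"
  shows "(effective_tensor L - TT) *v e = 0"
proof -
  have eq: "AE x in cell. TT *v e = L x *v e"
    using rel by eventually_elim (simp add: matrix_vector_mult_diff_rdistrib)
  have "effective_tensor L *v e = (LINT x|cell. TT *v e)"
    by (rule effective_tensor_applyI[OF L pot_const solenoidal_const eq])
  then show ?thesis by (simp add: matrix_vector_mult_diff_rdistrib)
qed

section \<open>Tensors for which \<open>L - TT\<close> has a graph as kernel\<close>

lemma matrix_vector_uminus [simp]: "A *v (- x) = - (A *v x)" for A :: "real^'n^'m"
  using matrix_vector_mult_scaleR[of A "-1" x] by simp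

text \<open>\<open>L - T\<close> vanishes on the graph of vectors \<open>(- M v, v)\<close>. For positive \<open>L\<close> this holds exactly
  when \<open>L = frakL A M\<close> for some \<open>A\<close>.\<close>

definition kernel_graph :: "tmat \<Rightarrow> mat2 \<Rightarrow> bool" where
  "kernel_graph L M \<longleftrightarrow> (\<forall>v. (L - TT) *v tpair (- (M *v v)) v = 0)"

lemma inner_tvec_2: "e \<bullet> f = tcomp 1 e \<bullet> tcomp 1 f + tcomp 2 e \<bullet> tcomp 2 f"
  by (simp add: inner_tvec sum_2)

lemma tcomp_TT: "tcomp 1 (TT *v e) = - (Rperp *v tcomp 2 e)" "tcomp 2 (TT *v e) = Rperp *v tcomp 1 e"
  by (simp_all add: TT_def tcomp_kron sum_2 Rperp_def)

lemma inner_TT: "e \<bullet> (TT *v e) = 2 * (tcomp 2 e \<bullet> (Rperp *v tcomp 1 e))"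
  using Rperp_skew[of "tcomp 2 e" "tcomp 1 e"] by (simp add: inner_tvec_2 tcomp_TT inner_commute)

lemma TT_Sym: "TT \<in> Sym"
  by (rule SymI) (simp add: inner_tvec_2 tcomp_TT Rperp_skew)

lemma Sym_diff: "A \<in> Sym \<Longrightarrow> B \<in> Sym \<Longrightarrow> A - B \<in> Sym"
  by (auto simp: Sym_def transpose_def vec_eq_iff)

lemma SymPos_diff_TT_Sym: "L \<in> SymPos \<Longrightarrow> L - TT \<in> Sym"
  using TT_Sym by (intro Sym_diff) (auto simp: SymPos_def)

lemma Rperp_inner [simp]: "(Rperp *v a) \<bullet> (Rperp *v b) = a \<bullet> b"
  by (simp add: Rperp_skew)

text \<open>By symmetry the range of \<open>L - TT\<close> is orthogonal to its kernel, so the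
  second component of \<open>j\<close> is \<open>transpose M\<close> applied to the first. The sign
  is positivity of \<open>L\<close> on a kernel vector, where \<open>L\<close> and \<open>TT\<close>
  agree.\<close>

lemma kernel_graph_flux:
  assumes L: "L \<in> SymPos" and M: "kernel_graph L M"
    and j: "j = (L - TT) *v e"
  shows "tcomp 1 j \<noteq> 0 \<Longrightarrow> tcomp 2 j \<bullet> (Rperp *v tcomp 1 j) < 0" and "tcomp 1 j = 0 \<Longrightarrow> j = 0"
proof -
  note N = SymPos_diff_TT_Sym[OF L]
  have j2: "tcomp 2 j \<bullet> v = tcomp 1 j \<bullet> (M *v v)" for v
  proof -
    have "j \<bullet> tpair (- (M *v v)) v = e \<bullet> ((L - TT) *v tpair (- (M *v v)) v)"
      unfolding j by (rule Sym_inner_commute[OF N])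
    also have "\<dots> = 0" using M by (simp add: kernel_graph_def)
    finally show ?thesis by (simp add: inner_tvec_2)
  qed
  show "j = 0" if "tcomp 1 j = 0"
  proof -
    have "tcomp 2 j \<bullet> tcomp 2 j = 0" using that by (simp add: j2)
    then show ?thesis using that by (simp add: tvec_eq_iff forall_2)
  qed
  show "tcomp 2 j \<bullet> (Rperp *v tcomp 1 j) < 0" if nz: "tcomp 1 j \<noteq> 0"
  proof -
    \<comment> \<open>With this \<open>v\<close> the form of \<open>TT\<close> on the kernel vector
      becomes -2 times the pairing in the claim.\<close>
    define v where "v = Rperp *v tcomp 1 j"
    have "v \<bullet> v \<noteq> 0" using nz by (simp add: v_def)
    then have "v \<noteq> 0" by auto
    define k where "k = tpair (- (M *v v)) v"
    have "tcomp 2 k \<noteq> 0" using \<open>v \<noteq> 0\<close> by (simp add: k_def)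
    then have "k \<noteq> 0" by auto
    then have "0 < k \<bullet> (L *v k)" using L by (auto simp: SymPos_def qless_def)
    also have "L *v k = TT *v k"
      using M by (simp add: kernel_graph_def k_def matrix_vector_mult_diff_rdistrib)
    also have "k \<bullet> (TT *v k) = - 2 * (v \<bullet> (Rperp *v (M *v v)))"
      unfolding inner_TT by (simp add: k_def)
    also have "v \<bullet> (Rperp *v (M *v v)) = tcomp 1 j \<bullet> (M *v v)"
      by (simp add: v_def)
    finally show ?thesis using j2[of v] by (simp add: v_def)
  qed
qed

definition blk :: "2 \<Rightarrow> 2 \<Rightarrow> tmat \<Rightarrow> mat2" where
  "blk a b X = (\<chi> i j. X $ (a, i) $ (b, j))"

lemma tcomp_blk: "tcomp a (X *v e) = (\<Sum>b\<in>UNIV. blk a b X *v tcomp b e)"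
  by (simp add: vec_eq_iff blk_def matrix_vector_mult_def sum_pair_2)

lemma blk_11_diff_TT: "blk 1 1 (L - TT) = blk 1 1 L"
  by (simp add: blk_def TT_def kron_def block_def Rperp_def vec_eq_iff)

lemma blk_11_SymPos:
  assumes "L \<in> SymPos" shows "blk 1 1 L \<in> SymPos"
  unfolding SymPos_def qless_def
proof (intro CollectI conjI allI impI)
  show "blk 1 1 L \<in> Sym"
    using assms by (auto simp: SymPos_def Sym_def blk_def transpose_def vec_eq_iff)
  fix v :: vec2 assume "v \<noteq> 0"
  then have "tcomp 1 (tpair v 0) \<noteq> 0" by simp
  then have "tpair v 0 \<noteq> 0" by (metis tcomp_simps(4))
  then have "0 < tpair v 0 \<bullet> (L *v tpair v 0)"
    using assms by (auto simp: SymPos_def qless_def)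
  then show "v \<bullet> (0 *v v) < v \<bullet> (blk 1 1 L *v v)"
    by (simp add: inner_tvec_2 tcomp_blk sum_2)
qed

lemma SymPos_invertible:
  fixes A :: "real^'n^'n"
  assumes "A \<in> SymPos" shows "invertible A"
proof -
  have "A *v x \<noteq> 0" if "x \<noteq> 0" for x
    using assms that by (auto simp: SymPos_def qless_def)
  then have "inj ((*v) A)"
    by (intro linear_injective_0[THEN iffD2]) auto
  then show ?thesis
    using invertible_left_inverse matrix_left_invertible_injective by blast
qed

lemma SymPos_inverse:
  fixes A :: "real^'n^'n"
  assumes "A \<in> SymPos" shows "A *v (matrix_inv A *v v) = v" "matrix_inv A *v (A *v v) = v"
proof -
  have "A ** matrix_inv A = mat 1 \<and> matrix_inv A ** A = mat 1"
    using SymPos_invertible[OF assms] unfolding invertible_def matrix_inv_def by (rule someI_ex)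
  then show "A *v (matrix_inv A *v v) = v" "matrix_inv A *v (A *v v) = v"
    by (simp_all add: matrix_vector_mul_assoc)
qed

text \<open>Choose \<open>E0\<close> so that \<open>j = (L - T) E\<close> has \<open>j\<^sub>1\<close> of mean zero. Then \<open>R\<^sub>\<perp> j\<^sub>1\<close> is a gradient,
  hence orthogonal to the solenoidal \<open>j\<^sub>2\<close>; but pointwise \<open>j\<^sub>2 \<bullet> R\<^sub>\<perp> j\<^sub>1 < 0\<close> unless \<open>j = 0\<close>.\<close>

lemma effective_tensor_kernel_graph:
  assumes L: "composite L" and rel: "AE x in cell. \<exists>M. kernel_graph (L x) M"
  shows "\<exists>M. kernel_graph (effective_tensor L) M"
proof -
  let ?L = "effective_tensor L"
  define A where "A = blk 1 1 ?L"
  have A: "A \<in> SymPos" unfolding A_def by (rule blk_11_SymPos[OF effective_tensor_SymPos[OF L]])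
  \<comment> \<open>The choice forced by requiring the first component of the mean of
    \<open>(L - TT) E\<close> to vanish; the block \<open>A\<close> is invertible by
    positivity.\<close>
  define M where "M = matrix_inv A ** blk 1 2 (?L - TT)"
  have "(?L - TT) *v tpair (- (M *v v)) v = 0" for v
  proof -
    let ?E0 = "tpair (- (M *v v)) v"
    obtain E where E: "cell_field L ?E0 E" using cell_field_exists[OF L] by blast
    define J where "J x = L x *v E x - TT *v E x" for x
    have s: "solenoidal J" and m: "(LINT x|cell. J x) = (?L - TT) *v ?E0"
      unfolding J_def by (rule cell_field_flux[OF L E])+
    have d: "div_free (\<lambda>x. tcomp a (J x))" for a using s by (simp add: solenoidal_def)
    have "(LINT x|cell. tcomp 1 (J x)) = tcomp 1 ((?L - TT) *v ?E0)"
      using integral_tcomp[OF solenoidal_L2_per[OF s], of 1] m by simp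
    also have "\<dots> = blk 1 2 (?L - TT) *v v - A *v (M *v v)"
      by (simp add: tcomp_blk sum_2 blk_11_diff_TT A_def)
    also have "\<dots> = 0"
      unfolding M_def by (simp add: matrix_vector_mul_assoc[symmetric] SymPos_inverse[OF A])
    finally have "grad_field (\<lambda>x. Rperp *v tcomp 1 (J x))"
      using helmholtz[OF d[of 1]] by simp
    from grad_div_free_orthogonal[OF this d[of 2]]
    have 0: "(LINT x|cell. tcomp 2 (J x) \<bullet> (Rperp *v tcomp 1 (J x))) = 0" .
    have pw: "AE x in cell. tcomp 2 (J x) \<bullet> (Rperp *v tcomp 1 (J x)) \<le> 0 \<and>
        (tcomp 2 (J x) \<bullet> (Rperp *v tcomp 1 (J x)) = 0 \<longrightarrow> J x = 0)"
      using rel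
    proof eventually_elim
      fix x assume "\<exists>M. kernel_graph (L x) M"
      then obtain M' where "kernel_graph (L x) M'" ..
      from kernel_graph_flux[OF composite_SymPos[OF L] this refl, where e="E x"]
      show "tcomp 2 (J x) \<bullet> (Rperp *v tcomp 1 (J x)) \<le> 0 \<and>
        (tcomp 2 (J x) \<bullet> (Rperp *v tcomp 1 (J x)) = 0 \<longrightarrow> J x = 0)"
        unfolding J_def matrix_vector_mult_diff_rdistrib[symmetric]
        by (cases "tcomp 1 ((L x - TT) *v E x) = 0") auto
    qed
    have i: "integrable cell (\<lambda>x. - (tcomp 2 (J x) \<bullet> (Rperp *v tcomp 1 (J x))))"
      by (intro integrable_minus L2_per_inner div_free_L2_per d
          L2_per_bounded_linear[OF matrix_vector_mul_bounded_linear])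
    have "AE x in cell. - (tcomp 2 (J x) \<bullet> (Rperp *v tcomp 1 (J x))) = 0"
      using integral_nonneg_eq_0_iff_AE[OF i] pw 0 by (auto elim: eventually_mono)
    with pw have "AE x in cell. J x = 0" by eventually_elim auto
    then have "(LINT x|cell. J x) = 0"
      by (intro integral_eq_zero_AE)
    then show ?thesis using m by simp
  qed
  then show ?thesis unfolding kernel_graph_def by blast
qed

section \<open>Algebraic descriptions of the relations\<close>

lemma inner_transpose: "x \<bullet> (transpose A *v y) = (A *v x) \<bullet> y" for A :: "real^'n^'m"
  using dot_lmul_matrix[of y A x] by (simp add: inner_commute)

lemma transpose_inner: "(transpose A *v y) \<bullet> x = y \<bullet> (A *v x)" for A :: "real^'n^'m"
  using inner_transpose[of x A y] by (simp add: inner_commute)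

declare transpose_matrix_vector [simp del]

lemma tcomp_frakL:
  "tcomp 1 (frakL L M *v e) = L *v (tcomp 1 e + M *v tcomp 2 e) - Rperp *v tcomp 2 e"
  "tcomp 2 (frakL L M *v e) = transpose M *v (L *v (tcomp 1 e + M *v tcomp 2 e)) + Rperp *v tcomp 1 e"
  by (simp_all add: frakL_def matrix_vector_mult_add_rdistrib tcomp_block tcomp_TT
      matrix_vector_mul_assoc[symmetric] matrix_vector_right_distrib)

lemma frakL_Sym: assumes "L \<in> Sym" shows "frakL L M \<in> Sym"
  by (rule SymI)
    (simp add: inner_tvec_2 tcomp_frakL inner_add_left inner_add_right inner_diff_left inner_diff_right
      inner_transpose transpose_inner
      matrix_vector_right_distrib Sym_inner_commute[OF assms] Rperp_skew)

text \<open>Grouped by \<open>w = tcomp 1 e + M *v tcomp 2 e\<close> and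
  \<open>y = Rperp *v tcomp 2 e\<close>, the variables in which both positivity criteria complete a
  square.\<close>

lemma frakL_quadratic:
  "e \<bullet> (frakL L M *v e) = (tcomp 1 e + M *v tcomp 2 e) \<bullet> (L *v (tcomp 1 e + M *v tcomp 2 e))
    - 2 * ((Rperp *v tcomp 2 e) \<bullet> (tcomp 1 e + M *v tcomp 2 e))
    + 2 * ((Rperp *v tcomp 2 e) \<bullet> (M *v tcomp 2 e))"
  using Rperp_skew[of "tcomp 2 e" "tcomp 1 e"]
  by (simp add: inner_tvec_2 tcomp_frakL inner_add_left inner_add_right inner_diff_right inner_transpose
      inner_commute[of _ "Rperp *v tcomp 2 e"])

lemma SymPos_posI: "A \<in> SymPos \<Longrightarrow> x \<noteq> 0 \<Longrightarrow> 0 < x \<bullet> (A *v x)" for A :: "real^'n^'n"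
  by (auto simp: SymPos_def qless_def)

lemma SymPos_nonneg: "A \<in> SymPos \<Longrightarrow> 0 \<le> x \<bullet> (A *v x)" for A :: "real^'n^'n"
  using SymPos_posI[of A x] by (cases "x = 0") auto

text \<open>Completing the square in \<open>w = e\<^sub>1 + M e\<^sub>2\<close>.\<close>

lemma frakL_SymPos_iff:
  assumes L: "L \<in> SymPos"
  shows "frakL L M \<in> SymPos \<longleftrightarrow> matrix_inv L \<prec> - (2 *\<^sub>R (M ** Rperp))"
proof -
  let ?K = "matrix_inv L"
  have LS: "L \<in> Sym" using L by (simp add: SymPos_def)
  have rhs: "y \<bullet> (- (2 *\<^sub>R (M ** Rperp)) *v y) = 2 * (y \<bullet> (M *v (- (Rperp *v y))))" for y
  proof -
    have "- (2 *\<^sub>R (M ** Rperp)) *v y = (-2) *\<^sub>R (M *v (Rperp *v y))"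
      by (simp add: scaleR_matrix_vector[symmetric] matrix_vector_mul_assoc)
    then show ?thesis by simp
  qed
  have form: "e \<bullet> (frakL L M *v e) = (w - ?K *v y) \<bullet> (L *v (w - ?K *v y))
      + (2 * (y \<bullet> (M *v tcomp 2 e)) - y \<bullet> (?K *v y))"
    if "w = tcomp 1 e + M *v tcomp 2 e" "y = Rperp *v tcomp 2 e" for e w y
  proof -
    have "(w - ?K *v y) \<bullet> (L *v (w - ?K *v y)) = w \<bullet> (L *v w) - 2 * (y \<bullet> w) + y \<bullet> (?K *v y)"
      using SymPos_inverse[OF L] Sym_inner_commute[OF LS, of "?K *v y" w]
      by (simp add: matrix_vector_mult_diff_distrib inner_diff_left inner_diff_right inner_commute[of w y]
          inner_commute[of "?K *v y" y])
    then show ?thesis using frakL_quadratic[of e L M] that by simp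
  qed
  show ?thesis
  proof
    assume P: "frakL L M \<in> SymPos"
    show "?K \<prec> - (2 *\<^sub>R (M ** Rperp))"
      unfolding qless_def rhs
    proof (intro allI impI)
      fix y :: vec2 assume y: "y \<noteq> 0"
      define v where "v = - (Rperp *v y)"
      \<comment> \<open>Chosen so that \<open>w\<close> equals \<open>?K *v y\<close>: the square
        vanishes and only the remainder is tested.\<close>
      define e where "e = tpair (?K *v y - M *v v) v"
      have "v \<bullet> v \<noteq> 0" using y by (simp add: v_def)
      then have "tcomp 2 e \<noteq> 0" by (auto simp: e_def)
      then have "e \<noteq> 0" by auto
      then have "0 < e \<bullet> (frakL L M *v e)" by (rule SymPos_posI[OF P])
      also have "\<dots> = 2 * (y \<bullet> (M *v v)) - y \<bullet> (?K *v y)"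
      proof -
        have "?K *v y = tcomp 1 e + M *v tcomp 2 e" "y = Rperp *v tcomp 2 e"
          by (simp_all add: e_def v_def)
        from form[OF this] show ?thesis by (simp add: e_def)
      qed
      finally show "y \<bullet> (?K *v y) < 2 * (y \<bullet> (M *v (- (Rperp *v y))))" by (simp only: v_def)
    qed
  next
    assume K: "?K \<prec> - (2 *\<^sub>R (M ** Rperp))"
    show "frakL L M \<in> SymPos"
      unfolding SymPos_def qless_def
    proof (intro CollectI conjI allI impI frakL_Sym LS)
      fix e :: tvec assume e: "e \<noteq> 0"
      define w y where "w = tcomp 1 e + M *v tcomp 2 e" and "y = Rperp *v tcomp 2 e"
      have ye: "tcomp 2 e = - (Rperp *v y)" by (simp add: y_def)
      have sq: "0 \<le> (w - ?K *v y) \<bullet> (L *v (w - ?K *v y))" by (rule SymPos_nonneg[OF L])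
      have "0 < e \<bullet> (frakL L M *v e)"
      proof (cases "y = 0")
        case True
        then have "tcomp 2 e = 0" using ye by simp
        then have "w \<noteq> 0" using e by (auto simp: w_def tvec_eq_iff forall_2)
        then have "0 < w \<bullet> (L *v w)" by (rule SymPos_posI[OF L])
        then show ?thesis using form[OF w_def y_def] True by simp
      next
        case False
        then have "y \<bullet> (?K *v y) < 2 * (y \<bullet> (M *v tcomp 2 e))"
          using K unfolding qless_def rhs ye by blast
        then show ?thesis using form[OF w_def y_def] sq by linarith
      qed
      then show "e \<bullet> (0 *v e) < e \<bullet> (frakL L M *v e)" by simp
    qed
  qed
qed

text \<open>Positivity of \<open>L\<close> is not presupposed here. For \<open>M = Rperp\<close> the
  last term of the form is \<open>2 * (y \<bullet> y)\<close>, so the square is completed in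
  \<open>y\<close> instead of \<open>w\<close>, and 1/2 is what this costs.\<close>

lemma frakL_Rperp_SymPos_iff:
  assumes L: "L \<in> Sym"
  shows "frakL L Rperp \<in> SymPos \<longleftrightarrow> (1/2) *\<^sub>R I2 \<prec> L"
proof -
  have form: "e \<bullet> (frakL L Rperp *v e) = (w \<bullet> (L *v w) - 1/2 * (w \<bullet> w)) + 2 * ((y - (1/2) *\<^sub>R w) \<bullet> (y - (1/2) *\<^sub>R w))"
    if "w = tcomp 1 e + y" "y = Rperp *v tcomp 2 e" for e w y
  proof -
    have "e \<bullet> (frakL L Rperp *v e) = w \<bullet> (L *v w) - 2 * (y \<bullet> w) + 2 * (y \<bullet> y)"
      using frakL_quadratic[of e L Rperp] that by (simp only:)
    moreover have "(y - (1/2) *\<^sub>R w) \<bullet> (y - (1/2) *\<^sub>R w) = y \<bullet> y - y \<bullet> w + (w \<bullet> w) / 4"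
      by (simp add: inner_diff_left inner_diff_right inner_commute[of w y] field_simps)
    ultimately show ?thesis by simp
  qed
  have half: "w \<bullet> ((1/2) *\<^sub>R I2 *v w) = 1/2 * (w \<bullet> w)" for w :: vec2
    by (simp add: scaleR_matrix_vector)
  show ?thesis
  proof
    assume P: "frakL L Rperp \<in> SymPos"
    show "(1/2) *\<^sub>R I2 \<prec> L"
      unfolding qless_def half
    proof (intro allI impI)
      fix w :: vec2 assume w: "w \<noteq> 0"
      \<comment> \<open>The vector with \<open>y\<close> equal to half of \<open>w\<close>, where
        the square in \<open>y\<close> is zero.\<close>
      define e where "e = tpair ((1/2) *\<^sub>R w) (- (Rperp *v ((1/2) *\<^sub>R w)))"
      have "tcomp 1 e \<noteq> 0" using w by (simp add: e_def)
      then have "e \<noteq> 0" by auto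
      then have "0 < e \<bullet> (frakL L Rperp *v e)" by (rule SymPos_posI[OF P])
      also have "\<dots> = w \<bullet> (L *v w) - 1/2 * (w \<bullet> w)"
      proof -
        have "w = tcomp 1 e + (1/2) *\<^sub>R w" "(1/2) *\<^sub>R w = Rperp *v tcomp 2 e"
          by (simp_all add: e_def flip: scaleR_add_left)
        from form[OF this] show ?thesis by simp
      qed
      finally show "1/2 * (w \<bullet> w) < w \<bullet> (L *v w)" by simp
    qed
  next
    assume K: "(1/2) *\<^sub>R I2 \<prec> L"
    show "frakL L Rperp \<in> SymPos"
      unfolding SymPos_def qless_def
    proof (intro CollectI conjI allI impI frakL_Sym L)
      fix e :: tvec assume e: "e \<noteq> 0"
      define y where "y = Rperp *v tcomp 2 e"
      define w where "w = tcomp 1 e + y"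
      have sq: "0 \<le> (y - (1/2) *\<^sub>R w) \<bullet> (y - (1/2) *\<^sub>R w)" by simp
      have "0 < e \<bullet> (frakL L Rperp *v e)"
      proof (cases "w = 0")
        case True
        have "y \<noteq> 0"
        proof
          assume y0: "y = 0"
          have "tcomp 2 e = - (Rperp *v y)" by (simp add: y_def)
          with y0 True have "e = 0" by (simp add: w_def tvec_eq_iff forall_2)
          with e show False ..
        qed
        then show ?thesis using form[OF w_def y_def] True by simp
      next
        case False
        then have "1/2 * (w \<bullet> w) < w \<bullet> (L *v w)"
          using K unfolding qless_def half by blast
        then show ?thesis using form[OF w_def y_def] sq by linarith
      qed
      then show "e \<bullet> (0 *v e) < e \<bullet> (frakL L Rperp *v e)" by simp
    qed
  qed
qed

section \<open>The parametrized sets as kernel conditions\<close>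

lemma kernel_graph_frakL: "kernel_graph (frakL L M) M"
  by (simp add: kernel_graph_def tvec_eq_iff forall_2 matrix_vector_mult_diff_rdistrib tcomp_frakL tcomp_TT)

text \<open>Modulo the kernel every \<open>e\<close> is congruent to a vector with second component
  zero, which gives the first identity; the second is orthogonality of range and kernel.\<close>

lemma kernel_graph_tcomp:
  assumes L: "L \<in> SymPos" and M: "kernel_graph L M"
  shows "tcomp 1 ((L - TT) *v e) = blk 1 1 L *v (tcomp 1 e + M *v tcomp 2 e)"
    and "tcomp 2 ((L - TT) *v e) = transpose M *v tcomp 1 ((L - TT) *v e)"
proof -
  note N = SymPos_diff_TT_Sym[OF L]
  have "e = tpair (- (M *v tcomp 2 e)) (tcomp 2 e) + tpair (tcomp 1 e + M *v tcomp 2 e) 0"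
    by (simp add: tvec_eq_iff forall_2)
  then have "(L - TT) *v e = (L - TT) *v tpair (tcomp 1 e + M *v tcomp 2 e) 0"
    using M by (metis (no_types) add_0 kernel_graph_def matrix_vector_right_distrib)
  then show "tcomp 1 ((L - TT) *v e) = blk 1 1 L *v (tcomp 1 e + M *v tcomp 2 e)"
    by (simp add: tcomp_blk sum_2 blk_11_diff_TT)
  let ?j = "(L - TT) *v e"
  have "v \<bullet> tcomp 2 ?j = v \<bullet> (transpose M *v tcomp 1 ?j)" for v
  proof -
    have "?j \<bullet> tpair (- (M *v v)) v = e \<bullet> ((L - TT) *v tpair (- (M *v v)) v)"
      by (rule Sym_inner_commute[OF N])
    also have "\<dots> = 0" using M by (simp add: kernel_graph_def)
    finally show ?thesis by (simp add: inner_tvec_2 inner_transpose inner_commute)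
  qed
  then show "tcomp 2 ?j = transpose M *v tcomp 1 ?j"
    by (rule iffD1[OF vector_eq_ldot, OF allI])
qed

lemma kernel_graph_imp_frakL:
  assumes L: "L \<in> SymPos" and M: "kernel_graph L M"
  shows "L = frakL (blk 1 1 L) M"
proof -
  have "L *v e = frakL (blk 1 1 L) M *v e" for e
  proof -
    have "tcomp 1 (L *v e) = tcomp 1 ((L - TT) *v e) + tcomp 1 (TT *v e)"
      "tcomp 2 (L *v e) = tcomp 2 ((L - TT) *v e) + tcomp 2 (TT *v e)"
      by (simp_all add: matrix_vector_mult_diff_rdistrib)
    then show ?thesis
      unfolding tvec_eq_iff forall_2 kernel_graph_tcomp(2)[OF L M]
      unfolding kernel_graph_tcomp(1)[OF L M] by (simp add: tcomp_frakL tcomp_TT)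
  qed
  then show ?thesis by (simp add: matrix_eq)
qed

text \<open>The predicate \<open>P\<close> lets one proof serve three sets. The matrix inequality on
  the left is exactly positivity of the tensor, and \<open>L\<close> is recovered as its upper left
  block.\<close>

lemma frakL_set_eq:
  "{frakL L M | L M. L \<in> Sym \<and> P M \<and> 0 \<prec> L \<and> matrix_inv L \<prec> - (2 *\<^sub>R (M ** Rperp))}
   = {L \<in> SymPos. \<exists>M. P M \<and> kernel_graph L M}"
proof (intro equalityI subsetI; clarsimp)
  fix L M :: mat2 assume "L \<in> Sym" "P M" "0 \<prec> L" and c: "matrix_inv L \<prec> - (2 *\<^sub>R (M ** Rperp))"
  then have "L \<in> SymPos" by (simp add: SymPos_def)
  with c have "frakL L M \<in> SymPos" using frakL_SymPos_iff by blast
  with \<open>P M\<close> show "frakL L M \<in> SymPos \<and> (\<exists>N. P N \<and> kernel_graph (frakL L M) N)"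
    using kernel_graph_frakL by blast
next
  fix L M assume L: "L \<in> SymPos" and PM: "P M" and M: "kernel_graph L M"
  have A: "blk 1 1 L \<in> SymPos" by (rule blk_11_SymPos[OF L])
  have eq: "L = frakL (blk 1 1 L) M" by (rule kernel_graph_imp_frakL[OF L M])
  then have "matrix_inv (blk 1 1 L) \<prec> - (2 *\<^sub>R (M ** Rperp))"
    using frakL_SymPos_iff[OF A, of M] L by simp
  with eq A PM show "\<exists>L' M. L = frakL L' M \<and> L' \<in> Sym \<and> P M \<and> 0 \<prec> L' \<and> matrix_inv L' \<prec> - (2 *\<^sub>R (M ** Rperp))"
    unfolding SymPos_def by blast
qed

lemma M21_eq: "M21 = {L \<in> SymPos. \<exists>M. kernel_graph L M}"
  using frakL_set_eq[of "\<lambda>M. True"] by (simp add: M21_def)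

lemma M20_param_eq: "M20_param = {L \<in> SymPos. \<exists>M. det M = 1 \<and> kernel_graph L M}"
  using frakL_set_eq[of "\<lambda>M. det M = 1"] by (simp add: M20_param_def)

lemma M19_kernel_eq: "M19 = {L \<in> SymPos. \<exists>M. M ** M = - I2 \<and> kernel_graph L M}"
proof -
  have "matrix_inv L + 2 *\<^sub>R (M ** Rperp) \<prec> 0 \<longleftrightarrow> matrix_inv L \<prec> - (2 *\<^sub>R (M ** Rperp))" for L M :: mat2
  proof -
    have "- (2 *\<^sub>R (M ** Rperp)) *v x = - ((2 *\<^sub>R (M ** Rperp)) *v x)" for x
      using scaleR_matrix_vector[of "-1" "2 *\<^sub>R (M ** Rperp)" x] by simp
    then show ?thesis
      by (auto simp: qless_def matrix_vector_mult_add_rdistrib inner_add_right)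
  qed
  then show ?thesis
    using frakL_set_eq[of "\<lambda>M. M ** M = - I2"] by (simp add: M19_def)
qed

lemma M13_eq: "M13 = {L \<in> SymPos. kernel_graph L Rperp}"
proof (intro equalityI subsetI)
  fix X assume "X \<in> M13"
  then show "X \<in> {L \<in> SymPos. kernel_graph L Rperp}"
    using frakL_Rperp_SymPos_iff kernel_graph_frakL by (auto simp: M13_def)
next
  fix L assume "L \<in> {L \<in> SymPos. kernel_graph L Rperp}"
  then have L: "L \<in> SymPos" and M: "kernel_graph L Rperp" by auto
  have A: "blk 1 1 L \<in> Sym" using blk_11_SymPos[OF L] by (simp add: SymPos_def)
  have eq: "L = frakL (blk 1 1 L) Rperp" by (rule kernel_graph_imp_frakL[OF L M])
  then have "(1/2) *\<^sub>R I2 \<prec> blk 1 1 L"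
    using frakL_Rperp_SymPos_iff[OF A] L by simp
  with eq A show "L \<in> M13" unfolding M13_def by blast
qed

text \<open>On the range \<open>{(p, M\<^sup>T p)}\<close> of \<open>L - T\<close> the form of \<open>J \<otimes> R\<^sub>\<perp>\<close> is \<open>(1 - det M) p \<bullet> R\<^sub>\<perp> q\<close>
  and that of \<open>Xmat \<otimes> R\<^sub>\<perp>\<close> is \<open>(tr M) p \<bullet> R\<^sub>\<perp> q\<close>; together they encode \<open>M\<^sup>2 = - I\<close>.\<close>

definition Xmat :: mat2 where
  "Xmat = vector [vector [0, 1], vector [1, 0]]"

lemma Jmat_nth [simp]: "Jmat $ 1 $ 1 = 1" "Jmat $ 1 $ 2 = 0" "Jmat $ 2 $ 1 = 0" "Jmat $ 2 $ 2 = -1"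
  by (simp_all add: Jmat_def)

lemma Rperp_entry [simp]: "Rperp $ 1 $ 1 = 0" "Rperp $ 1 $ 2 = -1" "Rperp $ 2 $ 1 = 1" "Rperp $ 2 $ 2 = 0"
  by (simp_all add: Rperp_def)

lemma Xmat_nth [simp]: "Xmat $ 1 $ 1 = 0" "Xmat $ 1 $ 2 = 1" "Xmat $ 2 $ 1 = 1" "Xmat $ 2 $ 2 = 0"
  by (simp_all add: Xmat_def)

text \<open>The product is the form of \<open>A \<otimes>\<^sub>k Rperp\<close> restricted to the
  range of \<open>L - TT\<close>. In the plane a skew form in \<open>p\<close>, \<open>q\<close> is
  a multiple of \<open>p \<bullet> (Rperp *v q)\<close>, so vanishing reduces to the scalar
  \<open>c\<close>.\<close>

lemma kernel_graph_null_form: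
  assumes L: "L \<in> SymPos" and M: "kernel_graph L M"
    and form: "\<And>p q. tpair p (transpose M *v p) \<bullet> ((A \<otimes>\<^sub>k Rperp) *v tpair q (transpose M *v q)) = c * (p \<bullet> (Rperp *v q))"
  shows "(L - TT) ** (A \<otimes>\<^sub>k Rperp) ** (L - TT) = 0 \<longleftrightarrow> c = 0"
proof -
  let ?N = "L - TT" and ?Q = "A \<otimes>\<^sub>k Rperp"
  note N = SymPos_diff_TT_Sym[OF L]
  have Ne: "?N *v e = tpair (tcomp 1 (?N *v e)) (transpose M *v tcomp 1 (?N *v e))" for e
    by (simp add: tvec_eq_iff forall_2 kernel_graph_tcomp(2)[OF L M])
  have key: "f \<bullet> ((?N ** ?Q ** ?N) *v e) = c * (tcomp 1 (?N *v f) \<bullet> (Rperp *v tcomp 1 (?N *v e)))" for e f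
  proof -
    have "f \<bullet> ((?N ** ?Q ** ?N) *v e) = (?N *v f) \<bullet> (?Q *v (?N *v e))"
      by (simp add: matrix_vector_mul_assoc[symmetric] Sym_inner_commute[OF N])
    also have "\<dots> = c * (tcomp 1 (?N *v f) \<bullet> (Rperp *v tcomp 1 (?N *v e)))"
      by (subst (1 2) Ne) (rule form)
    finally show ?thesis .
  qed
  show ?thesis
  proof
    assume 0: "?N ** ?Q ** ?N = 0"
    let ?A = "blk 1 1 L"
    \<comment> \<open>Invertibility of the upper left block lets the first components run through
      the standard basis, on which the skew form is 1.\<close>
    define e f where "e = tpair (matrix_inv ?A *v axis 1 1) 0" and "f = tpair (matrix_inv ?A *v axis 2 1) 0"
    have "tcomp 1 (?N *v e) = axis 1 1" "tcomp 1 (?N *v f) = axis 2 1"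
      unfolding kernel_graph_tcomp(1)[OF L M] e_def f_def
      by (simp_all add: SymPos_inverse[OF blk_11_SymPos[OF L]])
    with key[of f e] 0 show "c = 0" by (simp add: inner_axis')
  next
    assume "c = 0"
    then have "f \<bullet> ((?N ** ?Q ** ?N) *v e) = f \<bullet> 0" for e f by (simp add: key)
    then have "(?N ** ?Q ** ?N) *v e = 0" for e by (rule iffD1[OF vector_eq_ldot, OF allI])
    then show "?N ** ?Q ** ?N = 0" by (simp add: matrix_eq)
  qed
qed

lemma matrix_vector_nth_2: "(A *v v) $ i = A $ i $ 1 * v $ 1 + A $ i $ 2 * v $ 2" for A :: mat2
  by (simp add: matrix_vector_mult_def sum_2)

lemma kernel_graph_null_J:
  assumes "L \<in> SymPos" "kernel_graph L M"
  shows "(L - TT) ** (Jmat \<otimes>\<^sub>k Rperp) ** (L - TT) = 0 \<longleftrightarrow> det M = 1"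
proof -
  have "(L - TT) ** (Jmat \<otimes>\<^sub>k Rperp) ** (L - TT) = 0 \<longleftrightarrow> 1 - det M = 0"
    by (rule kernel_graph_null_form[OF assms])
      (simp add: inner_tvec_2 tcomp_kron sum_2 inner_vec_def matrix_vector_nth_2 transpose_def det_2 algebra_simps)
  then show ?thesis by auto
qed

lemma kernel_graph_null_X:
  assumes "L \<in> SymPos" "kernel_graph L M"
  shows "(L - TT) ** (Xmat \<otimes>\<^sub>k Rperp) ** (L - TT) = 0 \<longleftrightarrow> M $ 1 $ 1 + M $ 2 $ 2 = 0"
  by (rule kernel_graph_null_form[OF assms])
    (simp add: inner_tvec_2 tcomp_kron sum_2 inner_vec_def matrix_vector_nth_2 transpose_def algebra_simps)

text \<open>The range of \<open>L - T\<close> is isotropic for \<open>J \<otimes> R\<^sub>\<perp>\<close>; if its second components were not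
  determined by the first ones, they would all be parallel.\<close>

lemma null_J_imp_kernel_graph:
  assumes L: "L \<in> SymPos" and null: "(L - TT) ** (Jmat \<otimes>\<^sub>k Rperp) ** (L - TT) = 0"
  shows "\<exists>M. kernel_graph L M"
proof -
  let ?N = "L - TT" and ?Q = "Jmat \<otimes>\<^sub>k Rperp" and ?A = "blk 1 1 L"
  note N = SymPos_diff_TT_Sym[OF L]
  note inv = SymPos_inverse[OF blk_11_SymPos[OF L]]
  have iso: "tcomp 1 (?N *v f) \<bullet> (Rperp *v tcomp 1 (?N *v e)) = tcomp 2 (?N *v f) \<bullet> (Rperp *v tcomp 2 (?N *v e))" for e f
  proof -
    have "0 = f \<bullet> ((?N ** ?Q ** ?N) *v e)" by (simp add: null)
    also have "\<dots> = (?N *v f) \<bullet> (?Q *v (?N *v e))"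
      by (simp add: matrix_vector_mul_assoc[symmetric] Sym_inner_commute[OF N])
    finally show ?thesis by (simp add: inner_tvec_2 tcomp_kron sum_2)
  qed
  define M where "M = matrix_inv ?A ** blk 1 2 ?N"
  have "?N *v tpair (- (M *v v)) v = 0" for v
  proof (rule ccontr)
    let ?k = "tpair (- (M *v v)) v"
    define z where "z = tcomp 2 (?N *v ?k)"
    assume "?N *v ?k \<noteq> 0"
    moreover have k1: "tcomp 1 (?N *v ?k) = 0"
      by (simp add: tcomp_blk sum_2 blk_11_diff_TT M_def matrix_vector_mul_assoc[symmetric] inv)
    ultimately have z: "z \<noteq> 0" by (auto simp: tvec_eq_iff forall_2 z_def)
    \<comment> \<open>In the plane this says that all second components in the range are parallel to
      \<open>z\<close>.\<close>
    have par: "tcomp 2 (?N *v f) \<bullet> (Rperp *v z) = 0" for f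
      using iso[of f ?k] by (simp add: k1 z_def)
    define e f where "e = tpair (matrix_inv ?A *v axis 1 1) 0" and "f = tpair (matrix_inv ?A *v axis 2 1) 0"
    have 1: "tcomp 1 (?N *v e) = axis 1 1" "tcomp 1 (?N *v f) = axis 2 1"
      by (simp_all add: tcomp_blk sum_2 blk_11_diff_TT e_def f_def inv)
    let ?a = "tcomp 2 (?N *v f)" and ?b = "tcomp 2 (?N *v e)"
    \<comment> \<open>Parallel vectors have zero skew product, whereas isotropy makes it equal to
      the skew product of the two basis vectors, which is 1.\<close>
    have "(norm z)\<^sup>2 * (?a \<bullet> (Rperp *v ?b)) = - ((Rperp *v ?a) \<bullet> ((norm z)\<^sup>2 *\<^sub>R ?b))"
      by (simp add: Rperp_skew)
    also have "\<dots> = 0"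
      unfolding orthogonal_expand using par[of f] par[of e] by (simp add: inner_add_right Rperp_skew)
    finally have "?a \<bullet> (Rperp *v ?b) = 0" using z by simp
    with iso[of f e] 1 show False by (simp add: inner_axis')
  qed
  then show ?thesis unfolding kernel_graph_def by blast
qed

theorem M20_eq_M20_param: "M20 = M20_param"
  unfolding M20_def M20_param_eq
  using null_J_imp_kernel_graph kernel_graph_null_J by blast

text \<open>Cayley--Hamilton gives the converse direction. Forwards, a nonzero trace would force the
  off-diagonal entries to vanish, and a real diagonal entry cannot have square -1.\<close>

lemma matrix_sq_eq_minus_id_iff: "M ** M = - I2 \<longleftrightarrow> det M = 1 \<and> M $ 1 $ 1 + M $ 2 $ 2 = 0" for M :: mat2
proof -
  define a b c d where "a = M $ 1 $ 1" and "b = M $ 1 $ 2" and "c = M $ 2 $ 1" and "d = M $ 2 $ 2"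
  have "M ** M = - I2 \<longleftrightarrow> a * a + b * c = -1 \<and> a * b + b * d = 0 \<and> c * a + d * c = 0 \<and> c * b + d * d = -1"
    by (simp add: vec_eq_iff forall_2 matrix_matrix_mult_def sum_2 mat_def a_def b_def c_def d_def)
  also have "\<dots> \<longleftrightarrow> a * d - b * c = 1 \<and> a + d = 0"
  proof
    assume h: "a * a + b * c = -1 \<and> a * b + b * d = 0 \<and> c * a + d * c = 0 \<and> c * b + d * d = -1"
    then have bc: "b * (a + d) = 0" "c * (a + d) = 0" by (auto simp: algebra_simps)
    have "a + d = 0"
    proof (rule ccontr)
      assume "a + d \<noteq> 0"
      with bc have "b = 0" by simp
      with h have "a * a = -1" by simp
      then show False using zero_le_square[of a] by linarith
    qed
    then have "d = - a" by simp
    with h show "a * d - b * c = 1 \<and> a + d = 0" by simp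
  next
    assume h: "a * d - b * c = 1 \<and> a + d = 0"
    then have "d = - a" by simp
    with h show "a * a + b * c = -1 \<and> a * b + b * d = 0 \<and> c * a + d * c = 0 \<and> c * b + d * d = -1"
      by (simp add: algebra_simps)
  qed
  finally show ?thesis by (simp add: det_2 a_def b_def c_def d_def)
qed

text \<open>The relation with \<open>Jmat\<close> already produces the kernel graph with determinant
  one; the relation with \<open>Xmat\<close> then adds trace zero.\<close>

lemma M19_eq: "M19 = {L \<in> SymPos. (L - TT) ** (Jmat \<otimes>\<^sub>k Rperp) ** (L - TT) = 0 \<and> (L - TT) ** (Xmat \<otimes>\<^sub>k Rperp) ** (L - TT) = 0}"
  unfolding M19_kernel_eq matrix_sq_eq_minus_id_iff
  using null_J_imp_kernel_graph kernel_graph_null_J kernel_graph_null_X by blast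

section \<open>The set \<open>M8\<close> as the positive tensors commuting with a quarter turn of
  the summands\<close>

lemma tcomp_kron_Rperp_I2: "tcomp 1 (Rperp \<otimes>\<^sub>k I2 *v e) = - tcomp 2 e" "tcomp 2 (Rperp \<otimes>\<^sub>k I2 *v e) = tcomp 1 e"
  by (simp_all add: tcomp_kron sum_2)

lemma tcomp_I2_kron: "tcomp a (I2 \<otimes>\<^sub>k A *v e) = A *v tcomp a e"
  using exhaust_2[of a] by (auto simp: tcomp_kron sum_2 mat_def)

lemma tcomp_M8:
  "tcomp 1 ((I2 \<otimes>\<^sub>k A + t *\<^sub>R TT) *v e) = A *v tcomp 1 e - t *\<^sub>R (Rperp *v tcomp 2 e)"
  "tcomp 2 ((I2 \<otimes>\<^sub>k A + t *\<^sub>R TT) *v e) = A *v tcomp 2 e + t *\<^sub>R (Rperp *v tcomp 1 e)"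
  by (simp_all add: matrix_vector_mult_add_rdistrib scaleR_matrix_vector tcomp_I2_kron tcomp_TT)

lemma M8_tensor_Sym: assumes "A \<in> Sym" shows "I2 \<otimes>\<^sub>k A + t *\<^sub>R TT \<in> Sym"
  by (rule SymI)
    (simp add: inner_tvec_2 tcomp_M8 inner_add_left inner_add_right inner_diff_left inner_diff_right
      Sym_inner_commute[OF assms] Rperp_skew)

lemma Sym_entry: "A \<in> Sym \<Longrightarrow> A $ i $ j = A $ j $ i" for A :: "real^'n^'n"
  by (auto simp: Sym_def transpose_def vec_eq_iff)

lemma SymPos_det_pos:
  fixes A :: mat2
  assumes "A \<in> SymPos" shows "det A > 0"
proof -
  have s: "A $ 2 $ 1 = A $ 1 $ 2" using assms by (auto simp: SymPos_def intro: Sym_entry)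
  have "(axis 1 1 :: vec2) \<noteq> 0" by (simp add: axis_eq_0_iff)
  from SymPos_posI[OF assms this] have a: "A $ 1 $ 1 > 0"
    by (simp add: inner_axis' matrix_vector_mult_basis column_def)
  \<comment> \<open>\<open>A *v v\<close> has first component zero and second component
    \<open>det A\<close>, so the form at \<open>v\<close> is
    \<open>A $ 1 $ 1 * det A\<close>.\<close>
  define v :: vec2 where "v = vector [- A $ 1 $ 2, A $ 1 $ 1]"
  have v: "v $ 1 = - A $ 1 $ 2" "v $ 2 = A $ 1 $ 1" by (simp_all add: v_def)
  then have "v \<noteq> 0" using a by (auto simp: vec_eq_iff forall_2)
  from SymPos_posI[OF assms this] have "0 < A $ 1 $ 1 * det A"
    by (simp add: inner_vec_def sum_2 matrix_vector_nth_2 v s det_2 algebra_simps)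
  then show ?thesis using a by (simp add: zero_less_mult_iff)
qed

text \<open>Completing the square with \<open>A\<inverse> = - R\<^sub>\<perp> A R\<^sub>\<perp> / det A\<close>.\<close>

lemma M8_tensor_SymPos_iff:
  fixes A :: mat2
  assumes A: "A \<in> SymPos"
  shows "I2 \<otimes>\<^sub>k A + t *\<^sub>R TT \<in> SymPos \<longleftrightarrow> t\<^sup>2 < det A"
proof -
  let ?L = "I2 \<otimes>\<^sub>k A + t *\<^sub>R TT" and ?d = "det A"
  have AS: "A \<in> Sym" using A by (simp add: SymPos_def)
  have d: "?d > 0" by (rule SymPos_det_pos[OF A])
  \<comment> \<open>This is the inverse of \<open>A\<close> applied to \<open>Rperp *v v\<close>,
    the centre of the square.\<close>
  define p where "p v = (1 / ?d) *\<^sub>R (Rperp *v (A *v v))" for v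
  have Ap: "A *v p v = Rperp *v v" for v
  proof -
    have "A *v (Rperp *v (A *v v)) = ?d *\<^sub>R (Rperp *v v)"
      using Sym_entry[OF AS, of 2 1]
      by (simp add: vec_eq_iff forall_2 matrix_vector_nth_2 det_2 algebra_simps)
    then show ?thesis using d by (simp add: p_def matrix_vector_mult_scaleR)
  qed
  have pp: "p v \<bullet> (Rperp *v v) = (v \<bullet> (A *v v)) / ?d" for v
    by (simp add: p_def inner_commute)
  have form: "e \<bullet> (?L *v e) = (tcomp 1 e - t *\<^sub>R p (tcomp 2 e)) \<bullet> (A *v (tcomp 1 e - t *\<^sub>R p (tcomp 2 e)))
      + (1 - t\<^sup>2 / ?d) * (tcomp 2 e \<bullet> (A *v tcomp 2 e))" for e
  proof -
    let ?u = "tcomp 1 e" and ?v = "tcomp 2 e"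
    have "e \<bullet> (?L *v e) = ?u \<bullet> (A *v ?u) + ?v \<bullet> (A *v ?v) - 2 * t * (?u \<bullet> (Rperp *v ?v))"
      using Rperp_skew[of ?v ?u]
      by (simp add: inner_tvec_2 tcomp_M8 inner_add_right inner_diff_right inner_commute[of "Rperp *v ?v"])
    moreover have "(?u - t *\<^sub>R p ?v) \<bullet> (A *v (?u - t *\<^sub>R p ?v))
        = ?u \<bullet> (A *v ?u) - 2 * t * (?u \<bullet> (Rperp *v ?v)) + t\<^sup>2 * ((?v \<bullet> (A *v ?v)) / ?d)"
      using Sym_inner_commute[OF AS, of "p ?v" ?u, symmetric]
      by (simp add: matrix_vector_mult_diff_distrib matrix_vector_mult_scaleR Ap inner_diff_left inner_diff_right
          pp inner_commute[of "Rperp *v ?v"] power2_eq_square right_diff_distrib)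
    ultimately show ?thesis by (simp add: algebra_simps)
  qed
  show ?thesis
  proof
    assume P: "?L \<in> SymPos"
    define v :: vec2 where "v = axis 1 1"
    have v: "v \<noteq> 0" by (simp add: v_def axis_eq_0_iff)
    \<comment> \<open>The square vanishes at this vector, leaving the factor
      \<open>1 - t\<^sup>2 / ?d\<close> alone.\<close>
    define e where "e = tpair (t *\<^sub>R p v) v"
    have "tcomp 2 e \<noteq> 0" using v by (simp add: e_def)
    then have "e \<noteq> 0" by auto
    from SymPos_posI[OF P this] have "0 < (1 - t\<^sup>2 / ?d) * (v \<bullet> (A *v v))"
      unfolding form by (simp add: e_def)
    then have "0 < 1 - t\<^sup>2 / ?d" using SymPos_posI[OF A v] by (simp add: zero_less_mult_iff)
    then show "t\<^sup>2 < ?d" using d by (simp add: field_simps)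
  next
    assume t: "t\<^sup>2 < ?d"
    then have c: "0 < 1 - t\<^sup>2 / ?d" using d by (simp add: field_simps)
    show "?L \<in> SymPos"
      unfolding SymPos_def qless_def
    proof (intro CollectI conjI allI impI M8_tensor_Sym AS)
      fix e :: tvec assume e: "e \<noteq> 0"
      have "0 < e \<bullet> (?L *v e)"
      proof (cases "tcomp 2 e = 0")
        case True
        then have "tcomp 1 e \<noteq> 0" using e by (auto simp: tvec_eq_iff forall_2)
        then have "0 < tcomp 1 e \<bullet> (A *v tcomp 1 e)" by (rule SymPos_posI[OF A])
        then show ?thesis unfolding form using True by (simp add: p_def)
      next
        case False
        have "0 < (1 - t\<^sup>2 / ?d) * (tcomp 2 e \<bullet> (A *v tcomp 2 e))"
          by (rule mult_pos_pos[OF c SymPos_posI[OF A False]])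
        then show ?thesis unfolding form by (rule add_nonneg_pos[OF SymPos_nonneg[OF A]])
      qed
      then show "e \<bullet> (0 *v e) < e \<bullet> (?L *v e)" by simp
    qed
  qed
qed

text \<open>Commuting with the quarter turn of the summands makes the diagonal blocks equal and the
  off-diagonal blocks opposite. Symmetry of \<open>L\<close> makes the latter skew, and a skew
  matrix in the plane is a multiple of \<open>Rperp\<close>.\<close>

lemma M8_eq: "M8 = {L \<in> SymPos. L ** (Rperp \<otimes>\<^sub>k I2) = (Rperp \<otimes>\<^sub>k I2) ** L}"
proof (intro equalityI subsetI)
  fix X assume "X \<in> M8"
  then obtain A t where X: "X = I2 \<otimes>\<^sub>k A + t *\<^sub>R TT" "A \<in> SymPos" "t\<^sup>2 < det A"
    by (auto simp: M8_def)
  have "(X ** (Rperp \<otimes>\<^sub>k I2)) *v e = ((Rperp \<otimes>\<^sub>k I2) ** X) *v e" for e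
    unfolding X(1) tvec_eq_iff forall_2 matrix_vector_mul_assoc[symmetric] tcomp_M8 tcomp_kron_Rperp_I2
    by simp
  then have "X ** (Rperp \<otimes>\<^sub>k I2) = (Rperp \<otimes>\<^sub>k I2) ** X" unfolding matrix_eq by blast
  then show "X \<in> {L \<in> SymPos. L ** (Rperp \<otimes>\<^sub>k I2) = (Rperp \<otimes>\<^sub>k I2) ** L}"
    using X M8_tensor_SymPos_iff by blast
next
  fix L assume "L \<in> {L \<in> SymPos. L ** (Rperp \<otimes>\<^sub>k I2) = (Rperp \<otimes>\<^sub>k I2) ** L}"
  then have L: "L \<in> SymPos" and c: "L ** (Rperp \<otimes>\<^sub>k I2) = (Rperp \<otimes>\<^sub>k I2) ** L" by auto
  let ?A = "blk 1 1 L" and ?B = "blk 1 2 L"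
  have cu: "?B *v u = - (blk 2 1 L *v u)" "blk 2 2 L *v u = ?A *v u" for u
  proof -
    have "L *v ((Rperp \<otimes>\<^sub>k I2) *v tpair u 0) = (Rperp \<otimes>\<^sub>k I2) *v (L *v tpair u 0)"
      using c by (simp add: matrix_vector_mul_assoc)
    moreover have "(Rperp \<otimes>\<^sub>k I2) *v tpair u 0 = tpair 0 u"
      by (simp add: tvec_eq_iff forall_2 tcomp_kron_Rperp_I2)
    ultimately have "L *v tpair 0 u = (Rperp \<otimes>\<^sub>k I2) *v (L *v tpair u 0)" by simp
    then have "tcomp 1 (L *v tpair 0 u) = - tcomp 2 (L *v tpair u 0)"
      "tcomp 2 (L *v tpair 0 u) = tcomp 1 (L *v tpair u 0)"
      by (simp_all only: tcomp_kron_Rperp_I2)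
    then show "?B *v u = - (blk 2 1 L *v u)" "blk 2 2 L *v u = ?A *v u"
      by (simp_all add: tcomp_blk sum_2)
  qed
  then have b22: "blk 2 2 L = ?A" by (simp add: matrix_eq)
  have LS: "L \<in> Sym" using L by (simp add: SymPos_def)
  have b21: "blk 2 1 L = transpose ?B"
    using Sym_entry[OF LS] by (simp add: blk_def transpose_def vec_eq_iff)
  define t where "t = ?B $ 1 $ 2"
  have skew: "?B $ i $ j = - ?B $ j $ i" for i j
  proof -
    have "(?B *v axis j 1) $ i = (- (transpose ?B *v axis j 1)) $ i" by (simp only: cu(1) b21)
    then show ?thesis by (simp add: matrix_vector_mult_basis column_def transpose_def)
  qed
  have z: "?B $ 1 $ 1 = 0" "?B $ 2 $ 2 = 0" "?B $ 2 $ 1 = - t"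
    using skew[of 1 1] skew[of 2 2] skew[of 2 1] by (simp_all add: t_def)
  have B: "?B *v u = - t *\<^sub>R (Rperp *v u)" for u
    by (simp add: vec_eq_iff forall_2 matrix_vector_nth_2 z t_def[symmetric])
  have "L *v e = (I2 \<otimes>\<^sub>k ?A + t *\<^sub>R TT) *v e" for e
    unfolding tvec_eq_iff forall_2 tcomp_M8 tcomp_blk[of _ L] sum_2 b22 B
    using cu(1)[of "tcomp 1 e"] B[of "tcomp 1 e"] by (simp add: algebra_simps)
  then have eq: "L = I2 \<otimes>\<^sub>k ?A + t *\<^sub>R TT" by (simp add: matrix_eq)
  have A: "?A \<in> SymPos" by (rule blk_11_SymPos[OF L])
  have "t\<^sup>2 < det ?A" using M8_tensor_SymPos_iff[OF A, of t] eq L by simp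
  with eq A show "L \<in> M8" unfolding M8_def by blast
qed

section \<open>Rotations\<close>

lemma kron_mult: "(A \<otimes>\<^sub>k B) ** (C \<otimes>\<^sub>k D) = (A ** C) \<otimes>\<^sub>k (B ** D)"
proof -
  have "((A \<otimes>\<^sub>k B) ** (C \<otimes>\<^sub>k D)) *v e = ((A ** C) \<otimes>\<^sub>k (B ** D)) *v e" for e
    unfolding matrix_vector_mul_assoc[symmetric] tvec_eq_iff tcomp_kron
    by (simp add: sum_2 matrix_matrix_mult_def matrix_vector_right_distrib matrix_vector_mult_scaleR
        matrix_vector_mul_assoc[symmetric] scaleR_add_left scaleR_add_right)
  then show ?thesis by (simp add: matrix_eq)
qed

lemma rotation_matrix_commutes_Rperp:
  fixes R :: mat2
  assumes "rotation_matrix R" shows "R ** Rperp = Rperp ** R"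
proof -
  have o: "transpose R ** R = I2" "det R = 1"
    using assms by (auto simp: rotation_matrix_def orthogonal_matrix_def)
  define a b c d where "a = R $ 1 $ 1" and "b = R $ 1 $ 2" and "c = R $ 2 $ 1" and "d = R $ 2 $ 2"
  have "a * a + c * c = 1" "b * b + d * d = 1" "a * d - b * c = 1"
    using o by (simp_all add: vec_eq_iff forall_2 matrix_matrix_mult_def transpose_def sum_2 mat_def det_2
        a_def b_def c_def d_def)
  \<comment> \<open>The left side is the sum of the squared column norms minus twice the
    determinant, that is 2 - 2.\<close>
  then have "(a - d)\<^sup>2 + (b + c)\<^sup>2 = 0" by (simp add: power2_eq_square algebra_simps)
  then have "a - d = 0" "b + c = 0" by (simp_all only: sum_power2_eq_zero_iff)
  then have "a = d" "b = - c" by linarith+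
  then show ?thesis
    by (simp add: vec_eq_iff forall_2 matrix_matrix_mult_def sum_2 a_def b_def c_def d_def)
qed

locale rotation =
  fixes R :: mat2
  assumes rot: "rotation_matrix R"
begin

definition P :: tmat where "P = I2 \<otimes>\<^sub>k R"
definition P' :: tmat where "P' = I2 \<otimes>\<^sub>k transpose R"

lemma R_orthogonal: "transpose R ** R = I2" "R ** transpose R = I2"
  using rot by (auto simp: rotation_matrix_def orthogonal_matrix_def)

lemma R_commute: "R ** Rperp = Rperp ** R" "transpose R ** Rperp = Rperp ** transpose R"
proof -
  show 1: "R ** Rperp = Rperp ** R" by (rule rotation_matrix_commutes_Rperp[OF rot])
  have "transpose R ** (Rperp ** R) ** transpose R = transpose R ** (R ** Rperp) ** transpose R" by (simp add: 1)
  then have "transpose R ** Rperp ** (R ** transpose R) = (transpose R ** R) ** Rperp ** transpose R"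
    by (simp only: matrix_mul_assoc)
  then show "transpose R ** Rperp = Rperp ** transpose R" by (simp add: R_orthogonal)
qed

lemma tcomp_P [simp]: "tcomp a (P *v e) = R *v tcomp a e" "tcomp a (P' *v e) = transpose R *v tcomp a e"
  by (simp_all add: P_def P'_def tcomp_I2_kron)

lemma P_inverse [simp]: "P *v (P' *v e) = e" "P' *v (P *v e) = e"
  unfolding tvec_eq_iff tcomp_P by (simp_all add: matrix_vector_mul_assoc R_orthogonal)

lemma P_commute_Rperp:
  "P *v (A \<otimes>\<^sub>k Rperp *v e) = A \<otimes>\<^sub>k Rperp *v (P *v e)" "P' *v (A \<otimes>\<^sub>k Rperp *v e) = A \<otimes>\<^sub>k Rperp *v (P' *v e)"
  by (simp_all add: matrix_vector_mul_assoc P_def P'_def kron_mult R_commute)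

lemma P_commute_I2:
  "P *v (A \<otimes>\<^sub>k I2 *v e) = A \<otimes>\<^sub>k I2 *v (P *v e)" "P' *v (A \<otimes>\<^sub>k I2 *v e) = A \<otimes>\<^sub>k I2 *v (P' *v e)"
  by (simp_all add: matrix_vector_mul_assoc P_def P'_def kron_mult)

lemma P_inner: "(P *v e) \<bullet> f = e \<bullet> (P' *v f)"
  by (simp add: inner_tvec inner_transpose)

lemma conj_apply: "(P ** L ** P') *v e = P *v (L *v (P' *v e))"
  by (simp only: matrix_vector_mul_assoc matrix_mul_assoc)

text \<open>Rotations commute with the quarter turn, so \<open>TT\<close> is fixed by the
  conjugation and relations in \<open>L - TT\<close> are transported along with
  \<open>L\<close>.\<close>

lemma conj_TT_apply: "(P ** L ** P' - TT) *v e = P *v ((L - TT) *v (P' *v e))"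
  using P_commute_Rperp(1)[of Rperp "P' *v e"]
  by (simp add: matrix_vector_mult_diff_rdistrib matrix_vector_mult_diff_distrib conj_apply TT_def)

lemma conj_SymPos:
  assumes "L \<in> SymPos" shows "P ** L ** P' \<in> SymPos"
  unfolding SymPos_def qless_def
proof (intro CollectI conjI allI impI SymI)
  have LS: "L \<in> Sym" using assms by (simp add: SymPos_def)
  fix v w
  have "(P *v (L *v (P' *v v))) \<bullet> w = (P' *v v) \<bullet> (L *v (P' *v w))"
    unfolding P_inner by (rule Sym_inner_commute[OF LS])
  also have "\<dots> = v \<bullet> (P *v (L *v (P' *v w)))"
    using P_inner[of "L *v (P' *v w)" v] by (simp add: inner_commute)
  finally show "((P ** L ** P') *v v) \<bullet> w = v \<bullet> ((P ** L ** P') *v w)"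
    by (simp only: conj_apply)
next
  fix v :: tvec assume "v \<noteq> 0"
  then have "P' *v v \<noteq> 0" by (metis P_inverse(1) matrix_vector_mult_0_right)
  then have "0 < (P' *v v) \<bullet> (L *v (P' *v v))" by (rule SymPos_posI[OF assms])
  also have "\<dots> = v \<bullet> (P *v (L *v (P' *v v)))"
    using P_inner[of "L *v (P' *v v)" v] by (simp add: inner_commute)
  finally show "v \<bullet> (0 *v v) < v \<bullet> ((P ** L ** P') *v v)" by (simp add: conj_apply)
qed

lemma conj_duality:
  assumes "L ** (A \<otimes>\<^sub>k Rperp) ** L = A \<otimes>\<^sub>k Rperp"
  shows "(P ** L ** P') ** (A \<otimes>\<^sub>k Rperp) ** (P ** L ** P') = A \<otimes>\<^sub>k Rperp"
proof -
  have a: "L *v (A \<otimes>\<^sub>k Rperp *v (L *v e)) = A \<otimes>\<^sub>k Rperp *v e" for e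
    using assms by (simp add: matrix_vector_mul_assoc matrix_mul_assoc)
  have "((P ** L ** P') ** (A \<otimes>\<^sub>k Rperp) ** (P ** L ** P')) *v e = (A \<otimes>\<^sub>k Rperp) *v e" for e
    unfolding matrix_vector_mul_assoc[symmetric] by (simp add: P_commute_Rperp a)
  then show ?thesis by (simp add: matrix_eq)
qed

lemma conj_null_duality:
  assumes "(L - TT) ** (A \<otimes>\<^sub>k Rperp) ** (L - TT) = 0"
  shows "(P ** L ** P' - TT) ** (A \<otimes>\<^sub>k Rperp) ** (P ** L ** P' - TT) = 0"
proof -
  have a: "(L - TT) *v (A \<otimes>\<^sub>k Rperp *v ((L - TT) *v e)) = 0" for e
    using assms by (simp add: matrix_vector_mul_assoc matrix_mul_assoc)
  have "((P ** L ** P' - TT) ** (A \<otimes>\<^sub>k Rperp) ** (P ** L ** P' - TT)) *v e = 0" for e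
    unfolding matrix_vector_mul_assoc[symmetric] conj_TT_apply by (simp add: P_commute_Rperp a)
  then show ?thesis by (simp add: matrix_eq)
qed

lemma conj_commute:
  assumes "L ** (A \<otimes>\<^sub>k I2) = (A \<otimes>\<^sub>k I2) ** L"
  shows "(P ** L ** P') ** (A \<otimes>\<^sub>k I2) = (A \<otimes>\<^sub>k I2) ** (P ** L ** P')"
proof -
  have a: "L *v (A \<otimes>\<^sub>k I2 *v e) = A \<otimes>\<^sub>k I2 *v (L *v e)" for e
    using assms by (simp add: matrix_vector_mul_assoc)
  have "((P ** L ** P') ** (A \<otimes>\<^sub>k I2)) *v e = ((A \<otimes>\<^sub>k I2) ** (P ** L ** P')) *v e" for e
    unfolding matrix_vector_mul_assoc[symmetric] by (simp add: P_commute_I2 a)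
  then show ?thesis unfolding matrix_eq by blast
qed

lemma conj_kernel_graph:
  assumes "kernel_graph L M" shows "kernel_graph (P ** L ** P') (R ** M ** transpose R)"
  unfolding kernel_graph_def conj_TT_apply
proof
  fix v
  have "P' *v tpair (- ((R ** M ** transpose R) *v v)) v = tpair (- (M *v (transpose R *v v))) (transpose R *v v)"
    by (simp add: tvec_eq_iff forall_2 matrix_vector_mul_assoc matrix_mul_assoc R_orthogonal)
  then show "P *v ((L - TT) *v (P' *v tpair (- ((R ** M ** transpose R) *v v)) v)) = 0"
    using assms by (simp add: kernel_graph_def)
qed

lemma conj_kernel_graph_Rperp:
  assumes "kernel_graph L Rperp" shows "kernel_graph (P ** L ** P') Rperp"
proof -
  have "R ** Rperp ** transpose R = Rperp ** (R ** transpose R)"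
    by (simp only: R_commute(1) matrix_mul_assoc)
  then show ?thesis using conj_kernel_graph[OF assms] by (simp add: R_orthogonal)
qed

end

section \<open>Reduction of both properties to the defining relation\<close>

lemma rotationally_invariantI:
  assumes "\<And>L R. L \<in> \<M> \<Longrightarrow> rotation R \<Longrightarrow> rotation.P R ** L ** rotation.P' R \<in> \<M>"
  shows "rotationally_invariant \<M>"
  unfolding rotationally_invariant_def
proof (intro ballI allI impI)
  fix L and R :: mat2 assume "L \<in> \<M>" "rotation_matrix R"
  then interpret rotation R by unfold_locales
  show "(I2 \<otimes>\<^sub>k R) ** L ** (I2 \<otimes>\<^sub>k transpose R) \<in> \<M>"
    using assms[OF \<open>L \<in> \<M>\<close> rotation_axioms] by (simp add: P_def P'_def)
qed

text \<open>Symmetry and positivity of the effective tensor come for free, so only the relation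
  itself has to be inherited, and it may be assumed on the cell alone.\<close>

lemma exact_relationI:
  assumes "\<And>L. composite L \<Longrightarrow> AE x in cell. Q (L x) \<Longrightarrow> Q (effective_tensor L)"
  shows "exact_relation {L \<in> SymPos. Q L}"
  unfolding exact_relation_def
proof (intro conjI allI impI)
  fix L assume "composite L \<and> (AE x in lebesgue. L x \<in> {L \<in> SymPos. Q L})"
  then have L: "composite L" and ae: "AE x in lebesgue. L x \<in> {L \<in> SymPos. Q L}" by auto
  have "AE x in cell. Q (L x)"
    using ae by (auto simp: AE_restrict_space_iff elim: eventually_mono)
  then show "effective_tensor L \<in> {L \<in> SymPos. Q L}"
    using assms[OF L] effective_tensor_SymPos[OF L] by simp
qed auto

theorem mainTheorem1:
  shows "(rotationally_invariant M8 \<and> exact_relation M8)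
    \<and> (rotationally_invariant M13 \<and> exact_relation M13)
    \<and> (rotationally_invariant M17 \<and> exact_relation M17)
    \<and> (rotationally_invariant M19 \<and> exact_relation M19)
    \<and> (rotationally_invariant M20 \<and> exact_relation M20)
    \<and> (rotationally_invariant M21 \<and> exact_relation M21)
    \<and> (rotationally_invariant M22 \<and> exact_relation M22)
    \<and> M20 = M20_param"
proof (intro conjI)
  show "rotationally_invariant M8" unfolding M8_eq
    by (rule rotationally_invariantI) (simp add: rotation.conj_SymPos rotation.conj_commute)
  show "exact_relation M8" unfolding M8_eq
    by (rule exact_relationI) (rule effective_tensor_commute)
  show "rotationally_invariant M13" unfolding M13_eq
    by (rule rotationally_invariantI) (simp add: rotation.conj_SymPos rotation.conj_kernel_graph_Rperp)
  show "exact_relation M13" unfolding M13_eq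
  proof (rule exact_relationI)
    fix L assume L: "composite L" "AE x in cell. kernel_graph (L x) Rperp"
    show "kernel_graph (effective_tensor L) Rperp"
      unfolding kernel_graph_def
    proof
      fix v
      \<comment> \<open>For fixed \<open>v\<close> the kernel vector does not depend on
        \<open>x\<close>, so the constant-field argument applies.\<close>
      have "AE x in cell. (L x - TT) *v tpair (- (Rperp *v v)) v = 0"
        using L(2) by eventually_elim (simp add: kernel_graph_def)
      then show "(effective_tensor L - TT) *v tpair (- (Rperp *v v)) v = 0"
        by (rule effective_tensor_kernel[OF L(1)])
    qed
  qed
  show "rotationally_invariant M17" unfolding M17_def
    by (rule rotationally_invariantI) (simp add: rotation.conj_SymPos rotation.conj_duality)
  show "exact_relation M17" unfolding M17_def
    by (rule exact_relationI) (rule effective_tensor_duality)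
  show "rotationally_invariant M19" unfolding M19_eq
    by (rule rotationally_invariantI) (simp add: rotation.conj_SymPos rotation.conj_null_duality)
  show "exact_relation M19" unfolding M19_eq
    by (rule exact_relationI) (simp add: effective_tensor_null_duality)
  show "rotationally_invariant M20" unfolding M20_def
    by (rule rotationally_invariantI) (simp add: rotation.conj_SymPos rotation.conj_null_duality)
  show "exact_relation M20" unfolding M20_def
    by (rule exact_relationI) (rule effective_tensor_null_duality)
  show "rotationally_invariant M21" unfolding M21_eq
  proof (rule rotationally_invariantI)
    fix L R assume L: "L \<in> {L \<in> SymPos. \<exists>M. kernel_graph L M}" and R: "rotation R"
    then obtain M where "kernel_graph L M" by blast
    from rotation.conj_kernel_graph[OF R this] rotation.conj_SymPos[OF R] L
    show "rotation.P R ** L ** rotation.P' R \<in> {L \<in> SymPos. \<exists>M. kernel_graph L M}" by blast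
  qed
  show "exact_relation M21" unfolding M21_eq
    by (rule exact_relationI) (rule effective_tensor_kernel_graph)
  show "rotationally_invariant M22" unfolding M22_def
    by (rule rotationally_invariantI) (simp add: rotation.conj_SymPos rotation.conj_duality)
  show "exact_relation M22" unfolding M22_def
    by (rule exact_relationI) (rule effective_tensor_duality)
  show "M20 = M20_param" by (rule M20_eq_M20_param)
qed

end
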